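(* For every $a\in C^\infty(\mathbb{T}^2)$ there is a constant $C(a)$, depending only on $a$, such that for every even integer $N\geq 2$ and every orthonormal basis $\{\varphi_{N,j}\}_{j=0}^{N-1}$ of $\mathcal{H}_N$ consisting of eigenvectors of the quantum baker's map $\hat B_N$, the quantum variance $$S_2(a,N):=\frac1N\sum_{j=0}^{N-1}\Big|\langle\varphi_{N,j},\mathrm{Op}^{\mathrm W}_N(a)\varphi_{N,j}\rangle-\int_{\mathbb{T}^2}a(q,p)\,dq\,dp\Big|^2$$ satisfies $$S_2(a,N)\leq\frac{C(a)}{\log N}.$$
   Context: $\mathbb{T}^2=\mathbb{R}^2/\mathbb{Z}^2$, with points $\mathbf{x}=(q,p)$. For an integer $N\ge1$ (inverse Planck constant, $\hbar=(2\pi N)^{-1}$), $\mathcal{H}_N$ is an $N$-dimensional complex Hilbert space identified with $\mathbb{C}^N$ through an orthonormal "position" basis $\{\mathbf{q}_j\}_{j=0}^{N-1}$ (indices understood mod $N$); the inner product is antilinear in the first argument. Discrete Fourier transform: $\hat F_N$ is the unitary $N\times N$ matrix $(\hat F_N)_{kj}=N^{-1/2}e^{-2\pi i kj/N}$, $0\le k,j\le N-1$. Quantum baker's map: for $N$ even, in the basis $\{\mathbf{q}_j\}$, $$\hat B_N:=\hat F_N^{-1}\begin{pmatrix}\hat F_{N/2}&0\\0&\hat F_{N/2}\end{pmatrix},$$ a unitary matrix. Weyl quantisation: for $\mathbf{k}=(k_1,k_2)\in\mathbb{Z}^2$ let $T(\mathbf{k})$ be the unitary operator on $\mathcal{H}_N$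 with $T(\mathbf{k})\mathbf{q}_j=e^{i\pi k_1k_2/N}e^{2\pi i k_2 j/N}\,\mathbf{q}_{j+k_1}$. For $f\in C^\infty(\mathbb{T}^2)$ with Fourier expansion $f(q,p)=\sum_{\mathbf{k}\in\mathbb{Z}^2}\tilde f(\mathbf{k})e^{2\pi i(qk_2-pk_1)}$, set $\mathrm{Op}^{\mathrm W}_N(f):=\sum_{\mathbf{k}\in\mathbb{Z}^2}\tilde f(\mathbf{k})\,T(\mathbf{k})$. *)

theory Defs
  imports
    "HOL-Analysis.Analysis"
    "Jordan_Normal_Form.VS_Connect"
    "Jordan_Normal_Form.Char_Poly"
    "Jordan_Normal_Form.Gauss_Jordan_Elimination"
begin

text \<open>
  Functions on the torus $\mathbb{T}^2$ are $\mathbb{Z}^2$-periodic functions of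
  \<open>(q, p) :: real \<times> real\<close>.  A function is $C^{k+1}$ iff both partial derivatives exist
  everywhere and are $C^k$; since continuous partial derivatives imply differentiability,
  continuity need only be demanded at level \<open>0\<close>.
\<close>

primrec C_k :: "nat \<Rightarrow> (real \<times> real \<Rightarrow> complex) \<Rightarrow> bool" where
  "C_k 0 f \<longleftrightarrow> continuous_on UNIV f"
| "C_k (Suc k) f \<longleftrightarrow>
     (\<exists>f\<^sub>q f\<^sub>p.
        (\<forall>q p. ((\<lambda>t. f (t, p)) has_vector_derivative f\<^sub>q (q, p)) (at q)) \<and>
        (\<forall>q p. ((\<lambda>t. f (q, t)) has_vector_derivative f\<^sub>p (q, p)) (at p)) \<and>
        C_k k f\<^sub>q \<and> C_k k f\<^sub>p)"

definition smooth_torus :: "(real \<times> real \<Rightarrow> complex) \<Rightarrow> bool" where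
  "smooth_torus f \<longleftrightarrow>
     (\<forall>q p. f (q + 1, p) = f (q, p) \<and> f (q, p + 1) = f (q, p)) \<and> (\<forall>k. C_k k f)"

definition torus_integral :: "(real \<times> real \<Rightarrow> complex) \<Rightarrow> complex" where
  "torus_integral f = integral (cbox (0, 0) (1, 1)) f"

text \<open>
  The coefficients of $f(q,p)=\sum_{k} \tilde f(k)\, e^{2\pi i(q k_2-p k_1)}$.
\<close>

definition fourier_coeff :: "(real \<times> real \<Rightarrow> complex) \<Rightarrow> int \<times> int \<Rightarrow> complex" where
  "fourier_coeff f = (\<lambda>(k1, k2).
     torus_integral (\<lambda>(q, p). f (q, p) * cis (- 2 * pi * (q * of_int k2 - p * of_int k1))))"

text \<open>
  The space $\mathcal{H}_N$ is \<open>carrier_vec N\<close> over the complex numbers, with position basis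
  \<open>unit_vec N j\<close>.  The library's \<open>\<bullet>c\<close> is antilinear in its second argument, hence the swap.
\<close>

definition inner_H :: "complex Matrix.vec \<Rightarrow> complex Matrix.vec \<Rightarrow> complex" where
  "inner_H v w = w \<bullet>c v"

definition orthonormal_basis_H :: "nat \<Rightarrow> (nat \<Rightarrow> complex Matrix.vec) \<Rightarrow> bool" where
  "orthonormal_basis_H N \<phi> \<longleftrightarrow>
     (\<forall>j<N. \<phi> j \<in> carrier_vec N) \<and>
     (\<forall>i<N. \<forall>j<N. inner_H (\<phi> i) (\<phi> j) = (if i = j then 1 else 0)) \<and>
     vectorspace.basis class_ring (module_vec TYPE(complex) N) (\<phi> ` {..<N})"

definition dft :: "nat \<Rightarrow> complex Matrix.mat" where
  "dft N = Matrix.mat N N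
     (\<lambda>(k, j). cis (- 2 * pi * real k * real j / real N) / complex_of_real (sqrt (real N)))"

text \<open>Meaningful for even \<open>N\<close> only.\<close>

definition baker :: "nat \<Rightarrow> complex Matrix.mat" where
  "baker N = the (mat_inverse (dft N)) *
     four_block_mat (dft (N div 2)) (0\<^sub>m (N div 2) (N div 2))
                    (0\<^sub>m (N div 2) (N div 2)) (dft (N div 2))"

text \<open>
  Column \<open>j\<close> is the image of the \<open>j\<close>-th position vector; the row index \<open>j + k\<^sub>1\<close> is taken
  modulo \<open>N\<close>.
\<close>

definition weyl_translation :: "nat \<Rightarrow> int \<times> int \<Rightarrow> complex Matrix.mat" where
  "weyl_translation N = (\<lambda>(k1, k2). Matrix.mat N N (\<lambda>(i, j).
     if int i = (int j + k1) mod int N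
     then cis (pi * of_int k1 * of_int k2 / real N) * cis (2 * pi * of_int k2 * real j / real N)
     else 0))"

text \<open>
  The operator series is summed entrywise, which on a finite-dimensional space is convergence
  in operator norm.
\<close>

definition weyl_op :: "nat \<Rightarrow> (real \<times> real \<Rightarrow> complex) \<Rightarrow> complex Matrix.mat" where
  "weyl_op N f = Matrix.mat N N (\<lambda>(i, j).
     \<Sum>\<^sub>\<infinity>k\<in>UNIV. fourier_coeff f k * weyl_translation N k $$ (i, j))"

definition quantum_variance ::
    "(real \<times> real \<Rightarrow> complex) \<Rightarrow> nat \<Rightarrow> (nat \<Rightarrow> complex Matrix.vec) \<Rightarrow> real" where
  "quantum_variance a N \<phi> =
     1 / real N * (\<Sum>j<N. (cmod (inner_H (\<phi> j) (weyl_op N a *\<^sub>v \<phi> j) - torus_integral a))\<^sup>2)"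

end

theory Submission
  imports Defs
begin

text \<open>
  In every eigenbasis of the baker matrix \<open>B\<close> the diagonal matrix elements of \<open>A\<close> and
  \<open>B\<^sup>* A B\<close> agree, so the quantum variance is bounded by the normalised Hilbert--Schmidt norm of
  any time average of \<open>A\<close>, and it suffices to show that time evolution decorrelates \<open>A\<close>.

  The first binary digit of the position gives a diagonal reflection \<open>Z\<close>.  The squared entries
  of \<open>B\<close> decay quadratically away from the graph of the doubling map, hence \<open>Z\<close> evolved for \<open>i\<close>
  steps is close, in normalised Hilbert--Schmidt norm, to the reflection of the digit number
  \<open>i + 1\<close> of the position as long as \<open>2\<^sup>i\<close> is at most a small power of \<open>N\<close>; time reversal gives
  the same for the digits of the momentum.  Products of distinct evolved reflections thus behave
  like Walsh functions: those with different time shifts are almost orthogonal, and the time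
  average over \<open>m\<close> steps of such a product has squared norm about \<open>1/m\<close>.

  Writing \<open>exp (2 \<pi> i k x)\<close> as the product over the binary digits of \<open>x\<close> expands a Weyl
  translation into such products, with coefficients of polynomially bounded \<open>l\<^sup>1\<close> norm and
  vanishing constant term.  With \<open>m\<close> a small multiple of \<open>log N\<close> this gives the variance bound for Weyl
  translations, and the rapidly decaying Fourier coefficients of \<open>a\<close> allow summation over them.
\<close>

subsection \<open>Normalised Hilbert--Schmidt norm\<close>

text \<open>The baker map and the digit functions are discontinuous, so evolution is followed only
  in mean square; this is enough because \<open>rms_diag\<close> is bounded by \<open>hs\<close>.
  Unitary conjugation preserves \<open>hs\<close>, so the errors of successive steps and factors
  simply add, and \<open>i\<close> steps cost a constant times \<open>2 ^ i * eta M\<close>. This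
  confines the argument to times of order \<open>log N\<close>; the squared norm
  \<open>1 / m\<close> of an average over that many steps is the source of the logarithm.

  As \<open>N\<close> is any even number, the digit functions on \<open>N\<close> points need not be
  independent and Walsh functions need not have mean zero. What remains exact is that translation by
  \<open>N / 2\<close> flips the first digit and fixes all others; orthogonality of words is reduced
  to this fact.

  Evolved reflections at different times need not commute, so words are ordered by time. A Weyl
  translation is a function of momentum times a function of position. The momentum digits carry
  negative times, so the operator is evolved by \<open>m\<close> further steps, and the momentum
  digits are taken in reverse order to make the whole product time-ordered.\<close>

definition adj :: "complex mat \<Rightarrow> complex mat" where
  "adj A = Matrix.mat (dim_col A) (dim_row A) (\<lambda>(i, j). cnj (A $$ (j, i)))"

text \<open>Dividing by the dimension gives unitary matrices of positive dimension norm
  \<open>1\<close>, so that all bounds compare directly for different \<open>N\<close>.\<close>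

definition ip :: "complex mat \<Rightarrow> complex mat \<Rightarrow> complex" where
  "ip A B = (\<Sum>i<dim_row A. \<Sum>j<dim_col A. cnj (A $$ (i, j)) * B $$ (i, j)) / of_nat (dim_row A)"

definition hs :: "complex mat \<Rightarrow> real" where
  "hs A = L2_set (\<lambda>p. cmod (A $$ p)) ({..<dim_row A} \<times> {..<dim_col A}) / sqrt (real (dim_row A))"

definition unitary_mat :: "nat \<Rightarrow> complex mat \<Rightarrow> bool" where
  "unitary_mat n U \<longleftrightarrow> U \<in> carrier_mat n n \<and> adj U * U = 1\<^sub>m n"

lemma adj_carrier [simp]: "A \<in> carrier_mat n m \<Longrightarrow> adj A \<in> carrier_mat m n"
  by (auto simp: adj_def)

lemma adj_dim [simp]: "dim_row (adj A) = dim_col A" "dim_col (adj A) = dim_row A"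
  by (auto simp: adj_def)

lemma adj_index: "i < dim_col A \<Longrightarrow> j < dim_row A \<Longrightarrow> adj A $$ (i, j) = cnj (A $$ (j, i))"
  by (auto simp: adj_def)

lemma adj_adj [simp]: "adj (adj A) = A"
  by (rule eq_matI) (auto simp: adj_def)

lemma index_mult_sum:
  assumes "A \<in> carrier_mat n m" "B \<in> carrier_mat m l" "i < n" "j < l"
  shows "(A * B) $$ (i, j) = (\<Sum>k<m. A $$ (i, k) * B $$ (k, j))"
  using assms by (auto simp: scalar_prod_def lessThan_atLeast0 intro!: sum.cong)

lemma mult_carrier_square [simp]:
  "A \<in> carrier_mat n n \<Longrightarrow> B \<in> carrier_mat n n \<Longrightarrow> A * B \<in> carrier_mat n n"
  by (rule mult_carrier_mat)

lemma minus_carrier_square [simp]: "B \<in> carrier_mat n m \<Longrightarrow> A - B \<in> carrier_mat n m"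
  by (rule minus_carrier_mat)

lemma left_mult_one_square [simp]: "(A :: 'a :: semiring_1 mat) \<in> carrier_mat n n \<Longrightarrow> 1\<^sub>m n * A = A"
  by simp

lemma adj_mult:
  assumes "A \<in> carrier_mat n m" "B \<in> carrier_mat m l"
  shows "adj (A * B) = adj B * adj A"
proof (rule eq_matI)
  fix i j assume "i < dim_row (adj B * adj A)" "j < dim_col (adj B * adj A)"
  then have ij: "i < l" "j < n" using assms by auto
  have "adj (A * B) $$ (i, j) = cnj ((A * B) $$ (j, i))"
    using assms ij by (intro adj_index) auto
  also have "\<dots> = (\<Sum>k<m. cnj (A $$ (j, k)) * cnj (B $$ (k, i)))"
    using assms ij by (subst index_mult_sum) auto
  also have "\<dots> = (\<Sum>k<m. adj B $$ (i, k) * adj A $$ (k, j))"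
    using assms ij by (intro sum.cong refl) (auto simp: adj_index mult.commute)
  also have "\<dots> = (adj B * adj A) $$ (i, j)"
    using assms ij by (subst index_mult_sum) auto
  finally show "adj (A * B) $$ (i, j) = (adj B * adj A) $$ (i, j)" .
qed (use assms in auto)

lemma adj_one [simp]: "adj (1\<^sub>m n) = 1\<^sub>m n"
  by (rule eq_matI) (auto simp: adj_def)

lemma adj_smult: "adj (c \<cdot>\<^sub>m A) = cnj c \<cdot>\<^sub>m adj A"
  by (rule eq_matI) (auto simp: adj_def)

lemma unitary_mat_carrier: "unitary_mat n U \<Longrightarrow> U \<in> carrier_mat n n"
  by (simp add: unitary_mat_def)

lemma unitary_mat_left: "unitary_mat n U \<Longrightarrow> adj U * U = 1\<^sub>m n"
  by (simp add: unitary_mat_def)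

lemma unitary_mat_right: "unitary_mat n U \<Longrightarrow> U * adj U = 1\<^sub>m n"
  unfolding unitary_mat_def by (metis adj_carrier mat_mult_left_right_inverse)

lemma unitary_mat_adj: "unitary_mat n U \<Longrightarrow> unitary_mat n (adj U)"
  using unitary_mat_right[of n U] unitary_mat_carrier[of n U] by (simp add: unitary_mat_def)

lemma unitary_mat_one [simp]: "unitary_mat n (1\<^sub>m n)"
  by (simp add: unitary_mat_def)

lemma unitary_mat_mult:
  assumes "unitary_mat n U" "unitary_mat n V"
  shows "unitary_mat n (U * V)"
proof -
  note [simp] = unitary_mat_carrier[OF assms(1)] unitary_mat_carrier[OF assms(2)]
  have "adj (U * V) * (U * V) = adj V * adj U * (U * V)"
    by (simp add: adj_mult[of U n n V n])
  also have "\<dots> = adj V * (adj U * (U * V))"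
    by (rule assoc_mult_mat[of _ n n _ n _ n]) auto
  also have "adj U * (U * V) = adj U * U * V"
    by (rule assoc_mult_mat[of _ n n _ n _ n, symmetric]) auto
  finally show ?thesis
    using assms by (simp add: unitary_mat_def)
qed

lemma unitary_mat_smult: "unitary_mat n U \<Longrightarrow> cmod c = 1 \<Longrightarrow> unitary_mat n (c \<cdot>\<^sub>m U)"
proof -
  assume U: "unitary_mat n U" and c: "cmod c = 1"
  note [simp] = unitary_mat_carrier[OF U]
  have c1: "cnj c * c = 1"
    using c complex_norm_square[of c] by (simp add: mult.commute)
  have "(cnj c \<cdot>\<^sub>m adj U) * (c \<cdot>\<^sub>m U) = cnj c \<cdot>\<^sub>m (adj U * (c \<cdot>\<^sub>m U))"
    by (rule mult_smult_assoc_mat[of _ n n _ n]) auto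
  also have "adj U * (c \<cdot>\<^sub>m U) = c \<cdot>\<^sub>m (adj U * U)"
    by (rule mult_smult_distrib[of _ n n _ n]) auto
  also have "cnj c \<cdot>\<^sub>m \<dots> = adj U * U"
    by (intro eq_matI) (simp_all add: mult.assoc[symmetric] c1 del: index_mult_mat)
  finally show ?thesis using U by (simp add: unitary_mat_def adj_smult)
qed

lemma adj_mult_index:
  assumes "A \<in> carrier_mat n m" "B \<in> carrier_mat n l" "i < m" "j < l"
  shows "(adj A * B) $$ (i, j) = (\<Sum>k<n. cnj (A $$ (k, i)) * B $$ (k, j))"
  using assms by (subst index_mult_sum[of _ m n _ l]) (auto simp: adj_index simp del: index_mult_mat)

section \<open>The inner product and norm under unitary multiplication\<close>

lemma ip_trace:
  assumes "A \<in> carrier_mat n n" "B \<in> carrier_mat n n"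
  shows "ip A B = (\<Sum>j<n. (adj A * B) $$ (j, j)) / of_nat n"
proof -
  have "(\<Sum>j<n. (adj A * B) $$ (j, j)) = (\<Sum>j<n. \<Sum>k<n. cnj (A $$ (k, j)) * B $$ (k, j))"
    using assms by (intro sum.cong refl) (simp add: adj_mult_index del: index_mult_mat)
  also have "\<dots> = (\<Sum>i<n. \<Sum>j<n. cnj (A $$ (i, j)) * B $$ (i, j))"
    by (rule sum.swap)
  finally show ?thesis using assms by (simp add: ip_def)
qed

lemma hs_nonneg [simp]: "0 \<le> hs A"
  by (simp add: hs_def L2_set_nonneg)

lemma hs_power2:
  assumes "A \<in> carrier_mat n n"
  shows "(hs A)\<^sup>2 = (\<Sum>i<n. \<Sum>j<n. (cmod (A $$ (i, j)))\<^sup>2) / real n"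
  using assms
  by (simp add: hs_def power_divide L2_set_def sum_nonneg sum.cartesian_product case_prod_unfold)

lemma ip_self: "A \<in> carrier_mat n n \<Longrightarrow> ip A A = of_real ((hs A)\<^sup>2)"
proof -
  assume A: "A \<in> carrier_mat n n"
  have *: "cnj z * z = of_real ((cmod z)\<^sup>2)" for z
    by (metis complex_norm_square mult.commute)
  show ?thesis using A unfolding hs_power2[OF A] ip_def * by simp
qed

lemma ip_commute:
  assumes "A \<in> carrier_mat n n" "B \<in> carrier_mat n n"
  shows "ip B A = cnj (ip A B)"
  using assms by (simp add: ip_def mult.commute)

lemma ip_bound:
  assumes "A \<in> carrier_mat n n" "B \<in> carrier_mat n n"
  shows "cmod (ip A B) \<le> hs A * hs B"
proof -
  let ?I = "{..<n} \<times> {..<n}"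
  have "cmod (\<Sum>p\<in>?I. cnj (A $$ p) * B $$ p) \<le> (\<Sum>p\<in>?I. \<bar>cmod (A $$ p)\<bar> * \<bar>cmod (B $$ p)\<bar>)"
    by (rule order_trans[OF norm_sum]) (simp add: norm_mult)
  also have "\<dots> \<le> L2_set (\<lambda>p. cmod (A $$ p)) ?I * L2_set (\<lambda>p. cmod (B $$ p)) ?I"
    by (rule L2_set_mult_ineq)
  finally have "cmod (\<Sum>p\<in>?I. cnj (A $$ p) * B $$ p) / real n
      \<le> L2_set (\<lambda>p. cmod (A $$ p)) ?I * L2_set (\<lambda>p. cmod (B $$ p)) ?I / real n"
    by (rule divide_right_mono) simp
  then show ?thesis using assms by (simp add: ip_def hs_def norm_divide case_prod_unfold sum.cartesian_product)
qed

lemma ip_add_right: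
  assumes "A \<in> carrier_mat n n" "B \<in> carrier_mat n n" "C \<in> carrier_mat n n"
  shows "ip A (B + C) = ip A B + ip A C"
  using assms by (simp add: ip_def add_divide_distrib sum.distrib distrib_left)

lemma ip_diff_right:
  assumes "A \<in> carrier_mat n n" "B \<in> carrier_mat n n" "C \<in> carrier_mat n n"
  shows "ip A (B - C) = ip A B - ip A C"
  using assms by (simp add: ip_def diff_divide_distrib sum_subtractf right_diff_distrib)

lemma ip_add_left:
  assumes "A \<in> carrier_mat n n" "B \<in> carrier_mat n n" "C \<in> carrier_mat n n"
  shows "ip (B + C) A = ip B A + ip C A"
  using assms by (simp add: ip_def add_divide_distrib sum.distrib distrib_right)

lemma ip_diff_left:
  assumes "A \<in> carrier_mat n n" "B \<in> carrier_mat n n" "C \<in> carrier_mat n n"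
  shows "ip (B - C) A = ip B A - ip C A"
  using assms by (simp add: ip_def diff_divide_distrib sum_subtractf left_diff_distrib)

lemma hs_add:
  assumes "A \<in> carrier_mat n n" "B \<in> carrier_mat n n"
  shows "hs (A + B) \<le> hs A + hs B"
proof -
  let ?I = "{..<n} \<times> {..<n}"
  have "L2_set (\<lambda>p. cmod ((A + B) $$ p)) ?I \<le> L2_set (\<lambda>p. cmod (A $$ p) + cmod (B $$ p)) ?I"
    using assms by (intro L2_set_mono) (auto intro: norm_triangle_ineq)
  also have "\<dots> \<le> L2_set (\<lambda>p. cmod (A $$ p)) ?I + L2_set (\<lambda>p. cmod (B $$ p)) ?I"
    by (rule L2_set_triangle_ineq)
  finally show ?thesis using assms
    by (simp add: hs_def add_divide_distrib[symmetric] divide_right_mono)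
qed

lemma hs_smult: "hs (c \<cdot>\<^sub>m A) = cmod c * hs A"
proof -
  have "L2_set (\<lambda>p. cmod ((c \<cdot>\<^sub>m A) $$ p)) ({..<dim_row A} \<times> {..<dim_col A})
      = L2_set (\<lambda>p. cmod c * cmod (A $$ p)) ({..<dim_row A} \<times> {..<dim_col A})"
    by (intro L2_set_cong refl) (auto simp: norm_mult)
  then show ?thesis by (simp add: hs_def L2_set_right_distrib)
qed

lemma hs_diff_commute:
  assumes "A \<in> carrier_mat n n" "B \<in> carrier_mat n n"
  shows "hs (A - B) = hs (B - A)"
  using assms unfolding hs_def
  by (intro arg_cong2[of _ _ _ _ "(/)"] L2_set_cong) (auto simp: norm_minus_commute)

lemma hs_triangle:
  assumes "A \<in> carrier_mat n n" "B \<in> carrier_mat n n" "C \<in> carrier_mat n n"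
  shows "hs (A - C) \<le> hs (A - B) + hs (B - C)"
proof -
  have "A - C = (A - B) + (B - C)"
    using assms by (intro eq_matI) auto
  then show ?thesis using hs_add[of "A - B" n "B - C"] assms by (metis minus_carrier_mat)
qed

lemma hs_eqI:
  assumes "A \<in> carrier_mat n n" "B \<in> carrier_mat n n" "ip A A = ip B B"
  shows "hs A = hs B"
proof -
  have "(hs A)\<^sup>2 = (hs B)\<^sup>2"
    using assms by (metis ip_self of_real_eq_iff)
  then show ?thesis by (simp add: power2_eq_iff_nonneg)
qed

lemma hs_transpose:
  assumes "A \<in> carrier_mat n n"
  shows "hs (transpose_mat A) = hs A"
proof -
  have "(\<Sum>i<n. \<Sum>j<n. (cmod (transpose_mat A $$ (i,j)))\<^sup>2) = (\<Sum>i<n. \<Sum>j<n. (cmod (A $$ (j,i)))\<^sup>2)"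
    using assms by (auto intro!: sum.cong)
  also have "\<dots> = (\<Sum>i<n. \<Sum>j<n. (cmod (A $$ (i,j)))\<^sup>2)"
    by (rule sum.swap)
  finally have "(hs (transpose_mat A))\<^sup>2 = (hs A)\<^sup>2"
    using assms by (simp add: hs_power2[of _ n])
  then show ?thesis by (simp add: power2_eq_iff_nonneg)
qed

lemma ip_mult_left:
  assumes U: "unitary_mat n U" and [simp]: "A \<in> carrier_mat n n" "B \<in> carrier_mat n n"
  shows "ip (U * A) (U * B) = ip A B"
proof -
  note [simp] = unitary_mat_carrier[OF U]
  have "adj (U * A) * (U * B) = adj A * adj U * (U * B)"
    by (simp add: adj_mult[of U n n A n])
  also have "\<dots> = adj A * (adj U * (U * B))"
    by (rule assoc_mult_mat[of _ n n _ n _ n]) auto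
  also have "adj U * (U * B) = adj U * U * B"
    by (rule assoc_mult_mat[of _ n n _ n _ n, symmetric]) auto
  finally have "adj (U * A) * (U * B) = adj A * B"
    using unitary_mat_left[OF U] by simp
  then show ?thesis by (simp add: ip_trace[of _ n] mult_carrier_mat[of _ n n])
qed

lemma ip_adj:
  assumes "A \<in> carrier_mat n n" "B \<in> carrier_mat n n"
  shows "ip (adj A) (adj B) = cnj (ip A B)"
proof -
  have "(\<Sum>i<n. \<Sum>j<n. A $$ (j, i) * cnj (B $$ (j, i)))
      = (\<Sum>i<n. \<Sum>j<n. A $$ (i, j) * cnj (B $$ (i, j)))"
    by (rule sum.swap)
  moreover have "(\<Sum>i<n. \<Sum>j<n. cnj (adj A $$ (i, j)) * adj B $$ (i, j))
      = (\<Sum>i<n. \<Sum>j<n. A $$ (j, i) * cnj (B $$ (j, i)))"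
    using assms by (intro sum.cong refl) (auto simp: adj_index)
  ultimately show ?thesis using assms 
    by (simp add: ip_def)
qed

lemma ip_mult_right:
  assumes U: "unitary_mat n U" and [simp]: "A \<in> carrier_mat n n" "B \<in> carrier_mat n n"
  shows "ip (A * U) (B * U) = ip A B"
proof -
  note [simp] = unitary_mat_carrier[OF U]
  have "cnj (ip (A * U) (B * U)) = ip (adj (A * U)) (adj (B * U))"
    by (rule ip_adj[symmetric, of _ n]) (simp_all add: mult_carrier_mat[of _ n n])
  also have "\<dots> = ip (adj U * adj A) (adj U * adj B)"
    by (simp add: adj_mult[of A n n U n] adj_mult[of B n n U n])
  also have "\<dots> = ip (adj A) (adj B)"
    by (rule ip_mult_left[of n]) (auto intro: unitary_mat_adj U)
  also have "\<dots> = cnj (ip A B)" by (rule ip_adj[of _ n]) auto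
  finally show ?thesis by simp
qed

lemma hs_mult_left: "unitary_mat n U \<Longrightarrow> A \<in> carrier_mat n n \<Longrightarrow> hs (U * A) = hs A"
  using unitary_mat_carrier[of n U] by (intro hs_eqI[of _ n] ip_mult_left[of n]) auto

lemma hs_mult_right: "unitary_mat n U \<Longrightarrow> A \<in> carrier_mat n n \<Longrightarrow> hs (A * U) = hs A"
  using unitary_mat_carrier[of n U] by (intro hs_eqI[of _ n] ip_mult_right[of n]) auto

lemma hs_one: "n > 0 \<Longrightarrow> hs (1\<^sub>m n) = 1"
proof -
  assume n: "n > 0"
  have "ip (1\<^sub>m n) (1\<^sub>m n) = 1" using n by (simp add: ip_trace[of _ n])
  then have "(hs (1\<^sub>m n))\<^sup>2 = 1" using ip_self[of "1\<^sub>m n" n] of_real_eq_1_iff by (metis one_carrier_mat)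
  then show ?thesis by (metis hs_nonneg one_power2 power2_eq_iff_nonneg zero_le_one)
qed

lemma hs_unitary: "n > 0 \<Longrightarrow> unitary_mat n U \<Longrightarrow> hs U = 1"
  using hs_mult_left[of n U "1\<^sub>m n"] hs_one[of n] unitary_mat_carrier[of n U] by simp

text \<open>Unitary factors are replaced one at a time: the factor that stays drops out of the norm,
  so errors add without amplification.\<close>

lemma hs_mult_diff:
  assumes U: "unitary_mat n A" "unitary_mat n A'" "unitary_mat n B" "unitary_mat n B'"
  shows "hs (A * B - A' * B') \<le> hs (A - A') + hs (B - B')"
proof -
  note [simp] = U[THEN unitary_mat_carrier]
  have "hs (A * B - A' * B') \<le> hs (A * B - A' * B) + hs (A' * B - A' * B')"
    by (rule hs_triangle[of _ n]) (simp_all add: mult_carrier_mat[of _ n n])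
  also have "A * B - A' * B = (A - A') * B" by (rule minus_mult_distrib_mat[of _ n n _ _ n, symmetric]) auto
  also have "A' * B - A' * B' = A' * (B - B')" by (rule mult_minus_distrib_mat[of _ n n _ n, symmetric]) auto
  finally show ?thesis by (simp add: hs_mult_left[OF U(2)] hs_mult_right[OF U(3)] minus_carrier_mat)
qed

subsection \<open>Roots of unity and diagonal matrices\<close>

definition ee :: "real \<Rightarrow> complex" where "ee x = cis (2 * pi * x)"

lemma ee_add: "ee (x + y) = ee x * ee y"
  by (simp add: ee_def cis_mult distrib_left)

lemma norm_ee [simp]: "cmod (ee x) = 1"
  by (simp add: ee_def)

lemma cnj_ee: "cnj (ee x) = ee (- x)"
  by (simp add: ee_def cis_cnj)

lemma ee_zero [simp]: "ee 0 = 1"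
  by (simp add: ee_def)

lemma ee_int [simp]: "ee (of_int k) = 1"
  by (simp add: ee_def)

lemma ee_power: "ee x ^ n = ee (real n * x)"
  by (simp only: ee_def Complex.DeMoivre) (simp add: mult_ac)

lemma ee_eqI:
  assumes "x - y = of_int k" shows "ee x = ee y"
proof -
  have "ee x = ee (y + of_int k)" using assms by (simp add: algebra_simps)
  then show ?thesis by (simp add: ee_add)
qed

text \<open>Jordan's inequality: the sine is concave on \<open>[0, pi / 2]\<close> and lies above
  its chord.\<close>

lemma sin_pi_ge:
  assumes "0 \<le> y" "y \<le> 1 / 2"
  shows "2 * y \<le> sin (pi * y)"
proof -
  have "convex_on {0..pi/2} (\<lambda>x. - sin x)"
  proof (rule f''_ge0_imp_convex)
    show "((\<lambda>x. - sin x) has_real_derivative - cos x) (at x)" for x :: real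
      by (auto intro!: derivative_eq_intros)
    show "((\<lambda>x. - cos x) has_real_derivative sin x) (at x)" for x :: real
      by (auto intro!: derivative_eq_intros)
  qed (auto intro!: sin_ge_zero)
  then have "- sin ((1 - 2 * y) *\<^sub>R 0 + (2 * y) *\<^sub>R (pi / 2)) \<le> (1 - 2 * y) * (- sin 0) + 2 * y * (- sin (pi / 2))"
    using assms by (intro convex_onD) auto
  then show ?thesis by (simp add: mult.commute)
qed

lemma norm_ee_minus_one: "cmod (ee y - 1) = 2 * \<bar>sin (pi * y)\<bar>"
proof -
  have "ee y = ee (y / 2) * ee (y / 2)" by (simp flip: ee_add)
  moreover have "ee (y / 2) * ee (- (y / 2)) = 1" by (simp flip: ee_add)
  ultimately have "ee y - 1 = ee (y / 2) * (ee (y / 2) - ee (- (y / 2)))"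
    by (simp add: right_diff_distrib)
  moreover have "ee (y / 2) - ee (- (y / 2)) = 2 * \<i> * of_real (sin (pi * y))"
    by (simp add: ee_def complex_eq_iff)
  ultimately show ?thesis by (simp add: norm_mult)
qed

lemma norm_ee_minus_one_le: "cmod (ee y - 1) \<le> 2 * pi * \<bar>y\<bar>"
  using abs_sin_x_le_abs_x[of "pi * y"] by (simp add: norm_ee_minus_one abs_mult)

lemma norm_ee_minus_one_ge:
  assumes "0 \<le> y" "y \<le> 1"
  shows "4 * min y (1 - y) \<le> cmod (ee y - 1)"
proof (cases "y \<le> 1 / 2")
  case True
  then show ?thesis using assms sin_pi_ge[of y] by (simp add: norm_ee_minus_one)
next
  case False
  have "sin (pi * (1 - y)) = sin (pi * y)" by (simp add: right_diff_distrib sin_diff)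
  then show ?thesis using False assms sin_pi_ge[of "1 - y"] by (simp add: norm_ee_minus_one)
qed

text \<open>A sum of two inverse squares bounds the inverse square of the minimum; it is symmetric
  under \<open>y\<close> to \<open>1 - y\<close>, which later merges the two ends of a
  period.\<close>

lemma inverse_norm_ee_minus_one:
  assumes "0 < y" "y < 1"
  shows "1 / (cmod (ee y - 1))\<^sup>2 \<le> (1 / y\<^sup>2 + 1 / (1 - y)\<^sup>2) / 16"
proof -
  let ?m = "min y (1 - y)"
  have m: "0 < ?m" using assms by auto
  have "(4 * ?m)\<^sup>2 \<le> (cmod (ee y - 1))\<^sup>2"
    using norm_ee_minus_one_ge[of y] m assms by (intro power_mono) auto
  then have "1 / (cmod (ee y - 1))\<^sup>2 \<le> 1 / (4 * ?m)\<^sup>2"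
    using m by (intro divide_left_mono) (auto intro!: mult_pos_pos)
  also have "\<dots> = 1 / ?m\<^sup>2 / 16" by (simp add: power_mult_distrib)
  also have "\<dots> \<le> (1 / y\<^sup>2 + 1 / (1 - y)\<^sup>2) / 16"
    by (auto simp: min_def intro!: divide_right_mono)
  finally show ?thesis .
qed

lemma sum_ee_le:
  assumes "ee y \<noteq> 1"
  shows "cmod (\<Sum>k<n. ee (real k * y)) \<le> 2 / cmod (ee y - 1)"
proof -
  have "(\<Sum>k<n. ee (real k * y)) = (ee y ^ n - 1) / (ee y - 1)"
    using assms geometric_sum[of "ee y" n] by (simp add: ee_power)
  moreover have "cmod (ee y ^ n - 1) \<le> 2"
    using norm_triangle_ineq4[of "ee y ^ n" 1] by (simp add: norm_power)
  ultimately show ?thesis by (simp add: norm_divide divide_right_mono)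
qed

lemma ee_neq_one: "0 < y \<Longrightarrow> y < 1 \<Longrightarrow> ee y \<noteq> 1"
  using norm_ee_minus_one_ge[of y] by auto

lemma ee_div_mod:
  assumes "N > 0"
  shows "ee (of_int d / real N) = ee (of_int (d mod int N) / real N)"
proof (rule ee_eqI[where k = "d div int N"])
  have "d = d div int N * int N + d mod int N" by simp
  then have "real_of_int d = of_int (d div int N) * real N + of_int (d mod int N)"
    by (metis of_int_add of_int_mult of_int_of_nat_eq)
  then show "of_int d / real N - of_int (d mod int N) / real N = of_int (d div int N)"
    using assms by (simp add: field_simps)
qed

lemma sum_roots_of_unity:
  assumes N: "N > 0"
  shows "(\<Sum>k<N. ee (real k * (of_int d / real N))) = (if int N dvd d then of_nat N else 0)"
proof (cases "int N dvd d")
  case True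
  then obtain c where "d = int N * c" by auto
  then have "ee (of_int d / real N) = 1" using N by (simp add: ee_eqI[of _ 0 c])
  then show ?thesis using True by (simp only: ee_power[symmetric]) simp
next
  case False
  let ?y = "of_int (d mod int N) / real N"
  have "d mod int N \<noteq> 0" using False by auto
  moreover have "0 \<le> d mod int N" "d mod int N < int N" using N by auto
  ultimately have "0 < real_of_int (d mod int N)" "real_of_int (d mod int N) < real N"
    by linarith+
  then have "0 < ?y" "?y < 1" using N by (auto simp: field_simps)
  then have "ee (of_int d / real N) \<noteq> 1" using ee_neq_one ee_div_mod[OF N] by metis
  moreover have "ee (of_int d / real N) ^ N = 1" using N by (simp add: ee_power)
  ultimately show ?thesis using False geometric_sum[of "ee (of_int d / real N)" N]
    by (simp only: ee_power[symmetric]) simp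
qed

section \<open>Unitarity of the discrete Fourier transform\<close>

lemma dft_carrier [simp]: "dft N \<in> carrier_mat N N"
  by (simp add: dft_def)

lemma dft_dim [simp]: "dim_row (dft N) = N" "dim_col (dft N) = N"
  by (simp_all add: dft_def)

lemma dft_index:
  "k < N \<Longrightarrow> j < N \<Longrightarrow> dft N $$ (k, j) = ee (- (real k * real j / real N)) / of_real (sqrt (real N))"
  by (simp add: dft_def ee_def mult_ac)

lemma unitary_dft:
  assumes N: "N > 0"
  shows "unitary_mat N (dft N)"
proof -
  have "adj (dft N) * dft N = 1\<^sub>m N"
  proof (rule eq_matI)
    fix i j assume "i < dim_row (1\<^sub>m N)" "j < dim_col (1\<^sub>m N)"
    then have ij: "i < N" "j < N" by auto
    have "(adj (dft N) * dft N) $$ (i, j) = (\<Sum>k<N. cnj (dft N $$ (k, i)) * dft N $$ (k, j))"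
      using ij by (intro adj_mult_index) auto
    also have "\<dots> = (\<Sum>k<N. ee (real k * (of_int (int i - int j) / real N)) / of_nat N)"
    proof (intro sum.cong refl)
      fix k assume k: "k \<in> {..<N}"
      have arg: "ee (real k * real i / real N) * ee (- (real k * real j / real N))
          = ee (real k * (real i - real j) / real N)"
        unfolding ee_add[symmetric] by (intro arg_cong[of _ _ ee]) (simp add: right_diff_distrib diff_divide_distrib)
      have "complex_of_real (sqrt (real N)) * complex_of_real (sqrt (real N)) = of_nat N"
        by (simp flip: of_real_mult)
      then show "cnj (dft N $$ (k, i)) * dft N $$ (k, j) = ee (real k * (of_int (int i - int j) / real N)) / of_nat N"
        using k ij arg by (simp add: dft_index cnj_ee)
    qed
    also have "\<dots> = (if i = j then 1 else 0)"
    proof -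
      have "int N dvd int i - int j \<longleftrightarrow> i = j"
        using ij zdvd_imp_le[of "int N" "\<bar>int i - int j\<bar>"] by (cases "i = j") auto
      then show ?thesis using N sum_roots_of_unity[OF N, of "int i - int j"]
        by (simp only: sum_divide_distrib[symmetric]) simp
    qed
    finally show "(adj (dft N) * dft N) $$ (i, j) = 1\<^sub>m N $$ (i, j)" using ij by simp
  qed auto
  then show ?thesis by (simp add: unitary_mat_def)
qed

text \<open>The inverse in \<open>baker\<close> comes from an elimination procedure with optional
  result. That \<open>U\<close> is a unit excludes \<open>None\<close>, and uniqueness of inverses
  identifies the result with the adjoint.\<close>

lemma mat_inverse_unitary:
  assumes "unitary_mat n U"
  shows "the (mat_inverse U) = adj U"
proof -
  note [simp] = unitary_mat_carrier[OF assms]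
  have unit: "U \<in> Units (ring_mat TYPE(complex) n b)" for b :: unit
    unfolding Units_def using assms
    by (auto simp: ring_mat_simps unitary_mat_left unitary_mat_right intro!: bexI[of _ "adj U"])
  show ?thesis
  proof (cases "mat_inverse U")
    case None
    then show ?thesis using mat_inverse(1)[of U n "()"] unit by simp
  next
    case (Some V)
    then have V: "U * V = 1\<^sub>m n" "V \<in> carrier_mat n n"
      using mat_inverse(2)[of U n V] by auto
    have "adj U = adj U * (U * V)" using V right_mult_one_mat[of "adj U" n n] by simp
    also have "\<dots> = adj U * U * V"
      using V by (intro assoc_mult_mat[of _ n n _ n _ n, symmetric]) auto
    also have "\<dots> = V" using V unitary_mat_left[OF assms] by simp
    finally show ?thesis using Some by simp
  qed
qed

section \<open>Diagonal matrices\<close>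

definition dg :: "nat \<Rightarrow> (nat \<Rightarrow> complex) \<Rightarrow> complex mat" where
  "dg N f = Matrix.mat N N (\<lambda>(i, j). if i = j then f i else 0)"

lemma dg_carrier [simp]: "dg N f \<in> carrier_mat N N"
  by (simp add: dg_def)

lemma dg_dim [simp]: "dim_row (dg N f) = N" "dim_col (dg N f) = N"
  by (simp_all add: dg_def)

lemma dg_index [simp]: "i < N \<Longrightarrow> j < N \<Longrightarrow> dg N f $$ (i, j) = (if i = j then f i else 0)"
  by (simp add: dg_def)

lemma dg_mult_index:
  assumes "A \<in> carrier_mat N m" "i < N" "j < m"
  shows "(dg N f * A) $$ (i, j) = f i * A $$ (i, j)"
  using assms by (simp add: index_mult_sum[of _ N N _ m] if_distrib[of "\<lambda>x. x * _"] sum.delta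
    cong: if_cong del: index_mult_mat)

lemma mult_dg_index:
  assumes "A \<in> carrier_mat m N" "i < m" "j < N"
  shows "(A * dg N f) $$ (i, j) = A $$ (i, j) * f j"
  using assms by (simp add: index_mult_sum[of _ m N _ N] if_distrib[of "\<lambda>x. _ * x"] sum.delta
    cong: if_cong del: index_mult_mat)

lemma dg_mult: "dg N f * dg N g = dg N (\<lambda>j. f j * g j)"
  by (rule eq_matI) (auto simp: dg_mult_index[of _ _ N] simp del: index_mult_mat(1))

lemma dg_one: "dg N (\<lambda>_. 1) = 1\<^sub>m N"
  by (rule eq_matI) auto

lemma dg_cong: "(\<And>j. j < N \<Longrightarrow> f j = g j) \<Longrightarrow> dg N f = dg N g"
  by (rule eq_matI) auto

lemma adj_dg: "adj (dg N f) = dg N (\<lambda>j. cnj (f j))"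
  by (rule eq_matI) (auto simp: adj_index)

lemma dg_transpose: "transpose_mat (dg N f) = dg N f"
  by (rule eq_matI) auto

lemma unitary_dg: "(\<And>j. j < N \<Longrightarrow> cmod (f j) = 1) \<Longrightarrow> unitary_mat N (dg N f)"
proof -
  assume f: "\<And>j. j < N \<Longrightarrow> cmod (f j) = 1"
  have "cnj (f j) * f j = 1" if "j < N" for j
    using f[OF that] complex_norm_square[of "f j"] by (simp add: mult.commute)
  then have "dg N (\<lambda>j. cnj (f j) * f j) = dg N (\<lambda>_. 1)"
    by (rule dg_cong)
  then show ?thesis by (simp add: unitary_mat_def adj_dg dg_mult dg_one)
qed

lemma ip_dg: "ip (dg N f) (dg N g) = (\<Sum>j<N. cnj (f j) * g j) / of_nat N"
  by (simp add: ip_trace[of _ N] adj_dg dg_mult)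

lemma hs_dg_le:
  assumes "\<And>j. j < N \<Longrightarrow> cmod (f j - g j) \<le> \<epsilon>" "N > 0"
  shows "hs (dg N f - dg N g) \<le> \<epsilon>"
proof -
  have "cmod (f 0 - g 0) \<le> \<epsilon>" using assms by auto
  then have e: "0 \<le> \<epsilon>" using norm_ge_zero order_trans by blast
  have eq: "dg N f - dg N g = dg N (\<lambda>j. f j - g j)" by (rule eq_matI) auto
  have "(hs (dg N (\<lambda>j. f j - g j)))\<^sup>2 = (\<Sum>i<N. \<Sum>j<N. if j = i then (cmod (f i - g i))\<^sup>2 else 0) / real N"
    by (subst hs_power2[of _ N]) (simp_all only: dg_carrier, intro arg_cong2[of _ _ _ _ "(/)"] sum.cong refl, auto)
  also have "\<dots> = (\<Sum>i<N. (cmod (f i - g i))\<^sup>2) / real N"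
    by (simp add: sum.delta)
  also have "\<dots> \<le> (\<Sum>i<N. \<epsilon>\<^sup>2) / real N"
    using assms e by (intro divide_right_mono sum_mono power_mono) auto
  also have "\<dots> = \<epsilon>\<^sup>2" using assms by simp
  finally show ?thesis unfolding eq using e power2_le_imp_le by blast
qed

subsection \<open>The baker matrix and binary digits\<close>

text \<open>For \<open>i > 0\<close> and \<open>j < N\<close> the sign encodes the \<open>i\<close>-th binary digit of \<open>j / N\<close>.\<close>

definition rademacher :: "nat \<Rightarrow> nat \<Rightarrow> nat \<Rightarrow> real" where
  "rademacher N i j = (- 1) ^ ((2 ^ i * j) div N)"

definition Qm :: "nat \<Rightarrow> nat \<Rightarrow> complex mat" where
  "Qm N i = dg N (\<lambda>j. of_real (rademacher N i j))"

definition blk :: "nat \<Rightarrow> complex mat" where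
  "blk M = four_block_mat (dft M) (0\<^sub>m M M) (0\<^sub>m M M) (dft M)"

lemma Qm_carrier [simp]: "Qm N i \<in> carrier_mat N N"
  by (simp add: Qm_def)

lemma Qm_dim [simp]: "dim_row (Qm N i) = N" "dim_col (Qm N i) = N"
  by (simp_all add: Qm_def)

lemma rademacher_cases: "rademacher N i j = 1 \<or> rademacher N i j = - 1"
  by (cases "even ((2 ^ i * j) div N)") (auto simp: rademacher_def)

lemma abs_rademacher [simp]: "\<bar>rademacher N i j\<bar> = 1"
  using rademacher_cases[of N i j] by auto

lemma rademacher_square [simp]: "rademacher N i j * rademacher N i j = 1"
  using rademacher_cases[of N i j] by auto

text \<open>The doubling map shifts binary digits: the classical relation behind the intertwining of
  \<open>Qm\<close> by the baker matrix.\<close>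

lemma rademacher_Suc: "rademacher N (Suc i) j = rademacher N i (2 * j)"
  by (simp add: rademacher_def mult_ac)

text \<open>The quotient grows by \<open>2 ^ i\<close>, which is even exactly because
  \<open>i > 0\<close>; for \<open>i = 0\<close> the sign would flip.\<close>

lemma rademacher_periodic:
  assumes "N > 0" "i > 0"
  shows "rademacher N i (j + N) = rademacher N i j"
proof -
  have "(2 ^ i * (j + N)) div N = (2 ^ i * j) div N + 2 ^ i"
    using assms by (simp add: distrib_left)
  then show ?thesis using assms by (simp add: rademacher_def power_add)
qed

lemma rademacher_half_period:
  assumes "M > 0" "i > 1"
  shows "rademacher (2 * M) i (j + M) = rademacher (2 * M) i j"
proof -
  obtain l where l: "i = Suc l" "l > 0" using assms by (cases i) auto
  have "rademacher (2 * M) i (j + M) = rademacher (2 * M) l (2 * j + 2 * M)" by (simp add: l rademacher_Suc)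
  also have "\<dots> = rademacher (2 * M) i j" using assms l by (simp add: rademacher_periodic rademacher_Suc)
  finally show ?thesis .
qed

lemma rademacher_one_half_period:
  assumes "M > 0"
  shows "rademacher (2 * M) 1 (j + M) = - rademacher (2 * M) 1 j"
proof -
  have "(2 * (j + M)) div (2 * M) = (2 * j) div (2 * M) + 1"
    using assms by (simp add: distrib_left)
  then show ?thesis by (simp add: rademacher_def)
qed

lemma unitary_Qm: "unitary_mat N (Qm N i)"
  by (simp add: Qm_def unitary_dg)

lemma sum_periodic_shift:
  fixes g :: "nat \<Rightarrow> 'a :: ab_group_add"
  assumes "\<And>y. g (y + N) = g y"
  shows "(\<Sum>y<N. g (y + c)) = (\<Sum>y<N. g y)"
proof (induction c)
  case (Suc c)
  have "(\<Sum>y<N. g (y + Suc c)) + g c = (\<Sum>y<Suc N. g (y + c))"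
    by (subst sum.lessThan_Suc_shift) (simp add: add.commute)
  also have "\<dots> = (\<Sum>y<N. g (y + c)) + g c"
    using assms[of c] by (simp add: add.commute)
  finally show ?case using Suc by simp
qed simp

lemma sum_halves:
  fixes f :: "nat \<Rightarrow> 'a :: comm_monoid_add"
  shows "(\<Sum>k<2 * M. f k) = (\<Sum>k<M. f k) + (\<Sum>k<M. f (k + M))"
  using sum.atLeastLessThan_concat[of 0 M "2 * M" f] sum.shift_bounds_nat_ivl[of f 0 M M]
  by (simp add: lessThan_atLeast0 mult_2)

text \<open>Modulo \<open>2 * M\<close>, doubling hits each even residue exactly twice; the terms at
  odd residues are nonnegative and may be added.\<close>

lemma sum_double_le:
  fixes g :: "nat \<Rightarrow> real"
  assumes "\<And>y. g (y + 2 * M) = g y" "\<And>y. 0 \<le> g y"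
  shows "(\<Sum>j<2 * M. g (2 * j)) \<le> 2 * (\<Sum>y<2 * M. g y)"
proof -
  have split: "(\<Sum>j<2 * M. g (2 * j)) = (\<Sum>j<M. g (2 * j)) + (\<Sum>j<M. g (2 * (j + M)))"
    by (rule sum_halves)
  have "(\<Sum>j<M. g (2 * j)) = (\<Sum>y\<in>(\<lambda>j. 2 * j) ` {..<M}. g y)"
    by (simp add: sum.reindex inj_on_def)
  also have "\<dots> \<le> (\<Sum>y<2 * M. g y)"
    using assms by (intro sum_mono2) auto
  finally show ?thesis using assms(1) split by (simp add: distrib_left)
qed

text \<open>A squared L2 modulus of continuity of the digit function over one full period.\<close>

definition osc :: "nat \<Rightarrow> nat \<Rightarrow> nat \<Rightarrow> real" where
  "osc N i d = (\<Sum>y<N. (rademacher N i (y + d) - rademacher N i y)\<^sup>2)"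

lemma rademacher_diff_square: "(rademacher N i x - rademacher N i y)\<^sup>2 = 2 * \<bar>rademacher N i x - rademacher N i y\<bar>"
  using rademacher_cases[of N i x] rademacher_cases[of N i y] by auto

lemma sum_rademacher_step_le:
  assumes "N > 0"
  shows "(\<Sum>y<N. \<bar>rademacher N i (y + 1) - rademacher N i y\<bar>) \<le> 2 * 2 ^ i"
proof -
  have step: "\<bar>rademacher N i (y + 1) - rademacher N i y\<bar>
      \<le> 2 * (real ((2 ^ i * Suc y) div N) - real ((2 ^ i * y) div N))" for y
  proof -
    have le: "(2 ^ i * y) div N \<le> (2 ^ i * Suc y) div N" by (intro div_le_mono) simp
    show ?thesis
    proof (cases "(2 ^ i * y) div N = (2 ^ i * Suc y) div N")
      case False
      then have "real ((2 ^ i * y) div N) + 1 \<le> real ((2 ^ i * Suc y) div N)" using le by linarith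
      moreover have "\<bar>rademacher N i (y + 1) - rademacher N i y\<bar> \<le> 2"
        using rademacher_cases[of N i "y + 1"] rademacher_cases[of N i y] by auto
      ultimately show ?thesis by (smt (verit))
    qed (simp add: rademacher_def)
  qed
  have "(\<Sum>y<N. \<bar>rademacher N i (y + 1) - rademacher N i y\<bar>)
      \<le> (\<Sum>y<N. 2 * (real ((2 ^ i * Suc y) div N) - real ((2 ^ i * y) div N)))"
    by (intro sum_mono step)
  also have "\<dots> = 2 * real ((2 ^ i * N) div N)"
    unfolding sum_distrib_left[symmetric]
    using sum_lessThan_telescope[of "\<lambda>y. real ((2 ^ i * y) div N)" N] by simp
  also have "\<dots> = 2 * 2 ^ i" using assms by simp
  finally show ?thesis .
qed

text \<open>A shift by \<open>d\<close> is \<open>d\<close> unit shifts, each costing the total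
  variation of a sign that changes at most \<open>2 ^ i\<close> times per period. Since the values
  are signs, squaring a difference only doubles its absolute value.\<close>

lemma osc_le:
  assumes "N > 0" "i > 0"
  shows "osc N i d \<le> 4 * 2 ^ i * real d"
proof -
  have "(\<Sum>y<N. \<bar>rademacher N i (y + d) - rademacher N i y\<bar>) \<le> real d * (2 * 2 ^ i)"
  proof (induction d)
    case (Suc d)
    have "(\<Sum>y<N. \<bar>rademacher N i (y + Suc d) - rademacher N i y\<bar>)
        \<le> (\<Sum>y<N. \<bar>rademacher N i (y + d + 1) - rademacher N i (y + d)\<bar> + \<bar>rademacher N i (y + d) - rademacher N i y\<bar>)"
      by (intro sum_mono) auto
    also have "\<dots> = (\<Sum>y<N. \<bar>rademacher N i (y + d + 1) - rademacher N i (y + d)\<bar>)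
        + (\<Sum>y<N. \<bar>rademacher N i (y + d) - rademacher N i y\<bar>)"
      by (rule sum.distrib)
    also have "(\<Sum>y<N. \<bar>rademacher N i (y + d + 1) - rademacher N i (y + d)\<bar>)
        = (\<Sum>y<N. \<bar>rademacher N i (y + 1) - rademacher N i y\<bar>)"
    proof (rule sum_periodic_shift)
      show "\<bar>rademacher N i (y + N + 1) - rademacher N i (y + N)\<bar> = \<bar>rademacher N i (y + 1) - rademacher N i y\<bar>" for y
        using rademacher_periodic[OF assms, of "y + 1"] rademacher_periodic[OF assms, of y]
        by (simp add: add_ac)
    qed
    also have "\<dots> \<le> 2 * 2 ^ i" by (rule sum_rademacher_step_le[OF assms(1)])
    finally show ?case using Suc by (simp add: algebra_simps)
  qed simp
  then show ?thesis by (simp add: osc_def rademacher_diff_square sum_distrib_left[symmetric])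
qed

lemma osc_reflect:
  assumes "N > 0" "i > 0" "d \<le> N"
  shows "osc N i (N - d) = osc N i d"
proof -
  note per = rademacher_periodic[OF assms(1,2)]
  let ?g = "\<lambda>y. (rademacher N i (y + (N - d)) - rademacher N i y)\<^sup>2"
  have "?g (y + N) = ?g y" for y
    using per[of y] per[of "y + (N - d)"] by (simp add: add_ac)
  then have "osc N i (N - d) = (\<Sum>y<N. ?g (y + d))"
    unfolding osc_def by (intro sum_periodic_shift[symmetric]) auto
  also have "\<dots> = osc N i d"
    unfolding osc_def
  proof (intro sum.cong refl)
    fix y
    have "rademacher N i (y + d + (N - d)) = rademacher N i y"
      using per[of y] assms(3) by simp
    then show "?g (y + d) = (rademacher N i (y + d) - rademacher N i y)\<^sup>2"
      by (simp add: power2_commute)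
  qed
  finally show ?thesis .
qed

text \<open>A logarithm would be sharper, but the square root telescopes easily and costs only a
  power of \<open>N\<close>, which is harmless for a logarithmic rate.\<close>

lemma sum_inverse_le: "(\<Sum>d=1..n. 1 / real d) \<le> 2 * sqrt (real n)"
proof (induction n)
  case (Suc n)
  let ?a = "sqrt (real n)" and ?b = "sqrt (real (Suc n))"
  have b: "1 \<le> ?b" "?a \<le> ?b" "0 \<le> ?a" by auto
  have sq: "?b * ?b = real n + 1" "?a * ?a = real n" by auto
  have "1 \<le> 2 * ?b * (?b - ?a)"
  proof -
    have "(?b - ?a) * (?b + ?a) = 1" using sq by (simp add: algebra_simps)
    moreover have "(?b - ?a) * (?b + ?a) \<le> (?b - ?a) * (2 * ?b)"
      using b by (intro mult_left_mono) auto
    ultimately show ?thesis by (simp add: mult_ac)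
  qed
  then have "1 * ?b \<le> 2 * ?b * (?b - ?a) * ?b"
    using b by (intro mult_right_mono) auto
  also have "2 * ?b * (?b - ?a) * ?b = 2 * (?b - ?a) * (?b * ?b)" by (simp only: mult_ac)
  also have "\<dots> = 2 * (?b - ?a) * real (Suc n)" by simp
  finally have "1 \<le> 2 * (?b - ?a) * real (Suc n)" using b by linarith
  then have "1 / real (Suc n) \<le> 2 * (?b - ?a)" by (simp add: field_simps del: real_sqrt_abs2)
  then show ?case using Suc by (simp add: algebra_simps)
qed simp

section \<open>Matrix entries of the baker map\<close>

lemma blk_carrier [simp]: "blk M \<in> carrier_mat (2 * M) (2 * M)"
  by (simp add: blk_def mult_2)

lemma blk_dim [simp]: "dim_row (blk M) = 2 * M" "dim_col (blk M) = 2 * M"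
  using blk_carrier[of M] unfolding carrier_mat_def by auto

text \<open>Both blocks obey one formula because lowering both indices by \<open>M\<close> changes
  the phase by an integer number of turns.\<close>

lemma blk_index:
  assumes "k < 2 * M" "j < 2 * M"
  shows "blk M $$ (k, j) = (if (k < M) = (j < M)
    then ee (- (real k * real j / real M)) / of_real (sqrt (real M)) else 0)"
proof -
  have M: "M > 0" using assms by auto
  have "ee (- (real (k - M) * real (j - M) / real M)) = ee (- (real k * real j / real M))"
    if "\<not> k < M" "\<not> j < M"
  proof (rule ee_eqI[where k = "int k + int j - int M"])
    show "- (real (k - M) * real (j - M) / real M) - - (real k * real j / real M)
        = real_of_int (int k + int j - int M)"
      using that M by (simp add: of_nat_diff field_simps)
  qed
  then show ?thesis using assms by (auto simp: blk_def dft_index)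
qed

lemma blk_transpose: "transpose_mat (blk M) = blk M"
  by (rule eq_matI) (auto simp: blk_index mult.commute)

lemma unitary_blk:
  assumes "M > 0"
  shows "unitary_mat (2 * M) (blk M)"
proof -
  have "adj (blk M) = four_block_mat (adj (dft M)) (0\<^sub>m M M) (0\<^sub>m M M) (adj (dft M))"
    by (rule eq_matI) (auto simp: blk_def adj_def)
  then have "adj (blk M) * blk M = four_block_mat (1\<^sub>m M) (0\<^sub>m M M) (0\<^sub>m M M) (1\<^sub>m M)"
    using unitary_mat_left[OF unitary_dft[OF assms]]
    by (simp add: blk_def mult_four_block_mat[of _ M M _ M _ M _ _ M _ M] right_mult_zero_mat[of _ M M] left_mult_zero_mat[of _ M M] )
  then show ?thesis by (simp add: unitary_mat_def mult_2[symmetric])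
qed

lemma baker_eq: "M > 0 \<Longrightarrow> baker (2 * M) = adj (dft (2 * M)) * blk M"
  by (simp add: baker_def blk_def mat_inverse_unitary[OF unitary_dft])

lemma unitary_baker: "M > 0 \<Longrightarrow> unitary_mat (2 * M) (baker (2 * M))"
  unfolding baker_eq by (intro unitary_mat_mult unitary_mat_adj unitary_dft unitary_blk) auto

lemma baker_carrier [simp]: "M > 0 \<Longrightarrow> baker (2 * M) \<in> carrier_mat (2 * M) (2 * M)"
  by (intro unitary_mat_carrier unitary_baker)

text \<open>Column \<open>j\<close> meets only one block, so the entry is a geometric sum over
  \<open>M\<close> frequencies, peaked where \<open>x\<close> is \<open>2 * j\<close> modulo
  \<open>2 * M\<close>. For the lower block the frequencies are shifted by \<open>M\<close>, which
  contributes only a phase.\<close>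

lemma norm_baker_index:
  assumes M: "M > 0" and x: "x < 2 * M" and j: "j < 2 * M"
  shows "cmod (baker (2 * M) $$ (x, j))
    = cmod (\<Sum>k<M. ee (real k * ((real x - 2 * real j) / real (2 * M)))) / (sqrt 2 * real M)"
proof -
  let ?N = "2 * M" and ?c = "complex_of_real (sqrt (real (2 * M))) * complex_of_real (sqrt (real M))"
  let ?y = "(real x - 2 * real j) / real (2 * M)"
  let ?S = "\<Sum>k<M. ee (real k * ?y)"
  have "baker ?N $$ (x, j) = (\<Sum>k<?N. cnj (dft ?N $$ (k, x)) * blk M $$ (k, j))"
    unfolding baker_eq[OF M] using x j by (intro adj_mult_index) auto
  also have "\<dots> = (\<Sum>k<?N. if (k < M) = (j < M) then ee (real k * ?y) / ?c else 0)"
  proof (intro sum.cong refl)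
    fix k assume k: "k \<in> {..<?N}"
    have "ee (real k * real x / real ?N) * ee (- (real k * real j / real M)) = ee (real k * ?y)"
      unfolding ee_add[symmetric] using M by (intro arg_cong[of _ _ ee]) (simp add: field_simps)
    then show "cnj (dft ?N $$ (k, x)) * blk M $$ (k, j)
        = (if (k < M) = (j < M) then ee (real k * ?y) / ?c else 0)"
      using k x j by (auto simp: dft_index blk_index cnj_ee)
  qed
  also have "\<dots> = (if j < M then ?S / ?c else ee (real M * ?y) * ?S / ?c)"
  proof -
    have shift: "ee (real (k + M) * ?y) = ee (real M * ?y) * ee (real k * ?y)" for k
      unfolding ee_add[symmetric] by (intro arg_cong[of _ _ ee]) (simp only: of_nat_add distrib_right add.commute)
    show ?thesis
    proof (cases "j < M")
      case True
      then have "(\<Sum>k<?N. if (k < M) = (j < M) then ee (real k * ?y) / ?c else 0)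
          = (\<Sum>k<M. ee (real k * ?y) / ?c)"
        unfolding sum_halves by simp
      then show ?thesis using True by (simp only: sum_divide_distrib if_True)
    next
      case False
      then have "(\<Sum>k<?N. if (k < M) = (j < M) then ee (real k * ?y) / ?c else 0)
          = (\<Sum>k<M. ee (real (k + M) * ?y) / ?c)"
        unfolding sum_halves by simp
      also have "\<dots> = ee (real M * ?y) * ?S / ?c"
        by (simp only: shift sum_divide_distrib sum_distrib_left)
      finally show ?thesis using False by (simp only: if_False)
    qed
  qed
  finally have "cmod (baker ?N $$ (x, j)) = cmod ?S / (sqrt (real (2 * M)) * sqrt (real M))"
    by (auto simp: norm_mult norm_divide simp del: of_nat_mult)
  also have "sqrt (real (2 * M)) * sqrt (real M) = sqrt 2 * real M"
    by (simp add: real_sqrt_mult)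
  finally show ?thesis .
qed

text \<open>An unnormalised Fejer kernel of period \<open>2 * M\<close>; its argument is the
  distance of \<open>(j, x)\<close> from the graph of the doubling map.\<close>

definition kernel_sq :: "nat \<Rightarrow> nat \<Rightarrow> real" where
  "kernel_sq M z = (cmod (\<Sum>k<M. ee (real k * (real z / real (2 * M)))))\<^sup>2"

lemma kernel_sq_periodic:
  assumes "M > 0"
  shows "kernel_sq M (z + 2 * M) = kernel_sq M z"
proof -
  have "ee (real k * (real (z + 2 * M) / real (2 * M))) = ee (real k * (real z / real (2 * M)))" for k
    using assms by (intro ee_eqI[where k = "int k"]) (simp add: field_simps)
  then show ?thesis by (simp add: kernel_sq_def)
qed

text \<open>Adding \<open>2 * (2 * M - j)\<close> instead of subtracting \<open>2 * j\<close> stays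
  within the natural numbers and moves the argument by two periods.\<close>

lemma norm_baker_index_sq:
  assumes M: "M > 0" and x: "x < 2 * M" and j: "j < 2 * M"
  shows "(cmod (baker (2 * M) $$ (x, j)))\<^sup>2 = kernel_sq M (x + 2 * (2 * M - j)) / (2 * (real M)\<^sup>2)"
proof -
  have "ee (real k * ((real x - 2 * real j) / real (2 * M)))
      = ee (real k * (real (x + 2 * (2 * M - j)) / real (2 * M)))" for k
    using M j by (intro ee_eqI[where k = "- 2 * int k"]) (simp add: field_simps of_nat_diff)
  then show ?thesis
    by (simp only: norm_baker_index[OF assms] kernel_sq_def power_divide power_mult_distrib) simp
qed

lemma kernel_sq_le:
  assumes "0 < d" "d < 2 * M"
  shows "kernel_sq M d \<le> (real M)\<^sup>2 * (1 / (real d)\<^sup>2 + 1 / (real (2 * M - d))\<^sup>2)"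
proof -
  let ?y = "real d / real (2 * M)"
  have y: "0 < ?y" "?y < 1" using assms by auto
  have M: "real M > 0" using assms by auto
  have "kernel_sq M d \<le> (2 / cmod (ee ?y - 1))\<^sup>2"
    unfolding kernel_sq_def using ee_neq_one[OF y] by (intro power_mono sum_ee_le) auto
  also have "\<dots> = 4 * (1 / (cmod (ee ?y - 1))\<^sup>2)" by (simp add: power_divide)
  also have "\<dots> \<le> 4 * ((1 / ?y\<^sup>2 + 1 / (1 - ?y)\<^sup>2) / 16)"
    by (intro mult_left_mono inverse_norm_ee_minus_one y) simp
  also have "1 - ?y = real (2 * M - d) / real (2 * M)"
    using assms M by (simp add: of_nat_diff field_simps)
  also have "4 * ((1 / ?y\<^sup>2 + 1 / (real (2 * M - d) / real (2 * M))\<^sup>2) / 16)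
      = (real M)\<^sup>2 * (1 / (real d)\<^sup>2 + 1 / (real (2 * M - d))\<^sup>2)"
    using assms by (simp add: power_divide power_mult_distrib field_simps del: of_nat_diff)
  finally show ?thesis .
qed

text \<open>The kernel decays quadratically in \<open>d\<close> while the oscillation grows only
  linearly, so the product is of order \<open>1 / d\<close>.\<close>

lemma sum_kernel_osc_le:
  assumes M: "M > 0" and i: "i > 0"
  shows "(\<Sum>d<2 * M. kernel_sq M d * osc (2 * M) i d) \<le> (real M)\<^sup>2 * (16 * 2 ^ i * sqrt (real (2 * M)))"
proof -
  let ?N = "2 * M" and ?I = "{1..<2 * M}"
  have N: "?N > 0" using M by simp
  have o0: "0 \<le> osc ?N i d" for d by (simp add: osc_def sum_nonneg)
  \<comment> \<open>At the peak \<open>d = 0\<close> of the kernel the oscillation vanishes.\<close>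
  have "(\<Sum>d<?N. kernel_sq M d * osc ?N i d) = (\<Sum>d\<in>?I. kernel_sq M d * osc ?N i d)"
    by (rule sum.mono_neutral_right) (auto simp: osc_def not_less_eq_eq)
  also have "\<dots> \<le> (\<Sum>d\<in>?I. (real M)\<^sup>2 * (1 / (real d)\<^sup>2 + 1 / (real (?N - d))\<^sup>2) * osc ?N i d)"
    by (intro sum_mono mult_right_mono kernel_sq_le o0) auto
  also have "\<dots> = (real M)\<^sup>2 * ((\<Sum>d\<in>?I. osc ?N i d / (real d)\<^sup>2)
      + (\<Sum>d\<in>?I. osc ?N i d / (real (?N - d))\<^sup>2))"
    unfolding sum_distrib_left sum.distrib[symmetric] by (intro sum.cong refl) (simp add: distrib_left distrib_right)
  \<comment> \<open>By \<open>osc_reflect\<close>, replacing \<open>d\<close> by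
    \<open>?N - d\<close> makes the two halves of the kernel bound equal.\<close>
  also have "(\<Sum>d\<in>?I. osc ?N i d / (real (?N - d))\<^sup>2) = (\<Sum>d\<in>?I. osc ?N i d / (real d)\<^sup>2)"
    by (rule sum.reindex_bij_witness[of _ "\<lambda>d. ?N - d" "\<lambda>d. ?N - d"])
       (use N i in \<open>auto simp: osc_reflect\<close>)
  finally have bound: "(\<Sum>d<?N. kernel_sq M d * osc ?N i d)
      \<le> (real M)\<^sup>2 * (2 * (\<Sum>d\<in>?I. osc ?N i d / (real d)\<^sup>2))" by simp
  have "(\<Sum>d\<in>?I. osc ?N i d / (real d)\<^sup>2) \<le> (\<Sum>d\<in>?I. 4 * 2 ^ i * (1 / real d))"
  proof (rule sum_mono)
    fix d assume d: "d \<in> ?I"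
    have "osc ?N i d / (real d)\<^sup>2 \<le> 4 * 2 ^ i * real d / (real d)\<^sup>2"
      by (intro divide_right_mono osc_le N i) auto
    also have "\<dots> = 4 * 2 ^ i * (1 / real d)" using d by (simp add: power2_eq_square)
    finally show "osc ?N i d / (real d)\<^sup>2 \<le> 4 * 2 ^ i * (1 / real d)" .
  qed
  also have "(\<Sum>d\<in>?I. 4 * 2 ^ i * (1 / real d)) = 4 * 2 ^ i * (\<Sum>d\<in>?I. 1 / real d)"
    by (rule sum_distrib_left[symmetric])
  also have "\<dots> \<le> 4 * 2 ^ i * (2 * sqrt (real ?N))"
  proof (rule mult_left_mono)
    have "(\<Sum>d\<in>?I. 1 / real d) \<le> (\<Sum>d=1..?N. 1 / real d)"
      by (intro sum_mono2) auto
    also have "\<dots> \<le> 2 * sqrt (real ?N)" by (rule sum_inverse_le)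
    finally show "(\<Sum>d\<in>?I. 1 / real d) \<le> 2 * sqrt (real ?N)" .
  qed simp
  finally have "2 * (\<Sum>d\<in>?I. osc ?N i d / (real d)\<^sup>2) \<le> 16 * 2 ^ i * sqrt (real ?N)" by simp
  then show ?thesis by (intro order_trans[OF bound] mult_left_mono) auto
qed

text \<open>An entry of the difference is the baker entry times the difference of digit
  \<open>i\<close> at \<open>2 * j\<close> and at \<open>x\<close>. It vanishes on the graph of the
  doubling map; off the graph, the decay of the kernel competes with the oscillation of the
  digit.\<close>

lemma baker_intertwines_Qm:
  assumes M: "M > 0" and i: "i > 0"
  shows "(hs (baker (2 * M) * Qm (2 * M) (Suc i) - Qm (2 * M) i * baker (2 * M)))\<^sup>2
    \<le> 16 * 2 ^ i / sqrt (real (2 * M))"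
proof -
  let ?N = "2 * M" and ?B = "baker (2 * M)"
  let ?r = "rademacher ?N i"
  have N: "?N > 0" using M by simp
  note B[simp] = baker_carrier[OF M]
  note per = rademacher_periodic[OF N i]
  have entry: "(cmod ((?B * Qm ?N (Suc i) - Qm ?N i * ?B) $$ (x, j)))\<^sup>2
      = kernel_sq M (x + 2 * (?N - j)) * (?r x - ?r (2 * j))\<^sup>2 / (2 * (real M)\<^sup>2)"
    if "x < ?N" "j < ?N" for x j
  proof -
    have "(?B * Qm ?N (Suc i) - Qm ?N i * ?B) $$ (x, j) = ?B $$ (x, j) * of_real (?r (2 * j) - ?r x)"
    proof -
      have "(?B * Qm ?N (Suc i)) $$ (x, j) = ?B $$ (x, j) * of_real (?r (2 * j))"
        unfolding Qm_def by (simp only: mult_dg_index[OF B that] rademacher_Suc)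
      moreover have "(Qm ?N i * ?B) $$ (x, j) = of_real (?r x) * ?B $$ (x, j)"
        unfolding Qm_def by (rule dg_mult_index[OF B that])
      ultimately show ?thesis
        using that B by (simp add: right_diff_distrib mult.commute del: index_mult_mat(1))
    qed
    then have "(cmod ((?B * Qm ?N (Suc i) - Qm ?N i * ?B) $$ (x, j)))\<^sup>2
        = (cmod (?B $$ (x, j)))\<^sup>2 * (?r (2 * j) - ?r x)\<^sup>2"
      by (simp only: norm_mult power_mult_distrib norm_of_real power2_abs)
    then show ?thesis using norm_baker_index_sq[OF M that] by (simp add: power2_commute)
  qed
  \<comment> \<open>Substitution \<open>x = 2 * j + d\<close>; periodicity allows the sum over
    \<open>x\<close> to start at \<open>2 * j\<close>.\<close>
  have col: "(\<Sum>x<?N. kernel_sq M (x + 2 * (?N - j)) * (?r x - ?r (2 * j))\<^sup>2)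
      = (\<Sum>d<?N. kernel_sq M d * (?r (2 * j + d) - ?r (2 * j))\<^sup>2)" if j: "j < ?N" for j
  proof -
    let ?G = "\<lambda>x. kernel_sq M (x + 2 * (?N - j)) * (?r x - ?r (2 * j))\<^sup>2"
    have "?G (x + ?N) = ?G x" for x
      using per[of x] kernel_sq_periodic[OF M, of "x + 2 * (?N - j)"] by (simp add: add_ac)
    then have "(\<Sum>x<?N. ?G x) = (\<Sum>d<?N. ?G (d + 2 * j))"
      by (intro sum_periodic_shift[symmetric]) auto
    also have "\<dots> = (\<Sum>d<?N. kernel_sq M d * (?r (2 * j + d) - ?r (2 * j))\<^sup>2)"
    proof (intro sum.cong refl)
      fix d
      have "d + 2 * j + 2 * (?N - j) = d + ?N + ?N" using j by simp
      then have "kernel_sq M (d + 2 * j + 2 * (?N - j)) = kernel_sq M d"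
        using kernel_sq_periodic[OF M, of d] kernel_sq_periodic[OF M, of "d + ?N"] by (simp only:)
      then show "?G (d + 2 * j) = kernel_sq M d * (?r (2 * j + d) - ?r (2 * j))\<^sup>2"
        by (simp add: add.commute)
    qed
    finally show ?thesis .
  qed
  \<comment> \<open>Only the even base points \<open>2 * j\<close> occur, each twice, so a full
    oscillation sum bounds them up to the factor \<open>2\<close>.\<close>
  have double: "(\<Sum>j<?N. (?r (2 * j + d) - ?r (2 * j))\<^sup>2) \<le> 2 * osc ?N i d" for d
    unfolding osc_def
  proof (rule sum_double_le[where g = "\<lambda>y. (?r (y + d) - ?r y)\<^sup>2"])
    show "(?r (y + ?N + d) - ?r (y + ?N))\<^sup>2 = (?r (y + d) - ?r y)\<^sup>2" for y
      using per[of y] per[of "y + d"] by (simp add: add_ac)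
  qed simp
  have "(hs (?B * Qm ?N (Suc i) - Qm ?N i * ?B))\<^sup>2
      = (\<Sum>x<?N. \<Sum>j<?N. (cmod ((?B * Qm ?N (Suc i) - Qm ?N i * ?B) $$ (x, j)))\<^sup>2) / real ?N"
    by (rule hs_power2) (auto intro!: mult_carrier_square minus_carrier_square)
  also have "(\<Sum>x<?N. \<Sum>j<?N. (cmod ((?B * Qm ?N (Suc i) - Qm ?N i * ?B) $$ (x, j)))\<^sup>2)
      = (\<Sum>x<?N. \<Sum>j<?N. kernel_sq M (x + 2 * (?N - j)) * (?r x - ?r (2 * j))\<^sup>2 / (2 * (real M)\<^sup>2))"
    by (intro sum.cong refl entry) auto
  also have "\<dots> = (\<Sum>j<?N. \<Sum>x<?N. kernel_sq M (x + 2 * (?N - j)) * (?r x - ?r (2 * j))\<^sup>2) / (2 * (real M)\<^sup>2)"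
    unfolding sum_divide_distrib by (rule sum.swap)
  also have "(\<Sum>j<?N. \<Sum>x<?N. kernel_sq M (x + 2 * (?N - j)) * (?r x - ?r (2 * j))\<^sup>2)
      = (\<Sum>j<?N. \<Sum>d<?N. kernel_sq M d * (?r (2 * j + d) - ?r (2 * j))\<^sup>2)"
    by (intro sum.cong refl col) auto
  also have "\<dots> = (\<Sum>d<?N. kernel_sq M d * (\<Sum>j<?N. (?r (2 * j + d) - ?r (2 * j))\<^sup>2))"
    unfolding sum_distrib_left by (rule sum.swap)
  finally have eq: "(hs (?B * Qm ?N (Suc i) - Qm ?N i * ?B))\<^sup>2
      = (\<Sum>d<?N. kernel_sq M d * (\<Sum>j<?N. (?r (2 * j + d) - ?r (2 * j))\<^sup>2)) / (2 * (real M)\<^sup>2) / real ?N" .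
  have "(\<Sum>d<?N. kernel_sq M d * (\<Sum>j<?N. (?r (2 * j + d) - ?r (2 * j))\<^sup>2))
      \<le> (\<Sum>d<?N. kernel_sq M d * (2 * osc ?N i d))"
    by (intro sum_mono mult_left_mono double) (simp add: kernel_sq_def)
  also have "\<dots> = 2 * (\<Sum>d<?N. kernel_sq M d * osc ?N i d)"
    unfolding sum_distrib_left by (intro sum.cong) auto
  also have "\<dots> \<le> 2 * ((real M)\<^sup>2 * (16 * 2 ^ i * sqrt (real ?N)))"
    by (intro mult_left_mono sum_kernel_osc_le M i) simp
  finally have "(hs (?B * Qm ?N (Suc i) - Qm ?N i * ?B))\<^sup>2
      \<le> 2 * ((real M)\<^sup>2 * (16 * 2 ^ i * sqrt (real ?N))) / (2 * (real M)\<^sup>2) / real ?N"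
    unfolding eq by (intro divide_right_mono) auto
  also have "\<dots> = 16 * 2 ^ i * (sqrt (real ?N) / real ?N)"
    using M by simp
  also have "sqrt (real ?N) / real ?N = 1 / sqrt (real ?N)"
    using N by (simp add: real_div_sqrt field_simps del: of_nat_mult)
  finally show ?thesis by simp
qed

subsection \<open>Conjugation, reflections and their products\<close>

text \<open>One step of Heisenberg evolution under \<open>U\<close>.\<close>

definition cj :: "complex mat \<Rightarrow> complex mat \<Rightarrow> complex mat" where
  "cj U A = adj U * A * U"

lemma cj_carrier [simp]:
  "U \<in> carrier_mat n n \<Longrightarrow> A \<in> carrier_mat n n \<Longrightarrow> cj U A \<in> carrier_mat n n"
  by (simp add: cj_def)

lemma mult_cj:
  assumes U: "unitary_mat n U" and A: "A \<in> carrier_mat n n"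
  shows "U * cj U A = A * U"
proof -
  note [simp] = unitary_mat_carrier[OF U] A
  have "U * cj U A = U * (adj U * (A * U))"
    unfolding cj_def by (simp add: assoc_mult_mat[of _ n n _ n _ n])
  also have "\<dots> = U * adj U * (A * U)"
    by (rule assoc_mult_mat[of _ n n _ n _ n, symmetric]) auto
  finally show ?thesis by (simp add: unitary_mat_right[OF U])
qed

lemma cj_mult:
  assumes U: "unitary_mat n U" and A: "A \<in> carrier_mat n n" and C: "C \<in> carrier_mat n n"
  shows "cj U (A * C) = cj U A * cj U C"
proof -
  note [simp] = unitary_mat_carrier[OF U] A C
  have "cj U A * cj U C = adj U * A * (U * cj U C)"
    unfolding cj_def[of U A] by (rule assoc_mult_mat[of _ n n _ n _ n]) auto
  also have "\<dots> = cj U (A * C)"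
    unfolding mult_cj[OF U C] by (simp add: cj_def assoc_mult_mat[of _ n n _ n _ n])
  finally show ?thesis by simp
qed

lemma cj_one: "unitary_mat n U \<Longrightarrow> cj U (1\<^sub>m n) = 1\<^sub>m n"
  using unitary_mat_carrier[of n U] unitary_mat_left[of n U] right_mult_one_mat[of "adj U" n n]
  by (simp add: cj_def)

lemma cj_add:
  assumes "U \<in> carrier_mat n n" "A \<in> carrier_mat n n" "C \<in> carrier_mat n n"
  shows "cj U (A + C) = cj U A + cj U C"
  using assms by (simp add: cj_def mult_add_distrib_mat[of _ n n _ n] add_mult_distrib_mat[of _ n n _ _ n])

lemma cj_diff:
  assumes "U \<in> carrier_mat n n" "A \<in> carrier_mat n n" "C \<in> carrier_mat n n"
  shows "cj U (A - C) = cj U A - cj U C"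
  using assms by (simp add: cj_def mult_minus_distrib_mat[of _ n n _ n] minus_mult_distrib_mat[of _ n n _ _ n])

lemma cj_smult:
  assumes "U \<in> carrier_mat n n" "A \<in> carrier_mat n n"
  shows "cj U (c \<cdot>\<^sub>m A) = c \<cdot>\<^sub>m cj U A"
  using assms by (simp add: cj_def mult_smult_distrib[of _ n n _ n] mult_smult_assoc_mat[of _ n n _ n])

lemma ip_cj:
  assumes U: "unitary_mat n U" and [simp]: "A \<in> carrier_mat n n" "C \<in> carrier_mat n n"
  shows "ip (cj U A) (cj U C) = ip A C"
proof -
  note [simp] = unitary_mat_carrier[OF U]
  have "ip (cj U A) (cj U C) = ip (adj U * A) (adj U * C)"
    unfolding cj_def by (rule ip_mult_right[OF U]) auto
  then show ?thesis by (simp add: ip_mult_left[OF unitary_mat_adj[OF U]])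
qed

lemma hs_cj: "unitary_mat n U \<Longrightarrow> A \<in> carrier_mat n n \<Longrightarrow> hs (cj U A) = hs A"
  using unitary_mat_carrier[of n U] by (intro hs_eqI[of _ n] ip_cj) auto

text \<open>Turns an approximate intertwining relation into an approximate evolution with the same
  error.\<close>

lemma hs_cj_diff:
  assumes U: "unitary_mat n U" and [simp]: "A \<in> carrier_mat n n" "C \<in> carrier_mat n n"
  shows "hs (cj U A - C) = hs (A * U - U * C)"
proof -
  note [simp] = unitary_mat_carrier[OF U]
  have "U * (cj U A - C) = A * U - U * C"
    by (simp add: mult_minus_distrib_mat[of _ n n _ n] mult_cj[OF U])
  then show ?thesis using hs_mult_left[OF U, of "cj U A - C"] by simp
qed

lemma adj_cj:
  assumes "U \<in> carrier_mat n n" "A \<in> carrier_mat n n"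
  shows "adj (cj U A) = cj U (adj A)"
  using assms by (simp add: cj_def adj_mult[of _ n n _ n] assoc_mult_mat[of _ n n _ n _ n])

definition hermitian_involution :: "nat \<Rightarrow> complex mat \<Rightarrow> bool" where
  "hermitian_involution n R \<longleftrightarrow> R \<in> carrier_mat n n \<and> adj R = R \<and> R * R = 1\<^sub>m n"

lemma hermitian_involution_carrier: "hermitian_involution n R \<Longrightarrow> R \<in> carrier_mat n n"
  by (simp add: hermitian_involution_def)

lemma hermitian_involution_unitary: "hermitian_involution n R \<Longrightarrow> unitary_mat n R"
  by (simp add: hermitian_involution_def unitary_mat_def)

lemma hermitian_involution_cj:
  assumes U: "unitary_mat n U" and R: "hermitian_involution n R"
  shows "hermitian_involution n (cj U R)"
  using R unitary_mat_carrier[OF U]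
  by (auto simp: hermitian_involution_def adj_cj[of _ n] cj_mult[OF U, symmetric] cj_one[OF U])

lemma hermitian_involution_Qm: "hermitian_involution N (Qm N i)"
proof -
  have "dg N (\<lambda>j. of_real (rademacher N i j) * of_real (rademacher N i j)) = dg N (\<lambda>_. 1)"
    by (rule dg_cong) (simp flip: of_real_mult)
  then show ?thesis by (simp add: hermitian_involution_def Qm_def adj_dg dg_mult dg_one)
qed

text \<open>
  If \<open>R\<close> encodes a binary digit by the eigenvalues \<open>1\<close> and \<open>-1\<close>, then \<open>rot \<theta> R\<close> has the
  eigenvalues \<open>1\<close> and \<open>exp (2 \<pi> i \<theta>)\<close> instead.
\<close>

definition rot :: "real \<Rightarrow> complex mat \<Rightarrow> complex mat" where
  "rot \<theta> R = ((1 + ee \<theta>) / 2) \<cdot>\<^sub>m 1\<^sub>m (dim_row R) + ((1 - ee \<theta>) / 2) \<cdot>\<^sub>m R"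

lemma rot_carrier [simp]: "R \<in> carrier_mat n n \<Longrightarrow> rot \<theta> R \<in> carrier_mat n n"
  by (auto simp: rot_def)

lemma norm_rot_coeff: "cmod ((1 + ee \<theta>) / 2) \<le> 1" "cmod ((1 - ee \<theta>) / 2) \<le> 1"
  using norm_triangle_ineq[of 1 "ee \<theta>"] norm_triangle_ineq4[of 1 "ee \<theta>"] by (simp_all add: norm_divide)

lemma rot_dg:
  assumes "\<And>j. j < N \<Longrightarrow> f j = 1 \<or> f j = - 1"
  shows "rot \<theta> (dg N f) = dg N (\<lambda>j. if f j = 1 then 1 else ee \<theta>)"
proof (rule eq_matI)
  fix i j assume "i < dim_row (dg N (\<lambda>j. if f j = 1 then 1 else ee \<theta>))"
    "j < dim_col (dg N (\<lambda>j. if f j = 1 then 1 else ee \<theta>))"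
  then have "i < N" "j < N" by auto
  then show "rot \<theta> (dg N f) $$ (i, j) = dg N (\<lambda>j. if f j = 1 then 1 else ee \<theta>) $$ (i, j)"
    using assms[of i] by (auto simp: rot_def field_simps)
qed (auto simp: rot_def)

lemma cj_rot:
  assumes U: "unitary_mat n U" and R: "R \<in> carrier_mat n n"
  shows "cj U (rot \<theta> R) = rot \<theta> (cj U R)"
proof -
  have "dim_row (cj U R) = n" "dim_row R = n" using unitary_mat_carrier[OF U] R by (auto simp: cj_def)
  then show ?thesis using unitary_mat_carrier[OF U] R
    by (simp add: rot_def cj_add[of _ n] cj_smult[of _ n] cj_one[OF U])
qed

lemma hs_rot_diff:
  assumes "A \<in> carrier_mat n n" "C \<in> carrier_mat n n"
  shows "hs (rot \<theta> A - rot \<theta> C) \<le> hs (A - C)"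
proof -
  have "rot \<theta> A - rot \<theta> C = ((1 - ee \<theta>) / 2) \<cdot>\<^sub>m (A - C)"
    using assms by (intro eq_matI) (auto simp: rot_def right_diff_distrib)
  then show ?thesis using mult_right_mono[OF norm_rot_coeff(2)[of \<theta>] hs_nonneg[of "A - C"]]
    by (simp add: hs_smult)
qed

lemma unitary_rot:
  assumes R: "hermitian_involution n R"
  shows "unitary_mat n (rot \<theta> R)"
proof -
  define a where "a = (1 + ee \<theta>) / 2"
  define b where "b = (1 - ee \<theta>) / 2"
  note [simp] = hermitian_involution_carrier[OF R]
  have [simp]: "dim_row R = n" "dim_col R = n"
    using hermitian_involution_carrier[OF R] unfolding carrier_mat_def by auto
  have RR: "R * R = 1\<^sub>m n" "adj R = R" using R by (auto simp: hermitian_involution_def)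
  have rot: "rot \<theta> R = a \<cdot>\<^sub>m 1\<^sub>m n + b \<cdot>\<^sub>m R"
    by (simp add: rot_def a_def b_def)
  have "adj (rot \<theta> R) = cnj a \<cdot>\<^sub>m 1\<^sub>m n + cnj b \<cdot>\<^sub>m R"
  proof (rule eq_matI)
    fix i j assume "i < dim_row (cnj a \<cdot>\<^sub>m 1\<^sub>m n + cnj b \<cdot>\<^sub>m R)" "j < dim_col (cnj a \<cdot>\<^sub>m 1\<^sub>m n + cnj b \<cdot>\<^sub>m R)"
    then have ij: "i < n" "j < n" using hermitian_involution_carrier[OF R] by auto
    have "cnj (R $$ (j, i)) = R $$ (i, j)"
      using RR(2) ij adj_index[of i R j] by simp
    then show "adj (rot \<theta> R) $$ (i, j) = (cnj a \<cdot>\<^sub>m 1\<^sub>m n + cnj b \<cdot>\<^sub>m R) $$ (i, j)"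
      using ij by (auto simp: rot adj_index)
  qed (auto simp: rot)
  moreover have "(cnj a \<cdot>\<^sub>m 1\<^sub>m n + cnj b \<cdot>\<^sub>m R) * (a \<cdot>\<^sub>m 1\<^sub>m n + b \<cdot>\<^sub>m R)
      = (cnj a * a + cnj b * b) \<cdot>\<^sub>m 1\<^sub>m n + (cnj a * b + cnj b * a) \<cdot>\<^sub>m R"
  proof -
    have "(cnj a \<cdot>\<^sub>m 1\<^sub>m n + cnj b \<cdot>\<^sub>m R) * (a \<cdot>\<^sub>m 1\<^sub>m n + b \<cdot>\<^sub>m R)
        = cnj a \<cdot>\<^sub>m (a \<cdot>\<^sub>m 1\<^sub>m n + b \<cdot>\<^sub>m R) + cnj b \<cdot>\<^sub>m (R * (a \<cdot>\<^sub>m 1\<^sub>m n + b \<cdot>\<^sub>m R))"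
      by (simp add: add_mult_distrib_mat[of _ n n _ _ n] mult_smult_assoc_mat[of _ n n _ n])
    also have "R * (a \<cdot>\<^sub>m 1\<^sub>m n + b \<cdot>\<^sub>m R) = a \<cdot>\<^sub>m R + b \<cdot>\<^sub>m 1\<^sub>m n"
      using right_mult_one_mat[of R n n]
      by (simp add: mult_add_distrib_mat[of _ n n _ n] mult_smult_distrib[of _ n n _ n] RR)
    finally show ?thesis
      by (intro eq_matI) (auto simp: algebra_simps)
  qed
  moreover have "cnj a * a + cnj b * b = 1" "cnj a * b + cnj b * a = 0"
  proof -
    have e: "cnj (ee \<theta>) * ee \<theta> = 1"
      using complex_norm_square[of "ee \<theta>"] by (simp add: mult.commute)
    show "cnj a * a + cnj b * b = 1" "cnj a * b + cnj b * a = 0"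
      using e by (simp_all add: a_def b_def field_simps)
  qed
  moreover have "1 \<cdot>\<^sub>m 1\<^sub>m n + 0 \<cdot>\<^sub>m R = 1\<^sub>m n"
    by (intro eq_matI) auto
  ultimately show ?thesis by (simp add: unitary_mat_def rot[symmetric])
qed

section \<open>Ordered products and iterated conjugation\<close>

definition lprod :: "nat \<Rightarrow> complex mat list \<Rightarrow> complex mat" where
  "lprod n As = foldr (*) As (1\<^sub>m n)"

lemma lprod_Nil [simp]: "lprod n [] = 1\<^sub>m n"
  and lprod_Cons [simp]: "lprod n (A # As) = A * lprod n As"
  by (simp_all add: lprod_def)

lemma lprod_carrier [simp]: "(\<And>A. A \<in> set As \<Longrightarrow> A \<in> carrier_mat n n) \<Longrightarrow> lprod n As \<in> carrier_mat n n"
  by (induction As) auto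

lemma unitary_lprod: "(\<And>A. A \<in> set As \<Longrightarrow> unitary_mat n A) \<Longrightarrow> unitary_mat n (lprod n As)"
  by (induction As) (auto intro: unitary_mat_mult)

lemma lprod_append:
  assumes "\<And>A. A \<in> set As \<union> set Bs \<Longrightarrow> A \<in> carrier_mat n n"
  shows "lprod n (As @ Bs) = lprod n As * lprod n Bs"
  using assms
proof (induction As)
  case (Cons A As)
  then have "A \<in> carrier_mat n n" "lprod n As \<in> carrier_mat n n" "lprod n Bs \<in> carrier_mat n n"
    by auto
  then show ?case using Cons by (simp add: assoc_mult_mat[of _ n n _ n _ n])
qed simp

lemma cj_lprod:
  assumes U: "unitary_mat n U" and "\<And>A. A \<in> set As \<Longrightarrow> A \<in> carrier_mat n n"
  shows "cj U (lprod n As) = lprod n (map (cj U) As)"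
  using assms(2) by (induction As) (simp_all add: cj_one[OF U] cj_mult[OF U])

lemma hs_lprod_diff:
  assumes "\<And>x. x \<in> set xs \<Longrightarrow> unitary_mat n (f x)" "\<And>x. x \<in> set xs \<Longrightarrow> unitary_mat n (g x)" "n > 0"
  shows "hs (lprod n (map f xs) - lprod n (map g xs)) \<le> (\<Sum>x\<leftarrow>xs. hs (f x - g x))"
  using assms(1,2)
proof (induction xs)
  case Nil
  have "ip (1\<^sub>m n - 1\<^sub>m n) (1\<^sub>m n - 1\<^sub>m n) = 0" by (simp add: ip_def)
  then have "hs (1\<^sub>m n - 1\<^sub>m n) = 0"
    using ip_self[of "1\<^sub>m n - 1\<^sub>m n" n] by simp
  then show ?case by simp
next
  case (Cons x xs)
  have "hs (lprod n (map f (x # xs)) - lprod n (map g (x # xs)))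
      \<le> hs (f x - g x) + hs (lprod n (map f xs) - lprod n (map g xs))"
    using Cons.prems unfolding list.map lprod_Cons
    by (intro hs_mult_diff[of n] unitary_lprod) auto
  then show ?case using Cons by fastforce
qed

lemma lprod_dg: "lprod N (map (\<lambda>x. dg N (f x)) xs) = dg N (\<lambda>j. \<Prod>x\<leftarrow>xs. f x j)"
  by (induction xs) (simp_all add: dg_mult dg_one)

lemma cj_pow_carrier [simp]:
  "U \<in> carrier_mat n n \<Longrightarrow> A \<in> carrier_mat n n \<Longrightarrow> (cj U ^^ k) A \<in> carrier_mat n n"
  by (induction k) auto

lemma cj_pow_unitary: "unitary_mat n U \<Longrightarrow> unitary_mat n A \<Longrightarrow> unitary_mat n ((cj U ^^ k) A)"
  by (induction k) (auto simp: cj_def intro: unitary_mat_mult unitary_mat_adj)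

lemma cj_pow_hermitian_involution:
  "unitary_mat n U \<Longrightarrow> hermitian_involution n R \<Longrightarrow> hermitian_involution n ((cj U ^^ k) R)"
  by (induction k) (auto intro: hermitian_involution_cj)

lemma cj_pow_mult:
  assumes U: "unitary_mat n U" and "A \<in> carrier_mat n n" "C \<in> carrier_mat n n"
  shows "(cj U ^^ k) (A * C) = (cj U ^^ k) A * (cj U ^^ k) C"
  using assms(2,3) unitary_mat_carrier[OF U] by (induction k) (simp_all add: cj_mult[OF U])

lemma cj_pow_rot:
  assumes U: "unitary_mat n U" and "R \<in> carrier_mat n n"
  shows "(cj U ^^ k) (rot \<theta> R) = rot \<theta> ((cj U ^^ k) R)"
  using assms(2) unitary_mat_carrier[OF U] by (induction k) (simp_all add: cj_rot[OF U])

lemma cj_pow_lprod: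
  assumes U: "unitary_mat n U" and "\<And>A. A \<in> set As \<Longrightarrow> A \<in> carrier_mat n n"
  shows "(cj U ^^ k) (lprod n As) = lprod n (map (cj U ^^ k) As)"
  using assms(2)
proof (induction k)
  case (Suc k)
  have "(cj U ^^ Suc k) (lprod n As) = cj U (lprod n (map (cj U ^^ k) As))"
    using Suc by simp
  also have "\<dots> = lprod n (map (cj U) (map (cj U ^^ k) As))"
    using Suc unitary_mat_carrier[OF U] by (intro cj_lprod[OF U]) auto
  finally show ?case by (simp add: comp_def)
qed (simp add: list.map_id0[unfolded id_def])

lemma ip_cj_pow:
  assumes U: "unitary_mat n U" and "A \<in> carrier_mat n n" "C \<in> carrier_mat n n"
  shows "ip ((cj U ^^ k) A) ((cj U ^^ k) C) = ip A C"
  using assms(2,3) unitary_mat_carrier[OF U] by (induction k) (simp_all add: ip_cj[OF U])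

lemma hs_cj_pow_diff:
  assumes U: "unitary_mat n U" and "A \<in> carrier_mat n n" "C \<in> carrier_mat n n"
  shows "hs ((cj U ^^ k) A - (cj U ^^ k) C) = hs (A - C)"
  using assms(2,3) unitary_mat_carrier[OF U]
  by (induction k) (simp_all add: cj_diff[of _ n, symmetric] hs_cj[OF U])

lemma cj_cj:
  assumes "U \<in> carrier_mat n n" "V \<in> carrier_mat n n" "A \<in> carrier_mat n n"
  shows "cj U (cj V A) = cj (V * U) A"
  using assms by (simp add: cj_def adj_mult[of _ n n _ n] assoc_mult_mat[of _ n n _ n _ n])

subsection \<open>Evolution of digits\<close>

text \<open>The reflection of a momentum digit: it is diagonal after a Fourier transform.\<close>

definition Pm :: "nat \<Rightarrow> nat \<Rightarrow> complex mat" where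
  "Pm N i = cj (dft N) (Qm N i)"

definition Zm :: "nat \<Rightarrow> nat \<Rightarrow> complex mat" where
  "Zm M i = (cj (baker (2 * M)) ^^ i) (Qm (2 * M) 1)"

text \<open>The square root of the factor \<open>1 / sqrt N\<close> in
  \<open>baker_intertwines_Qm\<close>.\<close>

definition eta :: "nat \<Rightarrow> real" where
  "eta M = 1 / sqrt (sqrt (real (2 * M)))"

definition word :: "nat \<Rightarrow> nat list \<Rightarrow> complex mat" where
  "word M u = lprod (2 * M) (map (Zm M) u)"

context
  fixes M :: nat
  assumes M: "M > 0"
begin

lemma N_pos: "(2 * M) > 0" using M by simp

lemma eta_nonneg: "0 \<le> eta M" by (simp add: eta_def)

lemma baker_Qm_le:
  assumes "i > 0"
  shows "hs ((baker (2 * M)) * Qm (2 * M) (Suc i) - Qm (2 * M) i * (baker (2 * M))) \<le> 4 * 2 ^ i * eta M"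
proof (rule power2_le_imp_le)
  have "(hs ((baker (2 * M)) * Qm (2 * M) (Suc i) - Qm (2 * M) i * (baker (2 * M))))\<^sup>2 \<le> 16 * 2 ^ i / sqrt (real (2 * M))"
    by (rule baker_intertwines_Qm[OF M assms])
  \<comment> \<open>Squaring \<open>2 ^ i\<close> avoids its square root; extra powers of two in the
    error are affordable.\<close>
  also have "\<dots> \<le> 16 * (2 ^ i)\<^sup>2 / sqrt (real (2 * M))"
    by (intro divide_right_mono mult_left_mono) (auto simp: power2_eq_square)
  also have "\<dots> = (4 * 2 ^ i * eta M)\<^sup>2"
    by (simp add: eta_def power_mult_distrib power_divide)
  finally show "(hs ((baker (2 * M)) * Qm (2 * M) (Suc i) - Qm (2 * M) i * (baker (2 * M))))\<^sup>2 \<le> (4 * 2 ^ i * eta M)\<^sup>2" .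
qed (simp add: eta_nonneg)

lemmas unitary_baker_M = unitary_baker[OF M]

lemma Zm_carrier [simp]: "Zm M i \<in> carrier_mat (2 * M) (2 * M)"
  using unitary_mat_carrier[OF unitary_baker_M] by (simp add: Zm_def)

lemma Zm_hermitian_involution: "hermitian_involution (2 * M) (Zm M i)"
  unfolding Zm_def by (intro cj_pow_hermitian_involution unitary_baker_M hermitian_involution_Qm)

lemma unitary_Zm: "unitary_mat (2 * M) (Zm M i)"
  by (intro hermitian_involution_unitary Zm_hermitian_involution)

lemma cj_pow_Zm: "(cj (baker (2 * M)) ^^ k) (Zm M i) = Zm M (i + k)"
  by (simp add: Zm_def add.commute[of i k] funpow_add)

lemma Zm_Suc: "Zm M (Suc i) = cj (baker (2 * M)) (Zm M i)"
  by (simp add: Zm_def)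

text \<open>Earlier errors are transported isometrically, and passing from time \<open>i\<close> to
  \<open>i + 1\<close> adds \<open>4 * 2 ^ (i + 1) * eta M\<close>. The constant \<open>8\<close>
  absorbs this geometric sum.\<close>

lemma Zm_approx: "hs (Zm M i - Qm (2 * M) (Suc i)) \<le> 8 * 2 ^ i * eta M"
proof (induction i)
  case 0
  have "Zm M 0 - Qm (2 * M) (Suc 0) = 0 \<cdot>\<^sub>m Qm (2 * M) 1"
    by (intro eq_matI) (auto simp: Zm_def)
  then show ?case by (simp add: hs_smult eta_nonneg)
next
  case (Suc i)
  have "hs (Zm M (Suc i) - cj (baker (2 * M)) (Qm (2 * M) (Suc i))) = hs (Zm M i - Qm (2 * M) (Suc i))"
    using hs_cj_pow_diff[OF unitary_baker_M, of "Zm M i" "Qm (2 * M) (Suc i)" 1] Zm_carrier by (simp add: Zm_Suc)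
  moreover have "hs (Zm M (Suc i) - Qm (2 * M) (Suc (Suc i)))
      \<le> hs (Zm M (Suc i) - cj (baker (2 * M)) (Qm (2 * M) (Suc i))) + hs (cj (baker (2 * M)) (Qm (2 * M) (Suc i)) - Qm (2 * M) (Suc (Suc i)))"
    using unitary_mat_carrier[OF unitary_baker_M] by (intro hs_triangle[of _ "2 * M"]) auto
  moreover have "hs (cj (baker (2 * M)) (Qm (2 * M) (Suc i)) - Qm (2 * M) (Suc (Suc i))) \<le> 4 * 2 ^ Suc i * eta M"
  proof -
  have "hs (cj (baker (2 * M)) (Qm (2 * M) (Suc i)) - Qm (2 * M) (Suc (Suc i))) = hs (Qm (2 * M) (Suc i) * (baker (2 * M)) - (baker (2 * M)) * Qm (2 * M) (Suc (Suc i)))"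
    by (rule hs_cj_diff[OF unitary_baker_M]) auto
  also have "\<dots> = hs ((baker (2 * M)) * Qm (2 * M) (Suc (Suc i)) - Qm (2 * M) (Suc i) * (baker (2 * M)))"
    using unitary_mat_carrier[OF unitary_baker_M] by (intro hs_diff_commute[of _ "2 * M"]) auto
  also have "\<dots> \<le> 4 * 2 ^ Suc i * eta M" by (rule baker_Qm_le) simp
  finally show ?thesis .
  qed
  ultimately show ?case using Suc by (simp add: algebra_simps)
qed

section \<open>Evolution of momentum digits\<close>

lemma Pm_carrier [simp]: "Pm (2 * M) i \<in> carrier_mat (2 * M) (2 * M)"
  by (simp add: Pm_def)

lemma unitary_dft_M: "unitary_mat (2 * M) (dft (2 * M))" by (rule unitary_dft[OF N_pos])

lemma Pm_hermitian_involution: "hermitian_involution (2 * M) (Pm (2 * M) i)"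
  unfolding Pm_def by (intro hermitian_involution_cj unitary_dft_M hermitian_involution_Qm)

lemma dft_mult_baker: "dft (2 * M) * (baker (2 * M)) = blk M"
proof -
  have "dft (2 * M) * (baker (2 * M)) = dft (2 * M) * adj (dft (2 * M)) * blk M"
    unfolding baker_eq[OF M] by (rule assoc_mult_mat[of _ "2 * M" "2 * M" _ "2 * M" _ "2 * M", symmetric]) auto
  then show ?thesis by (simp add: unitary_mat_right[OF unitary_dft_M])
qed

text \<open>An exact relation: after one step the leading momentum digit is the leading position
  digit, because \<open>blk M\<close> is block diagonal with respect to the two halves and commutes
  with their sign. It places the momentum digits at negative times of \<open>Zm\<close>.\<close>

lemma cj_Pm_one: "cj (baker (2 * M)) (Pm (2 * M) 1) = Qm (2 * M) 1"
proof -
  have "cj (baker (2 * M)) (Pm (2 * M) 1) = cj (blk M) (Qm (2 * M) 1)"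
    using unitary_mat_carrier[OF unitary_baker_M] by (simp add: Pm_def cj_cj[of _ "2 * M"] dft_mult_baker)
  moreover have "Qm (2 * M) 1 * blk M = blk M * Qm (2 * M) 1"
  proof (rule eq_matI)
    fix k j assume "k < dim_row (blk M * Qm (2 * M) 1)" "j < dim_col (blk M * Qm (2 * M) 1)"
    then have kj: "k < (2 * M)" "j < (2 * M)" by auto
    have r: "rademacher (2 * M) 1 k = (if k < M then 1 else - 1)" if "k < (2 * M)" for k
    proof (cases "k < M")
      case False
      then have "(2 * k) div (2 * M) = 1" using that by (intro div_nat_eqI) auto
      then show ?thesis using False by (simp add: rademacher_def)
    qed (simp add: rademacher_def)
    have "(Qm (2 * M) 1 * blk M) $$ (k, j) = of_real (rademacher (2 * M) 1 k) * blk M $$ (k, j)"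
      unfolding Qm_def using kj by (intro dg_mult_index[of _ _ "2 * M"]) auto
    also have "\<dots> = blk M $$ (k, j) * of_real (rademacher (2 * M) 1 j)"
      using kj by (simp add: blk_index r[simplified])
    also have "\<dots> = (blk M * Qm (2 * M) 1) $$ (k, j)"
      unfolding Qm_def using kj by (intro mult_dg_index[of _ "2 * M", symmetric]) auto
    finally show "(Qm (2 * M) 1 * blk M) $$ (k, j) = (blk M * Qm (2 * M) 1) $$ (k, j)" .
  qed auto
  moreover have "adj (blk M) * (blk M * Qm (2 * M) 1) = adj (blk M) * blk M * Qm (2 * M) 1"
    by (rule assoc_mult_mat[of _ "2 * M" "2 * M" _ "2 * M" _ "2 * M", symmetric]) auto
  ultimately show ?thesis using unitary_mat_left[OF unitary_blk[OF M]]
    by (simp add: cj_def assoc_mult_mat[of _ "2 * M" "2 * M" _ "2 * M" _ "2 * M"])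
qed

text \<open>Time reversal: conjugation by the Fourier transform turns the baker matrix into its transpose.\<close>

lemma baker_Pm_le:
  assumes i: "i > 0"
  shows "hs (cj (baker (2 * M)) (Pm (2 * M) (Suc i)) - Pm (2 * M) i) \<le> 4 * 2 ^ i * eta M"
proof -
  let ?F = "dft (2 * M)" and ?b = "blk M"
  note [simp] = unitary_mat_carrier[OF unitary_baker_M]
  have uF: "unitary_mat (2 * M) (adj ?F)" by (rule unitary_mat_adj[OF unitary_dft_M])
  \<comment> \<open>Both factors of the baker matrix are symmetric, so transposition only exchanges
    them.\<close>
  have BT: "transpose_mat (baker (2 * M)) = ?b * adj ?F"
  proof -
    have "transpose_mat (adj ?F) = adj ?F"
      by (rule eq_matI) (auto simp: adj_index dft_index mult.commute)
    then show ?thesis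
      unfolding baker_eq[OF M] by (subst transpose_mult[of _ "2 * M" "2 * M" _ "2 * M"]) (auto simp: blk_transpose)
  qed
  have "hs (cj (baker (2 * M)) (Pm (2 * M) (Suc i)) - Pm (2 * M) i) = hs (Pm (2 * M) (Suc i) * (baker (2 * M)) - (baker (2 * M)) * Pm (2 * M) i)"
    by (rule hs_cj_diff[OF unitary_baker_M]) auto
  also have "\<dots> = hs (?F * (Pm (2 * M) (Suc i) * (baker (2 * M)) - (baker (2 * M)) * Pm (2 * M) i))"
    by (rule hs_mult_left[OF unitary_dft_M, symmetric]) auto
  also have "\<dots> = hs (?F * (Pm (2 * M) (Suc i) * (baker (2 * M)) - (baker (2 * M)) * Pm (2 * M) i) * adj ?F)"
    by (rule hs_mult_right[OF uF, symmetric]) auto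
  \<comment> \<open>Conjugation by the Fourier transform turns the momentum reflections into
    position reflections and the baker matrix into its transpose, which leaves the transpose of the
    known difference.\<close>
  also have "?F * (Pm (2 * M) (Suc i) * (baker (2 * M)) - (baker (2 * M)) * Pm (2 * M) i) * adj ?F
      = ?F * Pm (2 * M) (Suc i) * (baker (2 * M)) * adj ?F - ?F * (baker (2 * M)) * Pm (2 * M) i * adj ?F"
    by (simp add: mult_minus_distrib_mat[of _ "2 * M" "2 * M" _ "2 * M"] minus_mult_distrib_mat[of _ "2 * M" "2 * M" _ _ "2 * M"]
        assoc_mult_mat[of _ "2 * M" "2 * M" _ "2 * M" _ "2 * M"])
  also have "?F * Pm (2 * M) (Suc i) * (baker (2 * M)) * adj ?F = Qm (2 * M) (Suc i) * (?b * adj ?F)"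
    unfolding Pm_def mult_cj[OF unitary_dft_M Qm_carrier] dft_mult_baker[symmetric]
    by (simp add: assoc_mult_mat[of _ "2 * M" "2 * M" _ "2 * M" _ "2 * M"])
  also have "?F * (baker (2 * M)) * Pm (2 * M) i * adj ?F = ?b * adj ?F * Qm (2 * M) i"
  proof -
    have "Pm (2 * M) i * adj ?F = adj ?F * Qm (2 * M) i"
      using unitary_dft_M by (simp add: Pm_def cj_def assoc_mult_mat[of _ "2 * M" "2 * M" _ "2 * M" _ "2 * M"] unitary_mat_right
          right_mult_one_mat[of "Qm (2 * M) i" "2 * M" "2 * M"])
    then show ?thesis unfolding dft_mult_baker by (simp add: assoc_mult_mat[of _ "2 * M" "2 * M" _ "2 * M" _ "2 * M"])
  qed
  also have "Qm (2 * M) (Suc i) * (?b * adj ?F) - ?b * adj ?F * Qm (2 * M) i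
      = transpose_mat ((baker (2 * M)) * Qm (2 * M) (Suc i) - Qm (2 * M) i * (baker (2 * M)))"
    unfolding BT[symmetric]
    by (simp add: transpose_minus[of _ "2 * M" "2 * M"] transpose_mult[of _ "2 * M" "2 * M" _ "2 * M"] Qm_def dg_transpose)
  also have "hs \<dots> = hs ((baker (2 * M)) * Qm (2 * M) (Suc i) - Qm (2 * M) i * (baker (2 * M)))"
    by (rule hs_transpose[of _ "2 * M"]) auto
  also have "\<dots> \<le> 4 * 2 ^ i * eta M" by (rule baker_Qm_le[OF i])
  finally show ?thesis .
qed

text \<open>Each step lowers the index of the momentum digit by one; the last step, from the first
  momentum digit to the first position digit, is exact. Thus momentum digit \<open>i + 1\<close>
  behaves like a reflection at time \<open>- (i + 1)\<close>, with geometrically summed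
  errors.\<close>

lemma cj_pow_Pm_approx: "hs ((cj (baker (2 * M)) ^^ Suc i) (Pm (2 * M) (Suc i)) - Qm (2 * M) 1) \<le> 8 * 2 ^ i * eta M"
proof (induction i)
  case 0
  have "cj (baker (2 * M)) (Pm (2 * M) 1) - Qm (2 * M) 1 = 0 \<cdot>\<^sub>m Qm (2 * M) 1"
    unfolding cj_Pm_one by (intro eq_matI) auto
  then show ?case by (simp add: hs_smult eta_nonneg)
next
  case (Suc i)
  note [simp] = unitary_mat_carrier[OF unitary_baker_M]
  let ?C = "cj (baker (2 * M)) ^^ Suc i"
  \<comment> \<open>The innermost step is split off, since it is the one that lowers the digit from
    \<open>i + 2\<close> to \<open>i + 1\<close>.\<close>
  have "(cj (baker (2 * M)) ^^ Suc (Suc i)) (Pm (2 * M) (Suc (Suc i))) = ?C (cj (baker (2 * M)) (Pm (2 * M) (Suc (Suc i))))"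
    by (subst funpow_Suc_right) simp
  then have "hs ((cj (baker (2 * M)) ^^ Suc (Suc i)) (Pm (2 * M) (Suc (Suc i))) - Qm (2 * M) 1)
      \<le> hs (?C (cj (baker (2 * M)) (Pm (2 * M) (Suc (Suc i)))) - ?C (Pm (2 * M) (Suc i))) + hs (?C (Pm (2 * M) (Suc i)) - Qm (2 * M) 1)"
    by (simp only:) (intro hs_triangle[of _ "2 * M"] cj_pow_carrier; simp)
  also have "hs (?C (cj (baker (2 * M)) (Pm (2 * M) (Suc (Suc i)))) - ?C (Pm (2 * M) (Suc i)))
      = hs (cj (baker (2 * M)) (Pm (2 * M) (Suc (Suc i))) - Pm (2 * M) (Suc i))"
    by (rule hs_cj_pow_diff[OF unitary_baker_M]) auto
  also have "\<dots> \<le> 4 * 2 ^ Suc i * eta M" by (rule baker_Pm_le) simp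
  finally show ?case using Suc by simp
qed

section \<open>Words in the evolved reflections\<close>

lemma word_carrier [simp]: "word M u \<in> carrier_mat (2 * M) (2 * M)"
  unfolding word_def by (rule lprod_carrier) auto

lemma unitary_word: "unitary_mat (2 * M) (word M u)"
  unfolding word_def by (rule unitary_lprod) (auto simp: unitary_Zm)

lemma cj_pow_word: "(cj (baker (2 * M)) ^^ k) (word M u) = word M (map (\<lambda>i. i + k) u)"
  unfolding word_def by (subst cj_pow_lprod[OF unitary_baker_M]) (auto simp: comp_def cj_pow_Zm)

text \<open>The diagonal comparison matrix is a Walsh function of the position, with time
  \<open>i\<close> standing for digit \<open>i + 1\<close>. The error is the number of factors times
  the worst single error.\<close>

lemma word_approx:
  assumes "\<And>i. i \<in> set u \<Longrightarrow> i \<le> L"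
  shows "hs (word M u - dg (2 * M) (\<lambda>j. \<Prod>i\<leftarrow>u. of_real (rademacher (2 * M) (Suc i) j))) \<le> real (length u) * (8 * 2 ^ L * eta M)"
proof -
  have "hs (word M u - dg (2 * M) (\<lambda>j. \<Prod>i\<leftarrow>u. of_real (rademacher (2 * M) (Suc i) j)))
      = hs (lprod (2 * M) (map (Zm M) u) - lprod (2 * M) (map (\<lambda>i. Qm (2 * M) (Suc i)) u))"
    by (simp add: word_def Qm_def lprod_dg)
  also have "\<dots> \<le> (\<Sum>i\<leftarrow>u. hs (Zm M i - Qm (2 * M) (Suc i)))"
    by (rule hs_lprod_diff) (auto simp: unitary_Zm unitary_Qm M)
  also have "\<dots> \<le> (\<Sum>i\<leftarrow>u. 8 * 2 ^ L * eta M)"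
  proof (rule sum_list_mono)
    fix i assume "i \<in> set u"
    then have "(2::real) ^ i \<le> 2 ^ L" using assms by (intro power_increasing) auto
    then have "8 * 2 ^ i * eta M \<le> 8 * 2 ^ L * eta M"
      using eta_nonneg by (intro mult_right_mono) auto
    then show "hs (Zm M i - Qm (2 * M) (Suc i)) \<le> 8 * 2 ^ L * eta M"
      using Zm_approx[of i] by linarith
  qed
  finally show ?thesis by (simp add: sum_list_const_mult[symmetric] sum_list_triv)
qed

lemma rademacher_word_half_period:
  assumes "\<And>i. i \<in> set u \<Longrightarrow> i > 0"
  shows "(\<Prod>i\<leftarrow>u. of_real (rademacher (2 * M) (Suc i) (j + M))) = (\<Prod>i\<leftarrow>u. of_real (rademacher (2 * M) (Suc i) j) :: complex)"
  using assms by (induction u) (auto simp: rademacher_half_period[OF M])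

text \<open>The digit number 1 flips under \<open>j \<mapsto> j + M\<close>, all higher digits are unaffected.\<close>

lemma ip_diag_words:
  assumes "\<And>i. i \<in> set u \<Longrightarrow> i > 0" "\<And>i. i \<in> set v \<Longrightarrow> i > 0"
  shows "ip (dg (2 * M) (\<lambda>j. \<Prod>i\<leftarrow>0 # u. of_real (rademacher (2 * M) (Suc i) j)))
            (dg (2 * M) (\<lambda>j. \<Prod>i\<leftarrow>v. of_real (rademacher (2 * M) (Suc i) j))) = 0"
proof -
  let ?f = "\<lambda>j. cnj (\<Prod>i\<leftarrow>0 # u. of_real (rademacher (2 * M) (Suc i) j)) * (\<Prod>i\<leftarrow>v. of_real (rademacher (2 * M) (Suc i) j))"
  have "?f (j + M) = - ?f j" for j
    using rademacher_word_half_period[OF assms(1), where j = j] rademacher_word_half_period[OF assms(2), where j = j]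
      rademacher_one_half_period[OF M, of j, simplified] by simp
  then have "(\<Sum>j<(2 * M). ?f j) = 0"
    unfolding sum_halves by (simp only: sum.distrib[symmetric]) simp
  then show ?thesis unfolding ip_dg by simp
qed

text \<open>
  Invariance under conjugation moves the earliest time of the first word to \<open>0\<close>; all times in the
  second word are then positive.
\<close>

lemma ip_words_le:
  assumes u: "sorted_wrt (<) u" "u \<noteq> []" and L: "\<And>i. i \<in> set u \<Longrightarrow> i + t \<le> L" and st: "s < t"
  shows "cmod (ip (word M (map (\<lambda>i. i + s) u)) (word M (map (\<lambda>i. i + t) u)))
    \<le> 2 * (real (length u) * (8 * 2 ^ L * eta M))"
proof -
  obtain a w where aw: "u = a # w" using u(2) by (cases u) auto
  define w' where "w' = map (\<lambda>i. i - a) w"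
  define d where "d = t - s"
  have w: "a < i" if "i \<in> set w" for i using u(1) aw that by auto
  define v where "v = map (\<lambda>i. i + d) (0 # w')"
  let ?u = "0 # w'" and ?v = v
  let ?D = "\<lambda>u. dg (2 * M) (\<lambda>j. \<Prod>i\<leftarrow>u. of_real (rademacher (2 * M) (Suc i) j))"
  let ?e = "real (length u) * (8 * 2 ^ L * eta M)"
  have us: "map (\<lambda>i. i + s) u = map (\<lambda>i. i + (a + s)) ?u"
    using w by (force simp: aw w'_def)
  have ut: "map (\<lambda>i. i + t) u = map (\<lambda>i. i + (a + s)) ?v"
    using w st by (force simp: aw w'_def d_def v_def)
  have pos: "\<And>i. i \<in> set w' \<Longrightarrow> i > 0" "\<And>i. i \<in> set ?v \<Longrightarrow> i > 0"
    using w st by (auto simp: w'_def d_def v_def)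
  have unit: "unitary_mat (2 * M) (?D u)" for u
    by (rule unitary_dg) (induction u, auto simp: norm_mult)
  have e1: "hs (word M ?u - ?D ?u) \<le> ?e"
  proof -
    have "hs (word M ?u - ?D ?u) \<le> real (length ?u) * (8 * 2 ^ L * eta M)"
    proof (rule word_approx)
      fix i assume "i \<in> set ?u"
      then consider "i = 0" | l where "l \<in> set w" "i = l - a" by (auto simp: w'_def)
      then show "i \<le> L"
      proof cases
        case (2 l)
        then show ?thesis using L[of l] aw by simp
      qed simp
    qed
    then show ?thesis by (simp add: aw w'_def)
  qed
  have e2: "hs (word M ?v - ?D ?v) \<le> ?e"
  proof -
    have "hs (word M ?v - ?D ?v) \<le> real (length ?v) * (8 * 2 ^ L * eta M)"
    proof (rule word_approx)
      fix i assume "i \<in> set v"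
      then consider "i = d" | l where "l \<in> set w" "i = l - a + d" by (auto simp: v_def w'_def)
      then show "i \<le> L"
      proof cases
        case 1
        then show ?thesis using L[of a] aw by (simp add: d_def)
      next
        case (2 l)
        then show ?thesis using L[of l] aw by (simp add: d_def)
      qed
    qed
    then show ?thesis by (simp add: aw w'_def v_def)
  qed
  have "ip (word M (map (\<lambda>i. i + s) u)) (word M (map (\<lambda>i. i + t) u)) = ip (word M ?u) (word M ?v)"
    unfolding us ut cj_pow_word[symmetric] by (rule ip_cj_pow[OF unitary_baker_M]) auto
  \<comment> \<open>The two diagonal words are exactly orthogonal, so replacing the left and then
    the right word leaves only the two error terms.\<close>
  also have "\<dots> = ip (word M ?u - ?D ?u) (word M ?v) + ip (?D ?u) (word M ?v - ?D ?v)"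
    by (simp add: ip_diff_left[of _ "2 * M"] ip_diff_right[of _ "2 * M"] ip_diag_words[OF pos] del: list.map prod_list.Cons)
  finally have "cmod (ip (word M (map (\<lambda>i. i + s) u)) (word M (map (\<lambda>i. i + t) u)))
      \<le> cmod (ip (word M ?u - ?D ?u) (word M ?v)) + cmod (ip (?D ?u) (word M ?v - ?D ?v))"
    by (simp only: norm_triangle_ineq)
  also have "\<dots> \<le> hs (word M ?u - ?D ?u) * hs (word M ?v) + hs (?D ?u) * hs (word M ?v - ?D ?v)"
    by (intro add_mono ip_bound[of _ "2 * M"]) auto
  also have "\<dots> \<le> 2 * ?e"
    using e1 e2 unfolding hs_unitary[OF N_pos unitary_word] hs_unitary[OF N_pos unit] by simp
  finally show ?thesis .
qed

end

subsection \<open>Diagonal matrix elements in an eigenbasis\<close>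

definition expect :: "(nat \<Rightarrow> complex Matrix.vec) \<Rightarrow> complex mat \<Rightarrow> nat \<Rightarrow> complex" where
  "expect \<phi> A j = inner_H (\<phi> j) (A *\<^sub>v \<phi> j)"

text \<open>The square root of the quantum variance before subtraction of the classical mean. It is
  a seminorm in the matrix, so expansions and errors are handled by the triangle inequality.\<close>

definition rms_diag :: "(nat \<Rightarrow> complex Matrix.vec) \<Rightarrow> complex mat \<Rightarrow> real" where
  "rms_diag \<phi> A = L2_set (\<lambda>j. cmod (expect \<phi> A j)) {..<dim_row A} / sqrt (real (dim_row A))"

lemma inner_H_sum:
  assumes "v \<in> carrier_vec n" "w \<in> carrier_vec n"
  shows "inner_H v w = (\<Sum>i<n. cnj (v $ i) * w $ i)"
  using assms by (auto simp: inner_H_def scalar_prod_def lessThan_atLeast0 mult.commute intro!: sum.cong)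

lemma mult_mat_vec_sum:
  assumes "A \<in> carrier_mat n m" "v \<in> carrier_vec m" "i < n"
  shows "(A *\<^sub>v v) $ i = (\<Sum>l<m. A $$ (i, l) * v $ l)"
  using assms by (auto simp: scalar_prod_def lessThan_atLeast0 intro!: sum.cong)

lemma expect_sum:
  assumes "A \<in> carrier_mat n n" "\<phi> j \<in> carrier_vec n"
  shows "expect \<phi> A j = (\<Sum>i<n. \<Sum>l<n. cnj (\<phi> j $ i) * A $$ (i, l) * \<phi> j $ l)"
proof -
  have "A *\<^sub>v \<phi> j \<in> carrier_vec n" using assms by (rule mult_mat_vec_carrier)
  then have "expect \<phi> A j = (\<Sum>i<n. cnj (\<phi> j $ i) * (A *\<^sub>v \<phi> j) $ i)"
    unfolding expect_def by (rule inner_H_sum[OF assms(2)])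
  also have "\<dots> = (\<Sum>i<n. cnj (\<phi> j $ i) * (\<Sum>l<n. A $$ (i, l) * \<phi> j $ l))"
    by (intro sum.cong refl arg_cong2[of _ _ _ _ "(*)"] mult_mat_vec_sum[OF assms]) auto
  finally show ?thesis by (simp add: sum_distrib_left mult.assoc)
qed

lemma expect_add:
  assumes "A \<in> carrier_mat n n" "C \<in> carrier_mat n n" "\<phi> j \<in> carrier_vec n"
  shows "expect \<phi> (A + C) j = expect \<phi> A j + expect \<phi> C j"
  using assms by (simp add: expect_sum[of _ n] sum.distrib distrib_left distrib_right)

lemma expect_smult:
  assumes "A \<in> carrier_mat n n" "\<phi> j \<in> carrier_vec n"
  shows "expect \<phi> (c \<cdot>\<^sub>m A) j = c * expect \<phi> A j"
  using assms by (simp add: expect_sum[of _ n] sum_distrib_left mult_ac)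

lemma inner_H_adj:
  assumes "A \<in> carrier_mat n n" "v \<in> carrier_vec n" "w \<in> carrier_vec n"
  shows "inner_H v (adj A *\<^sub>v w) = inner_H (A *\<^sub>v v) w"
proof -
  have "inner_H v (adj A *\<^sub>v w) = (\<Sum>i<n. cnj (v $ i) * (\<Sum>l<n. adj A $$ (i, l) * w $ l))"
    using assms by (subst inner_H_sum[of _ n])
      (auto simp: mult_mat_vec_sum[of _ n n] intro!: mult_mat_vec_carrier[of _ n n] simp del: index_mult_mat_vec)
  also have "\<dots> = (\<Sum>i<n. \<Sum>l<n. cnj (A $$ (l, i)) * cnj (v $ i) * w $ l)"
    using assms by (auto simp: adj_index sum_distrib_left mult_ac intro!: sum.cong)
  also have "\<dots> = (\<Sum>l<n. \<Sum>i<n. cnj (A $$ (l, i)) * cnj (v $ i) * w $ l)"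
    by (rule sum.swap)
  also have "\<dots> = (\<Sum>l<n. cnj (\<Sum>i<n. A $$ (l, i) * v $ i) * w $ l)"
    by (simp add: sum_distrib_right)
  also have "\<dots> = inner_H (A *\<^sub>v v) w"
    using assms by (subst inner_H_sum[of _ n])
      (auto simp: mult_mat_vec_sum[of _ n n] intro!: mult_mat_vec_carrier[of _ n n] simp del: index_mult_mat_vec)
  finally show ?thesis .
qed

lemma inner_H_smult:
  assumes "v \<in> carrier_vec n" "w \<in> carrier_vec n"
  shows "inner_H (c \<cdot>\<^sub>v v) (d \<cdot>\<^sub>v w) = cnj c * d * inner_H v w"
  using assms by (simp add: inner_H_sum[of _ n] sum_distrib_left mult_ac)

text \<open>The recursion starts from the zero matrix of dimension \<open>n\<close>, since matrices
  of all dimensions share one type.\<close>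

primrec msum :: "nat \<Rightarrow> (nat \<Rightarrow> complex mat) \<Rightarrow> nat \<Rightarrow> complex mat" where
  "msum n A 0 = 0\<^sub>m n n"
| "msum n A (Suc T) = msum n A T + A T"

lemma msum_carrier [simp]: "(\<And>t. A t \<in> carrier_mat n n) \<Longrightarrow> msum n A T \<in> carrier_mat n n"
  by (induction T) auto

lemma ip_msum_right:
  assumes "\<And>t. A t \<in> carrier_mat n n" "C \<in> carrier_mat n n"
  shows "ip C (msum n A T) = (\<Sum>t<T. ip C (A t))"
proof (induction T)
  case 0
  show ?case using assms by (simp add: ip_def)
next
  case (Suc T)
  then show ?case using assms by (simp add: ip_add_right[of _ n])
qed

lemma ip_msum_left:
  assumes "\<And>t. A t \<in> carrier_mat n n" "C \<in> carrier_mat n n"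
  shows "ip (msum n A T) C = (\<Sum>t<T. ip (A t) C)"
proof (induction T)
  case 0
  show ?case using assms by (simp add: ip_def)
next
  case (Suc T)
  then show ?case using assms by (simp add: ip_add_left[of _ n])
qed

text \<open>The squared norm is the sum of the Gram matrix: the diagonal contributes
  \<open>T\<close>, and the remaining entries at most \<open>\<epsilon>\<close> each. After division
  by \<open>T\<close> squared the diagonal leaves \<open>1 / T\<close>.\<close>

lemma hs_msum_almost_orthogonal:
  assumes A: "\<And>t. unitary_mat n (A t)" and n: "n > 0"
    and small: "\<And>s t. s < t \<Longrightarrow> t < T \<Longrightarrow> cmod (ip (A s) (A t)) \<le> \<epsilon>"
    and \<epsilon>: "0 \<le> \<epsilon>"
  shows "(hs (msum n A T))\<^sup>2 \<le> real T + (real T)\<^sup>2 * \<epsilon>"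
proof -
  note [simp] = unitary_mat_carrier[OF A]
  have bound: "cmod (ip (A s) (A t)) \<le> (if s = t then 1 else 0) + \<epsilon>" if "s < T" "t < T" for s t
  proof (cases s t rule: linorder_cases)
    case equal
    then show ?thesis using \<epsilon> hs_unitary[OF n A] by (simp add: ip_self[of _ n])
  next
    case greater
    have "cmod (ip (A s) (A t)) = cmod (ip (A t) (A s))"
      by (subst ip_commute[of _ n]) auto
    then show ?thesis using greater small[of t s] that by simp
  qed (use small that in auto)
  have "of_real ((hs (msum n A T))\<^sup>2) = (\<Sum>s<T. \<Sum>t<T. ip (A s) (A t))"
    by (subst sum.swap) (simp only: ip_self[of _ n, symmetric] msum_carrier ip_msum_left ip_msum_right unitary_mat_carrier[OF A])
  then have "(hs (msum n A T))\<^sup>2 = cmod (\<Sum>s<T. \<Sum>t<T. ip (A s) (A t))"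
    by (metis abs_of_nonneg norm_of_real zero_le_power2)
  also have "\<dots> \<le> (\<Sum>s<T. \<Sum>t<T. (if s = t then 1 else 0) + \<epsilon>)"
    using bound by (intro order_trans[OF norm_sum] sum_mono) auto
  also have "\<dots> = real T + (real T)\<^sup>2 * \<epsilon>"
    by (simp add: sum.distrib sum.delta power2_eq_square algebra_simps)
  finally show ?thesis .
qed

context
  fixes n :: nat and \<phi> :: "nat \<Rightarrow> complex Matrix.vec"
  assumes n: "n > 0" and onb: "orthonormal_basis_H n \<phi>"
begin

lemma phi_carrier [simp]: "j < n \<Longrightarrow> \<phi> j \<in> carrier_vec n"
  using onb by (simp add: orthonormal_basis_H_def)

lemma phi_norm: "j < n \<Longrightarrow> inner_H (\<phi> j) (\<phi> j) = 1"
  using onb by (simp add: orthonormal_basis_H_def)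

text \<open>Written in the orthonormal basis, the operator becomes \<open>cj \<Phi> A\<close> with
  the same norm, and discarding off-diagonal entries only lowers it.\<close>

lemma rms_diag_le_hs:
  assumes A: "A \<in> carrier_mat n n"
  shows "rms_diag \<phi> A \<le> hs A"
proof -
  define \<Phi> where "\<Phi> = Matrix.mat n n (\<lambda>(i, j). \<phi> j $ i)"
  have [simp]: "\<Phi> \<in> carrier_mat n n" "dim_row \<Phi> = n" "dim_col \<Phi> = n" by (simp_all add: \<Phi>_def)
  have \<Phi>_index: "\<Phi> $$ (i, j) = \<phi> j $ i" if "i < n" "j < n" for i j
    using that by (simp add: \<Phi>_def)
  have "adj \<Phi> * \<Phi> = 1\<^sub>m n"
  proof (rule eq_matI)
    fix i j assume "i < dim_row (1\<^sub>m n)" "j < dim_col (1\<^sub>m n)"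
    then have ij: "i < n" "j < n" by auto
    have "(adj \<Phi> * \<Phi>) $$ (i, j) = (\<Sum>k<n. cnj (\<Phi> $$ (k, i)) * \<Phi> $$ (k, j))"
      using ij by (intro adj_mult_index) auto
    also have "\<dots> = inner_H (\<phi> i) (\<phi> j)"
      using ij by (subst inner_H_sum[of _ n]) (auto simp: \<Phi>_def)
    also have "\<dots> = 1\<^sub>m n $$ (i, j)"
      using onb ij by (auto simp: orthonormal_basis_H_def)
    finally show "(adj \<Phi> * \<Phi>) $$ (i, j) = 1\<^sub>m n $$ (i, j)" .
  qed auto
  then have \<Phi>: "unitary_mat n \<Phi>" by (simp add: unitary_mat_def)
  have diag: "cj \<Phi> A $$ (j, j) = expect \<phi> A j" if "j < n" for j
  proof -
    have "cj \<Phi> A = adj \<Phi> * (A * \<Phi>)" using A by (simp add: cj_def assoc_mult_mat[of _ n n _ n _ n])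
    also have "\<dots> $$ (j, j) = (\<Sum>i<n. cnj (\<Phi> $$ (i, j)) * (A * \<Phi>) $$ (i, j))"
      using A that by (intro adj_mult_index) auto
    also have "\<dots> = (\<Sum>i<n. cnj (\<phi> j $ i) * (\<Sum>l<n. A $$ (i, l) * \<phi> j $ l))"
      using A that by (intro sum.cong refl) (auto simp: index_mult_sum[of A n n \<Phi> n] \<Phi>_index simp del: index_mult_mat(1))
    finally show ?thesis using A that by (simp add: expect_sum[of _ n] sum_distrib_left mult.assoc)
  qed
  have "(rms_diag \<phi> A)\<^sup>2 = (\<Sum>j<n. (cmod (expect \<phi> A j))\<^sup>2) / real n"
    using A by (simp add: rms_diag_def power_divide L2_set_def sum_nonneg)
  also have "\<dots> = (\<Sum>j<n. (cmod (cj \<Phi> A $$ (j, j)))\<^sup>2) / real n"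
    by (simp add: diag)
  also have "\<dots> \<le> (\<Sum>i<n. \<Sum>j<n. (cmod (cj \<Phi> A $$ (i, j)))\<^sup>2) / real n"
  proof (intro divide_right_mono sum_mono)
    fix j assume "j \<in> {..<n}"
    then show "(cmod (cj \<Phi> A $$ (j, j)))\<^sup>2 \<le> (\<Sum>l<n. (cmod (cj \<Phi> A $$ (j, l)))\<^sup>2)"
      by (intro member_le_sum) auto
  qed auto
  also have "\<dots> = (hs A)\<^sup>2"
    using hs_power2[of "cj \<Phi> A" n] hs_cj[OF \<Phi> A] A by simp
  finally show ?thesis by (rule power2_le_imp_le) simp
qed

lemma rms_diag_nonneg: "0 \<le> rms_diag \<phi> A"
  by (simp add: rms_diag_def L2_set_nonneg)

lemma rms_diag_add:
  assumes "A \<in> carrier_mat n n" "C \<in> carrier_mat n n"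
  shows "rms_diag \<phi> (A + C) \<le> rms_diag \<phi> A + rms_diag \<phi> C"
proof -
  have "L2_set (\<lambda>j. cmod (expect \<phi> (A + C) j)) {..<n}
      \<le> L2_set (\<lambda>j. cmod (expect \<phi> A j) + cmod (expect \<phi> C j)) {..<n}"
    using assms by (intro L2_set_mono) (auto simp: expect_add[of _ n] intro: norm_triangle_ineq)
  also have "\<dots> \<le> L2_set (\<lambda>j. cmod (expect \<phi> A j)) {..<n} + L2_set (\<lambda>j. cmod (expect \<phi> C j)) {..<n}"
    by (rule L2_set_triangle_ineq)
  finally show ?thesis using assms
    by (simp add: rms_diag_def add_divide_distrib[symmetric] divide_right_mono)
qed

lemma rms_diag_smult:
  assumes "A \<in> carrier_mat n n"
  shows "rms_diag \<phi> (c \<cdot>\<^sub>m A) = cmod c * rms_diag \<phi> A"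
proof -
  have "L2_set (\<lambda>j. cmod (expect \<phi> (c \<cdot>\<^sub>m A) j)) {..<n} = L2_set (\<lambda>j. cmod c * cmod (expect \<phi> A j)) {..<n}"
    using assms by (intro L2_set_cong refl) (auto simp: expect_smult[of _ n] norm_mult)
  then show ?thesis using assms by (simp add: rms_diag_def L2_set_right_distrib)
qed

lemma rms_diag_diff_le:
  assumes "A \<in> carrier_mat n n" "C \<in> carrier_mat n n"
  shows "rms_diag \<phi> A \<le> rms_diag \<phi> C + hs (A - C)"
proof -
  have "A = C + (A - C)" using assms by (intro eq_matI) auto
  then have "rms_diag \<phi> A \<le> rms_diag \<phi> C + rms_diag \<phi> (A - C)" using rms_diag_add[of C "A - C"] assms by simp
  then show ?thesis using rms_diag_le_hs[of "A - C"] assms by simp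
qed

lemma rms_diag_msum_invariant:
  assumes "\<And>t. A t \<in> carrier_mat n n" "\<And>t j. j < n \<Longrightarrow> expect \<phi> (A t) j = expect \<phi> (A 0) j"
  shows "rms_diag \<phi> (msum n A T) = real T * rms_diag \<phi> (A 0)"
proof -
  have ex: "expect \<phi> (msum n A T) j = of_nat T * expect \<phi> (A 0) j" if "j < n" for j
  proof (induction T)
    case 0
    show ?case using that by (simp add: expect_sum[of _ n])
  next
    case (Suc T)
    have "expect \<phi> (msum n A (Suc T)) j = expect \<phi> (msum n A T) j + expect \<phi> (A T) j"
      using assms(1) that by (simp add: expect_add[of _ n])
    then show ?case using Suc assms(2)[OF that, of T] by (simp add: algebra_simps)
  qed
  have [simp]: "dim_row (msum n A T) = n" "dim_row (A 0) = n"
    using carrier_matD(1)[OF msum_carrier, of A n T] carrier_matD(1)[OF assms(1)[of 0]] assms(1) by blast+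
  have "L2_set (\<lambda>j. cmod (expect \<phi> (msum n A T) j)) {..<n} = L2_set (\<lambda>j. real T * cmod (expect \<phi> (A 0) j)) {..<n}"
    by (intro L2_set_cong refl) (auto simp: ex norm_mult)
  then show ?thesis by (simp add: rms_diag_def L2_set_right_distrib)
qed

text \<open>The eigenvalue enters once conjugated and once plain, and unitarity gives it modulus
  \<open>1\<close>.\<close>

lemma expect_cj:
  assumes U: "unitary_mat n U" and A: "A \<in> carrier_mat n n" and j: "j < n"
    and eig: "\<exists>\<mu>. eigenvector U (\<phi> j) \<mu>"
  shows "expect \<phi> (cj U A) j = expect \<phi> A j"
proof -
  obtain \<mu> where \<mu>: "U *\<^sub>v \<phi> j = \<mu> \<cdot>\<^sub>v \<phi> j" using eig by (auto simp: eigenvector_def)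
  note [simp] = unitary_mat_carrier[OF U] A phi_carrier[OF j]
  have "inner_H (\<phi> j) (\<phi> j) = inner_H (\<phi> j) (adj U *\<^sub>v (U *\<^sub>v \<phi> j))"
    by (simp add: assoc_mult_mat_vec[of _ n n _ n, symmetric] unitary_mat_left[OF U])
  also have "\<dots> = inner_H (\<mu> \<cdot>\<^sub>v \<phi> j) (\<mu> \<cdot>\<^sub>v \<phi> j)"
    by (subst inner_H_adj[of _ n]) (auto simp: \<mu>)
  also have "\<dots> = cnj \<mu> * \<mu> * inner_H (\<phi> j) (\<phi> j)" by (rule inner_H_smult[of _ n]) auto
  finally have 1: "cnj \<mu> * \<mu> = 1" using phi_norm[OF j] by simp
  have "expect \<phi> (cj U A) j = inner_H (\<phi> j) (adj U *\<^sub>v (A *\<^sub>v (U *\<^sub>v \<phi> j)))"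
    by (simp add: expect_def cj_def assoc_mult_mat_vec[of _ n n _ n] mult_mat_vec_carrier[of _ n n])
  also have "\<dots> = inner_H (\<mu> \<cdot>\<^sub>v \<phi> j) (A *\<^sub>v (\<mu> \<cdot>\<^sub>v \<phi> j))"
    unfolding \<mu> by (subst inner_H_adj[of _ n]) (auto simp: \<mu> intro!: mult_mat_vec_carrier[of _ n n])
  also have "A *\<^sub>v (\<mu> \<cdot>\<^sub>v \<phi> j) = \<mu> \<cdot>\<^sub>v (A *\<^sub>v \<phi> j)"
    by (rule mult_mat_vec[of _ n n]) auto
  also have "inner_H (\<mu> \<cdot>\<^sub>v \<phi> j) (\<mu> \<cdot>\<^sub>v (A *\<^sub>v \<phi> j)) = expect \<phi> A j"
    by (subst inner_H_smult[of _ n]) (auto simp: 1 expect_def mult_mat_vec_carrier[of _ n n])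
  finally show ?thesis .
qed

lemma expect_cj_pow:
  assumes U: "unitary_mat n U" and A: "A \<in> carrier_mat n n" and j: "j < n"
    and eig: "\<exists>\<mu>. eigenvector U (\<phi> j) \<mu>"
  shows "expect \<phi> ((cj U ^^ k) A) j = expect \<phi> A j"
  using A unitary_mat_carrier[OF U] by (induction k) (simp_all add: expect_cj[OF U _ j eig])

lemma rms_diag_cj_pow:
  assumes U: "unitary_mat n U" and A: "A \<in> carrier_mat n n"
    and eig: "\<forall>j<n. \<exists>\<mu>. eigenvector U (\<phi> j) \<mu>"
  shows "rms_diag \<phi> ((cj U ^^ k) A) = rms_diag \<phi> A"
proof -
  have dims: "dim_row ((cj U ^^ k) A) = n" "dim_row A = n"
    using carrier_matD(1)[OF cj_pow_carrier[OF unitary_mat_carrier[OF U] A]] A by auto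
  have "L2_set (\<lambda>j. cmod (expect \<phi> ((cj U ^^ k) A) j)) {..<n} = L2_set (\<lambda>j. cmod (expect \<phi> A j)) {..<n}"
  proof (rule L2_set_cong[OF refl])
    fix j assume "j \<in> {..<n}"
    then have "expect \<phi> ((cj U ^^ k) A) j = expect \<phi> A j"
      by (intro expect_cj_pow[OF U A]) (simp_all add: eig)
    then show "cmod (expect \<phi> ((cj U ^^ k) A) j) = cmod (expect \<phi> A j)" by simp
  qed
  then show ?thesis unfolding rms_diag_def dims by simp
qed

lemma rms_diag_unitary: "unitary_mat n U \<Longrightarrow> rms_diag \<phi> U \<le> 1"
  using rms_diag_le_hs[of U] hs_unitary[OF n, of U] unitary_mat_carrier[of n U] by simp

end

subsection \<open>Digit expansion of Weyl translations\<close>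

text \<open>The l1 norm of the two coefficients of \<open>rot \<theta>\<close>, equal to
  \<open>|cos (pi * \<theta>)| + |sin (pi * \<theta>)|\<close>.\<close>

definition wt :: "real \<Rightarrow> real" where
  "wt \<theta> = cmod ((1 + ee \<theta>) / 2) + cmod ((1 - ee \<theta>) / 2)"

lemma wt_nonneg: "0 \<le> wt \<theta>" by (simp add: wt_def)

lemma wt_le_two: "wt \<theta> \<le> 2"
  using norm_rot_coeff[of \<theta>] by (simp add: wt_def)

lemma wt_le: "wt \<theta> \<le> 1 + pi * \<bar>\<theta>\<bar>"
proof -
  have "cmod ((1 - ee \<theta>) / 2) \<le> pi * \<bar>\<theta>\<bar>"
    using norm_ee_minus_one_le[of \<theta>] by (simp add: norm_divide norm_minus_commute)
  then show ?thesis using norm_rot_coeff(1)[of \<theta>] unfolding wt_def by linarith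
qed

lemma prod_wt_small:
  "(\<Prod>i=1..m. wt (x / 2 ^ i)) \<le> exp (pi * \<bar>x\<bar>)"
proof -
  have "(\<Prod>i=1..m. wt (x / 2 ^ i)) \<le> (\<Prod>i=1..m. exp (pi * \<bar>x\<bar> * (1 / 2) ^ i))"
  proof (rule prod_mono)
    fix i assume "i \<in> {1..m}"
    have "wt (x / 2 ^ i) \<le> 1 + pi * \<bar>x\<bar> * (1 / 2) ^ i"
      using wt_le[of "x / 2 ^ i"] by (simp add: abs_divide power_divide)
    also have "\<dots> \<le> exp (pi * \<bar>x\<bar> * (1 / 2) ^ i)" by (rule exp_ge_add_one_self)
    finally show "0 \<le> wt (x / 2 ^ i) \<and> wt (x / 2 ^ i) \<le> exp (pi * \<bar>x\<bar> * (1 / 2) ^ i)"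
      using wt_nonneg by simp
  qed
  also have "\<dots> = exp (\<Sum>i=1..m. pi * \<bar>x\<bar> * (1 / 2) ^ i)" by (simp add: exp_sum)
  also have "(\<Sum>i=1..m. pi * \<bar>x\<bar> * (1 / 2) ^ i) = pi * \<bar>x\<bar> * (\<Sum>i=1..m. (1 / 2) ^ i)"
    by (simp add: sum_distrib_left)
  also have "(\<Sum>i=1..m. (1 / 2 :: real) ^ i) = 1 - (1 / 2) ^ m"
    by (induction m) auto
  also have "exp (pi * \<bar>x\<bar> * (1 - (1 / 2) ^ m)) \<le> exp (pi * \<bar>x\<bar>)"
    by (simp add: mult_left_le)
  finally show ?thesis .
qed

text \<open>The bound of \<open>prod_wt_small\<close> is exponential in \<open>x\<close>, too large
  to sum against coefficients that decay faster than any power. Halving \<open>x\<close> until it is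
  at most \<open>1\<close> in modulus costs a factor \<open>2\<close> each time by
  \<open>wt_le_two\<close>, hence only linear growth.\<close>

lemma prod_wt_le: "(\<Prod>i=1..m. wt (x / 2 ^ i)) \<le> exp pi * max 1 (2 * \<bar>x\<bar>)"
proof (induction m arbitrary: x)
  case 0
  have "1 \<le> exp pi" by simp
  then show ?case by (simp add: mult_ge1_I)
next
  case (Suc m)
  show ?case
  proof (cases "\<bar>x\<bar> \<le> 1")
    case True
    have "exp (pi * \<bar>x\<bar>) \<le> exp pi" using True by (simp add: mult_left_le)
    also have "\<dots> \<le> exp pi * max 1 (2 * \<bar>x\<bar>)" by simp
    finally show ?thesis using prod_wt_small[of x "Suc m"] by linarith
  next
    case False
    have "(\<Prod>i=1..Suc m. wt (x / 2 ^ i)) = wt (x / 2) * (\<Prod>i=Suc 1..Suc m. wt (x / 2 ^ i))"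
      by (subst prod.atLeast_Suc_atMost) auto
    also have "(\<Prod>i=Suc 1..Suc m. wt (x / 2 ^ i)) = (\<Prod>i=1..m. wt (x / 2 / 2 ^ i))"
      by (subst prod.atLeast_Suc_atMost_Suc_shift) (simp add: comp_def)
    also have "wt (x / 2) * (\<Prod>i=1..m. wt (x / 2 / 2 ^ i)) \<le> 2 * (exp pi * max 1 (2 * \<bar>x / 2\<bar>))"
      by (intro mult_mono wt_le_two Suc prod_nonneg) (auto simp: wt_nonneg)
    also have "\<dots> = exp pi * max 1 (2 * \<bar>x\<bar>)" using False by (simp add: max_def)
    finally show ?thesis .
  qed
qed

text \<open>For \<open>j < N\<close>, the truncation of \<open>j / N\<close> to its first
  \<open>m\<close> binary digits.\<close>

definition trunc :: "nat \<Rightarrow> nat \<Rightarrow> nat \<Rightarrow> real" where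
  "trunc N m j = real ((2 ^ m * j) div N) / 2 ^ m"

lemma trunc_error:
  assumes "N > 0"
  shows "\<bar>trunc N m j - real j / real N\<bar> \<le> 1 / 2 ^ m"
proof -
  let ?q = "(2 ^ m * j) div N"
  have "?q * N \<le> 2 ^ m * j" "2 ^ m * j < ?q * N + N"
    using assms div_mult_mod_eq[of "2 ^ m * j" N] mod_less_divisor[OF assms, of "2 ^ m * j"]
    by linarith+
  then have "real (?q * N) \<le> real (2 ^ m * j)" "real (2 ^ m * j) < real (?q * N + N)"
    by (simp_all only: of_nat_le_iff of_nat_less_iff)
  then have "real ?q * real N \<le> 2 ^ m * real j" "2 ^ m * real j < real ?q * real N + real N"
    by simp_all
  then have "real ?q \<le> 2 ^ m * (real j / real N)" "2 ^ m * (real j / real N) \<le> real ?q + 1"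
    using assms by (auto simp: field_simps)
  then have "\<bar>real ?q - 2 ^ m * (real j / real N)\<bar> \<le> 1" by linarith
  then have "\<bar>real ?q - 2 ^ m * (real j / real N)\<bar> / 2 ^ m \<le> 1 / 2 ^ m"
    by (rule divide_right_mono) simp
  then have "\<bar>(real ?q - 2 ^ m * (real j / real N)) / 2 ^ m\<bar> \<le> 1 / 2 ^ m"
    by (simp only: abs_divide power_abs abs_numeral)
  then show ?thesis by (simp add: trunc_def diff_divide_distrib)
qed

lemma prod_rademacher_ee:
  assumes "j < N"
  shows "(\<Prod>i=1..m. if rademacher N i j = 1 then 1 else ee (x / 2 ^ i)) = ee (x * trunc N m j)"
proof (induction m)
  case 0
  \<comment> \<open>The hypothesis \<open>j < N\<close> says that there is no integer part.\<close>
  show ?case using assms by (simp add: trunc_def)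
next
  case (Suc m)
  let ?q = "(2 ^ m * j) div N" and ?r = "(2 ^ Suc m * j) div N"
  have "?r div 2 = (2 * (2 ^ m * j)) div (2 * N)"
    by (metis div_mult2_eq mult.assoc mult.commute power_Suc)
  then have "?r div 2 = ?q" by simp
  then have r: "?r = 2 * ?q + ?r mod 2" by (metis mult_div_mod_eq)
  have t: "trunc N (Suc m) j = trunc N m j + (if even ?r then 0 else 1 / 2 ^ Suc m)"
  proof (cases "even ?r")
    case True
    then have "?r = 2 * ?q" using r by (simp add: even_iff_mod_2_eq_zero del: power_Suc)
    then have "real ?r = 2 * real ?q" by (metis of_nat_mult of_nat_numeral)
    then show ?thesis using True unfolding trunc_def by simp
  next
    case False
    then have "?r = 2 * ?q + 1" using r by (simp only: odd_iff_mod_2_eq_one)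
    then have "real ?r = 2 * real ?q + 1" by (metis of_nat_mult of_nat_numeral of_nat_add of_nat_1)
    then show ?thesis using False unfolding trunc_def by (simp add: add_divide_distrib)
  qed
  have rademacher: "rademacher N (Suc m) j = (if even ?r then 1 else - 1)" by (simp add: rademacher_def)
  have "(\<Prod>i=1..Suc m. if rademacher N i j = 1 then 1 else ee (x / 2 ^ i))
      = ee (x * trunc N m j) * (if even ?r then 1 else ee (x / 2 ^ Suc m))"
    using Suc by (simp add: rademacher)
  also have "\<dots> = ee (x * trunc N (Suc m) j)"
    by (simp add: t ee_add[symmetric] distrib_left)
  finally show ?case .
qed

lemma hs_trunc:
  assumes "N > 0"
  shows "hs (dg N (\<lambda>j. ee (x * (real j / real N))) - dg N (\<lambda>j. ee (x * trunc N m j))) \<le> 2 * pi * \<bar>x\<bar> / 2 ^ m"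
proof (rule hs_dg_le[OF _ assms])
  fix j
  let ?y = "x * (trunc N m j - real j / real N)"
  have "ee (x * trunc N m j) = ee (x * (real j / real N)) * ee ?y"
    by (simp add: ee_add[symmetric] right_diff_distrib)
  then have "ee (x * (real j / real N)) - ee (x * trunc N m j) = ee (x * (real j / real N)) * (1 - ee ?y)"
    by (simp add: right_diff_distrib)
  then have "cmod (ee (x * (real j / real N)) - ee (x * trunc N m j)) = cmod (ee ?y - 1)"
    by (simp add: norm_mult norm_minus_commute)
  also have "\<dots> \<le> 2 * pi * \<bar>?y\<bar>" by (rule norm_ee_minus_one_le)
  also have "\<dots> \<le> 2 * pi * (\<bar>x\<bar> * (1 / 2 ^ m))"
    unfolding abs_mult by (intro mult_left_mono trunc_error assms) auto
  finally show "cmod (ee (x * (real j / real N)) - ee (x * trunc N m j)) \<le> 2 * pi * \<bar>x\<bar> / 2 ^ m" by simp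
qed

text \<open>Diagonal factors commute, so any enumeration of the digits is allowed; increasing order
  is used for position and decreasing order for momentum.\<close>

lemma lprod_rot_Qm:
  assumes "set xs = {1..m}" "distinct xs"
  shows "lprod N (map (\<lambda>i. rot (x / 2 ^ i) (Qm N i)) xs) = dg N (\<lambda>j. ee (x * trunc N m j))"
proof -
  have "rot (x / 2 ^ i) (Qm N i) = dg N (\<lambda>j. if rademacher N i j = 1 then 1 else ee (x / 2 ^ i))" for i
  proof -
    have "complex_of_real (rademacher N i j) = 1 \<longleftrightarrow> rademacher N i j = 1"
      "complex_of_real (rademacher N i j) = 1 \<or> complex_of_real (rademacher N i j) = - 1" for j
      using rademacher_cases[of N i j] by auto
    then show ?thesis unfolding Qm_def by (subst rot_dg) auto
  qed
  then have "lprod N (map (\<lambda>i. rot (x / 2 ^ i) (Qm N i)) xs)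
      = dg N (\<lambda>j. \<Prod>i\<leftarrow>xs. if rademacher N i j = 1 then 1 else ee (x / 2 ^ i))"
    by (simp add: lprod_dg)
  also have "\<dots> = dg N (\<lambda>j. ee (x * trunc N m j))"
    using assms by (intro dg_cong) (simp only: prod.distinct_set_conv_list[symmetric] prod_rademacher_ee)
  finally show ?thesis .
qed

text \<open>By orthogonality of roots of unity the factor diagonal in momentum is the cyclic shift
  by \<open>k1\<close>; the position factor supplies the character in \<open>k2\<close>. The
  symmetrising phase has modulus \<open>1\<close>.\<close>

lemma weyl_translation_eq:
  assumes N: "N > 0"
  shows "weyl_translation N (k1, k2) = ee (of_int (k1 * k2) / (2 * real N)) \<cdot>\<^sub>m
    (cj (dft N) (dg N (\<lambda>j. ee (- of_int k1 * (real j / real N)))) * dg N (\<lambda>j. ee (of_int k2 * (real j / real N))))"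
    (is "_ = ?c \<cdot>\<^sub>m (?E * ?D)")
proof (rule eq_matI)
  fix i j assume "i < dim_row (?c \<cdot>\<^sub>m (?E * ?D))" "j < dim_col (?c \<cdot>\<^sub>m (?E * ?D))"
  then have ij: "i < N" "j < N" by (auto simp: cj_def)
  have [simp]: "?E \<in> carrier_mat N N" by simp
  have "?E $$ (i, j) = (\<Sum>l<N. cnj (dft N $$ (l, i)) * (dg N (\<lambda>j. ee (- of_int k1 * (real j / real N))) * dft N) $$ (l, j))"
    using ij by (simp only: cj_def assoc_mult_mat[of _ N N _ N _ N] adj_carrier dft_carrier dg_carrier)
      (intro adj_mult_index, auto)
  also have "\<dots> = (\<Sum>l<N. ee (real l * (of_int (int i - int j - k1) / real N)) / of_nat N)"
  proof (intro sum.cong refl)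
    fix l assume l: "l \<in> {..<N}"
    have sq: "complex_of_real (sqrt (real N)) * complex_of_real (sqrt (real N)) = of_nat N"
      by (simp flip: of_real_mult)
    have "ee (real l * real i / real N) * (ee (- of_int k1 * (real l / real N)) * ee (- (real l * real j / real N)))
        = ee (real l * (of_int (int i - int j - k1) / real N))"
      unfolding ee_add[symmetric]
    proof (rule arg_cong[of _ _ ee])
      show "real l * real i / real N + (- of_int k1 * (real l / real N) + - (real l * real j / real N))
          = real l * (of_int (int i - int j - k1) / real N)"
        using N by (simp add: field_simps)
    qed
    then show "cnj (dft N $$ (l, i)) * (dg N (\<lambda>j. ee (- of_int k1 * (real j / real N))) * dft N) $$ (l, j)
        = ee (real l * (of_int (int i - int j - k1) / real N)) / of_nat N"
      using l ij sq by (simp add: dg_mult_index[OF dft_carrier] dft_index cnj_ee del: index_mult_mat(1))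
  qed
  also have "\<dots> = (if int N dvd int i - int j - k1 then 1 else 0)"
    using N sum_roots_of_unity[OF N, of "int i - int j - k1"]
    by (simp only: sum_divide_distrib[symmetric]) simp
  also have "int N dvd int i - int j - k1 \<longleftrightarrow> int i = (int j + k1) mod int N"
  proof -
    have "int N dvd int i - int j - k1 \<longleftrightarrow> int i mod int N = (int j + k1) mod int N"
      by (simp add: mod_eq_dvd_iff algebra_simps)
    then show ?thesis using ij by simp
  qed
  finally have E: "?E $$ (i, j) = (if int i = (int j + k1) mod int N then 1 else 0)" .
  have "(?E * ?D) $$ (i, j) = ?E $$ (i, j) * ee (of_int k2 * (real j / real N))"
    using ij by (intro mult_dg_index[of _ N]) auto
  moreover have "?c = cis (pi * of_int k1 * of_int k2 / real N)"
    by (simp add: ee_def mult.assoc)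
  moreover have "ee (of_int k2 * (real j / real N)) = cis (2 * pi * of_int k2 * real j / real N)"
    by (simp add: ee_def mult.assoc)
  ultimately show "weyl_translation N (k1, k2) $$ (i, j) = (?c \<cdot>\<^sub>m (?E * ?D)) $$ (i, j)"
    using ij E by (simp add: weyl_translation_def cj_def del: index_mult_mat(1))
qed (auto simp: weyl_translation_def cj_def)

text \<open>
  The square combines the diagonal (\<open>1 / m\<close>) and the off-diagonal terms of the squared norm of an
  average of words over \<open>m\<close> time steps.
\<close>

definition tau :: "nat \<Rightarrow> nat \<Rightarrow> real" where
  "tau M m = sqrt (1 / real m + 32 * real m * 2 ^ (3 * m) * eta M)"

definition rots :: "nat \<Rightarrow> (real \<times> nat) list \<Rightarrow> complex mat" where
  "rots M ps = lprod (2 * M) (map (\<lambda>p. rot (fst p) (Zm M (snd p))) ps)"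

lemma ee_odd_half: "odd k \<Longrightarrow> ee (of_int k / 2) = - 1"
proof -
  assume "odd k"
  then obtain c where "k = 2 * c + 1" by (elim oddE)
  then have "ee (of_int k / 2) = ee (1 / 2)" by (intro ee_eqI[where k = c]) (simp add: field_simps)
  then show ?thesis by (simp add: ee_def)
qed

text \<open>For \<open>k = 2 ^ l * c\<close> with \<open>c\<close> odd, \<open>i = l + 1\<close>
  makes \<open>k / 2 ^ i\<close> a half-integer. The corresponding \<open>rot\<close> has no
  identity component, which removes the empty word from the digit expansion.\<close>

lemma ex_half_integer:
  assumes "k \<noteq> 0" "\<bar>k\<bar> < 2 ^ m"
  shows "\<exists>i\<in>{1..m}. ee (of_int k / 2 ^ i) = - 1"
  using assms
proof (induction m arbitrary: k)
  case (Suc m)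
  show ?case
  proof (cases "even k")
    case True
    then obtain c where c: "k = 2 * c" by (elim evenE)
    then obtain i where "i \<in> {1..m}" "ee (of_int c / 2 ^ i) = - 1"
      using Suc.IH[of c] Suc.prems by (auto simp: abs_mult)
    then show ?thesis using c by (intro bexI[of _ "Suc i"]) auto
  next
    case False
    then show ?thesis using ee_odd_half by (intro bexI[of _ 1]) auto
  qed
qed simp

context
  fixes M :: nat and \<phi> :: "nat \<Rightarrow> complex Matrix.vec"
  assumes M: "M > 0" and onb: "orthonormal_basis_H (2 * M) \<phi>"
    and eig: "\<forall>j<2 * M. \<exists>\<mu>. eigenvector (baker (2 * M)) (\<phi> j) \<mu>"
begin

lemma two_M: "2 * M > 0" using M by simp

lemmas [simp] = word_carrier[OF M] Zm_carrier[OF M]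

text \<open>In an eigenbasis the time average has the same diagonal elements as the word itself. The
  times in \<open>u\<close> are below \<open>2 * m\<close> and averaging adds less than
  \<open>m\<close>, whence the exponent \<open>3 * m\<close>.\<close>

lemma rms_diag_word_le:
  assumes m: "m > 0" and u: "sorted_wrt (<) u" "u \<noteq> []" "\<And>i. i \<in> set u \<Longrightarrow> i < 2 * m"
  shows "rms_diag \<phi> (word M u) \<le> tau M m"
proof -
  define A where "A t = word M (map (\<lambda>i. i + t) u)" for t
  have A_cj: "A t = (cj (baker (2 * M)) ^^ t) (word M u)" for t
    unfolding A_def by (rule cj_pow_word[OF M, symmetric])
  have A0: "A 0 = word M u" by (simp add: A_def)
  \<comment> \<open>The bound of \<open>ip_words_le\<close> for at most \<open>2 * m\<close>
    factors: \<open>2 * (2 * m) * 8 = 32 * m\<close>.\<close>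
  let ?\<epsilon> = "32 * real m * 2 ^ (3 * m) * eta M"
  have "distinct u" using u(1) by (metis strict_sorted_iff)
  moreover have "set u \<subseteq> {..<2 * m}" using u(3) by auto
  ultimately have len: "length u \<le> 2 * m"
    using card_mono[of "{..<2 * m}" "set u"] by (simp add: distinct_card)
  have "(hs (msum (2 * M) A m))\<^sup>2 \<le> real m + (real m)\<^sup>2 * ?\<epsilon>"
  proof (rule hs_msum_almost_orthogonal[OF _ two_M])
    fix s t assume st: "s < t" "t < m"
    have "cmod (ip (A s) (A t)) \<le> 2 * (real (length u) * (8 * 2 ^ (3 * m) * eta M))"
      unfolding A_def using u st by (intro ip_words_le[OF M]) force+
    also have "\<dots> \<le> 2 * (real (2 * m) * (8 * 2 ^ (3 * m) * eta M))"
      using len eta_nonneg[OF M] by (intro mult_left_mono mult_right_mono) auto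
    finally show "cmod (ip (A s) (A t)) \<le> ?\<epsilon>" by (simp add: mult_ac)
  qed (auto simp: A_def unitary_word[OF M] eta_nonneg[OF M])
  moreover have "rms_diag \<phi> (msum (2 * M) A m) = real m * rms_diag \<phi> (A 0)"
  proof (rule rms_diag_msum_invariant[OF two_M onb])
    show "expect \<phi> (A t) j = expect \<phi> (A 0) j" if "j < 2 * M" for t j
      using expect_cj_pow[OF two_M onb unitary_baker[OF M] word_carrier[OF M] that] eig that
      unfolding A0 by (simp only: A_cj)
  qed (simp add: A_def)
  moreover have "rms_diag \<phi> (msum (2 * M) A m) \<le> hs (msum (2 * M) A m)"
    by (rule rms_diag_le_hs[OF two_M onb]) (simp add: A_def)
  ultimately have "(real m * rms_diag \<phi> (word M u))\<^sup>2 \<le> real m + (real m)\<^sup>2 * ?\<epsilon>"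
    using rms_diag_nonneg[OF two_M onb, of "word M u"]
    by (smt (verit) A0 mult_nonneg_nonneg of_nat_0_le_iff power_mono)
  also have "\<dots> = (real m)\<^sup>2 * (1 / real m + ?\<epsilon>)"
    using m by (simp add: power2_eq_square field_simps)
  finally have "(rms_diag \<phi> (word M u))\<^sup>2 \<le> 1 / real m + ?\<epsilon>"
    using m by (simp add: power_mult_distrib)
  then show ?thesis unfolding tau_def by (rule real_le_rsqrt)
qed

lemma rots_carrier [simp]: "rots M ps \<in> carrier_mat (2 * M) (2 * M)"
  unfolding rots_def by (rule lprod_carrier) auto

text \<open>The factors \<open>rot\<close> are expanded one at a time into identity and reflection,
  and \<open>u\<close> collects the reflections chosen so far, still in order of time. Only the
  empty word lacks the bound \<open>tau M m\<close>; its coefficient is the additional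
  product.\<close>

lemma rms_diag_word_rots_le:
  assumes m: "m > 0" and "sorted_wrt (<) (u @ map snd ps)" "\<And>i. i \<in> set u \<union> snd ` set ps \<Longrightarrow> i < 2 * m"
  shows "rms_diag \<phi> (word M u * rots M ps) \<le> tau M m * (\<Prod>p\<leftarrow>ps. wt (fst p))
    + (if u = [] then \<Prod>p\<leftarrow>ps. cmod ((1 + ee (fst p)) / 2) else 0)"
  using assms(2,3)
proof (induction ps arbitrary: u)
  case Nil
  have tau0: "0 \<le> tau M m" using eta_nonneg[OF M] by (simp add: tau_def)
  have one: "word M u * rots M [] = word M u"
    by (simp add: rots_def right_mult_one_mat[of _ "2 * M" "2 * M"])
  show ?case
  proof (cases "u = []")
    case True
    then have "rms_diag \<phi> (word M u) \<le> 1" using rms_diag_unitary[OF two_M onb unitary_word[OF M]] by simp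
    then show ?thesis using True tau0 unfolding one by simp
  next
    case False
    then show ?thesis unfolding one using rms_diag_word_le[OF m _ False] Nil by simp
  qed
next
  case (Cons p ps)
  obtain \<theta> l where p: "p = (\<theta>, l)" by (cases p)
  let ?a = "(1 + ee \<theta>) / 2" and ?b = "(1 - ee \<theta>) / 2"
  let ?W = "word M u" and ?R = "rots M ps" and ?Z = "Zm M l"
  have dim: "dim_row ?Z = 2 * M" using carrier_matD(1)[OF Zm_carrier[OF M]] .
  have snoc: "word M (u @ [l]) = ?W * ?Z"
  proof -
    have "word M (u @ [l]) = lprod (2 * M) (map (Zm M) u) * lprod (2 * M) [?Z]"
      unfolding word_def map_append list.map by (rule lprod_append) auto
    then show ?thesis by (simp add: word_def right_mult_one_mat[of _ "2 * M" "2 * M"])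
  qed
  have "?W * rots M (p # ps) = ?W * (rot \<theta> ?Z * ?R)" by (simp add: rots_def p)
  also have "rot \<theta> ?Z * ?R = ?a \<cdot>\<^sub>m ?R + ?b \<cdot>\<^sub>m (?Z * ?R)"
    unfolding rot_def dim
    by (simp add: add_mult_distrib_mat[of _ "2 * M" "2 * M" _ _ "2 * M"] mult_smult_assoc_mat[of _ "2 * M" "2 * M" _ "2 * M"])
  also have "?W * (?a \<cdot>\<^sub>m ?R + ?b \<cdot>\<^sub>m (?Z * ?R)) = ?a \<cdot>\<^sub>m (?W * ?R) + ?b \<cdot>\<^sub>m (?W * (?Z * ?R))"
    by (simp add: mult_add_distrib_mat[of _ "2 * M" "2 * M" _ "2 * M"] mult_smult_distrib[of _ "2 * M" "2 * M" _ "2 * M"])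
  also have "?W * (?Z * ?R) = word M (u @ [l]) * ?R"
    unfolding snoc by (rule assoc_mult_mat[of _ "2 * M" "2 * M" _ "2 * M" _ "2 * M", symmetric]) auto
  finally have "rms_diag \<phi> (?W * rots M (p # ps))
      \<le> rms_diag \<phi> (?a \<cdot>\<^sub>m (?W * ?R)) + rms_diag \<phi> (?b \<cdot>\<^sub>m (word M (u @ [l]) * ?R))"
    by (simp only:) (rule rms_diag_add[OF two_M onb]; simp)
  also have "\<dots> = cmod ?a * rms_diag \<phi> (?W * ?R) + cmod ?b * rms_diag \<phi> (word M (u @ [l]) * ?R)"
    by (intro arg_cong2[of _ _ _ _ "(+)"] rms_diag_smult[OF two_M onb]) simp_all
  also have "\<dots> \<le> cmod ?a * (tau M m * (\<Prod>p\<leftarrow>ps. wt (fst p))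
      + (if u = [] then \<Prod>p\<leftarrow>ps. cmod ((1 + ee (fst p)) / 2) else 0))
      + cmod ?b * (tau M m * (\<Prod>p\<leftarrow>ps. wt (fst p)))"
  proof (intro add_mono mult_left_mono norm_ge_zero)
    show "rms_diag \<phi> (?W * ?R) \<le> tau M m * (\<Prod>p\<leftarrow>ps. wt (fst p))
      + (if u = [] then \<Prod>p\<leftarrow>ps. cmod ((1 + ee (fst p)) / 2) else 0)"
      by (rule Cons.IH) (use Cons.prems in \<open>auto simp: sorted_wrt_append\<close>)
    \<comment> \<open>Once a reflection has been chosen, the word is nonempty and the additional
      product is absent.\<close>
    have "rms_diag \<phi> (word M (u @ [l]) * ?R) \<le> tau M m * (\<Prod>p\<leftarrow>ps. wt (fst p))
      + (if u @ [l] = [] then \<Prod>p\<leftarrow>ps. cmod ((1 + ee (fst p)) / 2) else 0)"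
      by (rule Cons.IH) (use Cons.prems p in \<open>auto simp: sorted_wrt_append\<close>)
    then show "rms_diag \<phi> (word M (u @ [l]) * ?R) \<le> tau M m * (\<Prod>p\<leftarrow>ps. wt (fst p))" by simp
  qed
  also have "\<dots> = tau M m * (\<Prod>p\<leftarrow>p # ps. wt (fst p))
    + (if u = [] then \<Prod>p\<leftarrow>p # ps. cmod ((1 + ee (fst p)) / 2) else 0)"
    by (simp add: p wt_def algebra_simps)
  finally show ?case .
qed

lemma rms_diag_rots_le:
  assumes "m > 0" "sorted_wrt (<) (map snd ps)" "\<And>i. i \<in> snd ` set ps \<Longrightarrow> i < 2 * m"
    and zero: "\<exists>p\<in>set ps. ee (fst p) = - 1"
  shows "rms_diag \<phi> (rots M ps) \<le> tau M m * (\<Prod>p\<leftarrow>ps. wt (fst p))"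
proof -
  have "word M [] * rots M ps = rots M ps" by (simp add: word_def)
  moreover have zero_prod: "(\<Prod>p\<leftarrow>ps. cmod ((1 + ee (fst p)) / 2)) = 0"
    using zero by (induction ps) auto
  ultimately show ?thesis using rms_diag_word_rots_le[of m "[]" ps] assms(1-3) unfolding zero_prod by simp
qed

end

definition growth :: "int \<Rightarrow> real" where
  "growth k = exp pi * max 1 (2 * \<bar>of_int k\<bar>)"

lemma sum_list_le_length:
  fixes f :: "'a \<Rightarrow> real"
  shows "(\<And>x. x \<in> set xs \<Longrightarrow> f x \<le> c) \<Longrightarrow> (\<Sum>x\<leftarrow>xs. f x) \<le> real (length xs) * c"
  by (induction xs) (auto simp: algebra_simps intro: add_mono)

context
  fixes M :: nat and \<phi> :: "nat \<Rightarrow> complex Matrix.vec"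
  assumes M: "M > 0" and onb: "orthonormal_basis_H (2 * M) \<phi>"
    and eig: "\<forall>j<2 * M. \<exists>\<mu>. eigenvector (baker (2 * M)) (\<phi> j) \<mu>"
begin

text \<open>Momentum digit \<open>i\<close> belongs to time \<open>- i\<close> and arrives at time
  \<open>m - i\<close> after \<open>m\<close> steps.\<close>

lemma momentum_rots_approx:
  assumes "set xs = {1..m}" "length xs = m"
  shows "hs ((cj (baker (2 * M)) ^^ m) (lprod (2 * M) (map (\<lambda>i. rot (x / 2 ^ i) (Pm (2 * M) i)) xs))
      - lprod (2 * M) (map (\<lambda>i. rot (x / 2 ^ i) (Zm M (m - i))) xs)) \<le> real m * (8 * 2 ^ m * eta M)"
proof -
  let ?C = "cj (baker (2 * M))"
  note [simp] = Pm_carrier[OF M] Zm_carrier[OF M] unitary_mat_carrier[OF unitary_baker[OF M]]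
  note uB = unitary_baker[OF M]
  have "(?C ^^ m) (lprod (2 * M) (map (\<lambda>i. rot (x / 2 ^ i) (Pm (2 * M) i)) xs))
      = lprod (2 * M) (map (\<lambda>i. rot (x / 2 ^ i) ((?C ^^ m) (Pm (2 * M) i))) xs)"
    by (subst cj_pow_lprod[OF uB]) (auto simp: comp_def cj_pow_rot[OF uB])
  moreover have "hs (lprod (2 * M) (map (\<lambda>i. rot (x / 2 ^ i) ((?C ^^ m) (Pm (2 * M) i))) xs)
      - lprod (2 * M) (map (\<lambda>i. rot (x / 2 ^ i) (Zm M (m - i))) xs))
      \<le> (\<Sum>i\<leftarrow>xs. hs (rot (x / 2 ^ i) ((?C ^^ m) (Pm (2 * M) i)) - rot (x / 2 ^ i) (Zm M (m - i))))"
    using M by (intro hs_lprod_diff unitary_rot cj_pow_hermitian_involution uB Pm_hermitian_involution[OF M]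
        Zm_hermitian_involution[OF M]) auto
  moreover have "\<dots> \<le> real (length xs) * (8 * 2 ^ m * eta M)"
  proof (rule sum_list_le_length)
    fix i assume "i \<in> set xs"
    then have "1 \<le> i" "i \<le> m" unfolding assms(1) by auto
    then obtain l where l: "i = Suc l" "Suc l \<le> m" by (cases i) auto
    have "(?C ^^ (m - i + i)) (Pm (2 * M) i) = (?C ^^ (m - i)) ((?C ^^ i) (Pm (2 * M) i))"
      by (simp only: funpow_add comp_apply)
    then have split: "(?C ^^ m) (Pm (2 * M) i) = (?C ^^ (m - i)) ((?C ^^ i) (Pm (2 * M) i))"
      using l by simp
    have "hs (rot (x / 2 ^ i) ((?C ^^ m) (Pm (2 * M) i)) - rot (x / 2 ^ i) (Zm M (m - i)))
        \<le> hs ((?C ^^ m) (Pm (2 * M) i) - Zm M (m - i))"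
      by (rule hs_rot_diff[of _ "2 * M"]) auto
    also have "\<dots> = hs ((?C ^^ (m - i)) ((?C ^^ i) (Pm (2 * M) i)) - (?C ^^ (m - i)) (Qm (2 * M) 1))"
      unfolding split by (simp only: Zm_def)
    also have "\<dots> = hs ((?C ^^ i) (Pm (2 * M) i) - Qm (2 * M) 1)"
      by (rule hs_cj_pow_diff[OF uB]) auto
    also have "\<dots> \<le> 8 * 2 ^ l * eta M"
      unfolding l(1) by (rule cj_pow_Pm_approx[OF M])
    also have "\<dots> \<le> 8 * 2 ^ m * eta M"
      using l eta_nonneg[OF M] by (intro mult_right_mono mult_left_mono power_increasing) auto
    finally show "hs (rot (x / 2 ^ i) ((?C ^^ m) (Pm (2 * M) i)) - rot (x / 2 ^ i) (Zm M (m - i)))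
        \<le> 8 * 2 ^ m * eta M" .
  qed
  ultimately show ?thesis using assms(2) by simp
qed

text \<open>Position digits are counted from \<open>1\<close> but times from \<open>0\<close>, so
  digit \<open>i\<close> starts at time \<open>i - 1\<close>.\<close>

lemma position_rots_approx:
  assumes "set xs = {1..m}" "length xs = m"
  shows "hs ((cj (baker (2 * M)) ^^ m) (lprod (2 * M) (map (\<lambda>i. rot (x / 2 ^ i) (Qm (2 * M) i)) xs))
      - lprod (2 * M) (map (\<lambda>i. rot (x / 2 ^ i) (Zm M (m + i - 1))) xs)) \<le> real m * (8 * 2 ^ m * eta M)"
proof -
  let ?C = "cj (baker (2 * M))"
  note [simp] = Zm_carrier[OF M] unitary_mat_carrier[OF unitary_baker[OF M]]
  note uB = unitary_baker[OF M]
  have "(?C ^^ m) (lprod (2 * M) (map (\<lambda>i. rot (x / 2 ^ i) (Qm (2 * M) i)) xs))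
      = lprod (2 * M) (map (\<lambda>i. rot (x / 2 ^ i) ((?C ^^ m) (Qm (2 * M) i))) xs)"
    by (subst cj_pow_lprod[OF uB]) (auto simp: comp_def cj_pow_rot[OF uB])
  moreover have "hs (lprod (2 * M) (map (\<lambda>i. rot (x / 2 ^ i) ((?C ^^ m) (Qm (2 * M) i))) xs)
      - lprod (2 * M) (map (\<lambda>i. rot (x / 2 ^ i) (Zm M (m + i - 1))) xs))
      \<le> (\<Sum>i\<leftarrow>xs. hs (rot (x / 2 ^ i) ((?C ^^ m) (Qm (2 * M) i)) - rot (x / 2 ^ i) (Zm M (m + i - 1))))"
    using M by (intro hs_lprod_diff unitary_rot cj_pow_hermitian_involution uB hermitian_involution_Qm
        Zm_hermitian_involution[OF M]) auto
  moreover have "\<dots> \<le> real (length xs) * (8 * 2 ^ m * eta M)"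
  proof (rule sum_list_le_length)
    fix i assume "i \<in> set xs"
    then have "1 \<le> i" "i \<le> m" unfolding assms(1) by auto
    then obtain l where l: "i = Suc l" "Suc l \<le> m" by (cases i) auto
    have shift: "Zm M (m + i - 1) = (?C ^^ m) (Zm M l)" by (simp add: cj_pow_Zm[OF M] l add.commute)
    have "hs (rot (x / 2 ^ i) ((?C ^^ m) (Qm (2 * M) i)) - rot (x / 2 ^ i) (Zm M (m + i - 1)))
        \<le> hs ((?C ^^ m) (Qm (2 * M) i) - Zm M (m + i - 1))"
      by (rule hs_rot_diff[of _ "2 * M"]) auto
    also have "\<dots> = hs (Qm (2 * M) i - Zm M l)"
      unfolding shift by (rule hs_cj_pow_diff[OF uB]) auto
    also have "\<dots> = hs (Zm M l - Qm (2 * M) (Suc l))"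
      unfolding l by (rule hs_diff_commute[of _ "2 * M"]) auto
    also have "\<dots> \<le> 8 * 2 ^ l * eta M" by (rule Zm_approx[OF M])
    also have "\<dots> \<le> 8 * 2 ^ m * eta M"
      using l eta_nonneg[OF M] by (intro mult_right_mono mult_left_mono power_increasing) auto
    finally show "hs (rot (x / 2 ^ i) ((?C ^^ m) (Qm (2 * M) i)) - rot (x / 2 ^ i) (Zm M (m + i - 1)))
        \<le> 8 * 2 ^ m * eta M" .
  qed
  ultimately show ?thesis using assms(2) by simp
qed

lemma prod_list_wt_le:
  assumes "set xs = {1..m}" "distinct xs" "\<bar>x\<bar> = \<bar>of_int k\<bar>"
  shows "(\<Prod>i\<leftarrow>xs. wt (x / 2 ^ i)) \<le> growth k"
  using prod_wt_le[of x m] assms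
  by (simp only: prod.distinct_set_conv_list[symmetric] growth_def)

text \<open>The three terms come from the expansion into nonempty words, from dropping all digits
  beyond \<open>m\<close>, and from replacing the digits evolved by \<open>m\<close> steps with
  \<open>Zm\<close>.\<close>

lemma rms_diag_weyl_translation_le:
  assumes m: "m > 0" and k: "(k1, k2) \<noteq> (0, 0)" "\<bar>k1\<bar> < 2 ^ m" "\<bar>k2\<bar> < 2 ^ m"
  shows "rms_diag \<phi> (weyl_translation (2 * M) (k1, k2)) \<le> tau M m * (growth k1 * growth k2)
    + 2 * pi * (\<bar>of_int k1\<bar> + \<bar>of_int k2\<bar>) / 2 ^ m + 16 * real m * 2 ^ m * eta M"
proof -
  let ?N = "2 * M" and ?C = "cj (baker (2 * M))"
  have N: "?N > 0" using M by simp
  note uB = unitary_baker[OF M]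
  note uF = unitary_dft[OF N]
  note [simp] = Pm_carrier[OF M] Zm_carrier[OF M] unitary_mat_carrier[OF uB]
  define x1 where "x1 = - real_of_int k1"
  define x2 where "x2 = real_of_int k2"
  define xs where "xs = [1..<Suc m]"
  have xs: "set xs = {1..m}" "length xs = m" "distinct xs"
    and rxs: "set (rev xs) = {1..m}" "length (rev xs) = m" "distinct (rev xs)"
    by (auto simp: xs_def)
  define E where "E = cj (dft ?N) (dg ?N (\<lambda>j. ee (x1 * (real j / real ?N))))"
  define D where "D = dg ?N (\<lambda>j. ee (x2 * (real j / real ?N)))"
  define E' where "E' = lprod ?N (map (\<lambda>i. rot (x1 / 2 ^ i) (Pm ?N i)) (rev xs))"
  define D' where "D' = lprod ?N (map (\<lambda>i. rot (x2 / 2 ^ i) (Qm ?N i)) xs)"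
  define R1 where "R1 = lprod ?N (map (\<lambda>i. rot (x1 / 2 ^ i) (Zm M (m - i))) (rev xs))"
  define R2 where "R2 = lprod ?N (map (\<lambda>i. rot (x2 / 2 ^ i) (Zm M (m + i - 1))) xs)"
  \<comment> \<open>The reversed momentum digits have times \<open>0\<close> to
    \<open>m - 1\<close>, the position digits \<open>m\<close> to \<open>2 * m - 1\<close>; the list
    is therefore strictly increasing in time.\<close>
  define ps where "ps = map (\<lambda>i. (x1 / 2 ^ i, m - i)) (rev xs) @ map (\<lambda>i. (x2 / 2 ^ i, m + i - 1)) xs"
  have uE: "unitary_mat ?N E"
    unfolding E_def cj_def by (intro unitary_mat_mult unitary_mat_adj uF unitary_dg) auto
  have uD: "unitary_mat ?N D"
    unfolding D_def by (intro unitary_dg) auto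
  have uE': "unitary_mat ?N E'"
    unfolding E'_def by (rule unitary_lprod) (auto intro: unitary_rot Pm_hermitian_involution[OF M])
  have uD': "unitary_mat ?N D'"
    unfolding D'_def by (rule unitary_lprod) (auto intro: unitary_rot hermitian_involution_Qm)
  have uR1: "unitary_mat ?N R1"
    unfolding R1_def by (rule unitary_lprod) (auto intro: unitary_rot Zm_hermitian_involution[OF M])
  have uR2: "unitary_mat ?N R2"
    unfolding R2_def by (rule unitary_lprod) (auto intro: unitary_rot Zm_hermitian_involution[OF M])
  note carriers [simp] = uE[THEN unitary_mat_carrier] uD[THEN unitary_mat_carrier] uE'[THEN unitary_mat_carrier]
    uD'[THEN unitary_mat_carrier] uR1[THEN unitary_mat_carrier] uR2[THEN unitary_mat_carrier]
  have hD: "hs (D - D') \<le> 2 * pi * \<bar>x2\<bar> / 2 ^ m"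
    unfolding D_def D'_def lprod_rot_Qm[OF xs(1,3)] by (rule hs_trunc[OF N])
  have hE: "hs (E - E') \<le> 2 * pi * \<bar>x1\<bar> / 2 ^ m"
  proof -
    have "E' = cj (dft ?N) (lprod ?N (map (\<lambda>i. rot (x1 / 2 ^ i) (Qm ?N i)) (rev xs)))"
      unfolding E'_def Pm_def by (subst cj_lprod[OF uF]) (auto simp: comp_def cj_rot[OF uF Qm_carrier])
    then have "E - E' = cj (dft ?N) (dg ?N (\<lambda>j. ee (x1 * (real j / real ?N)))
        - dg ?N (\<lambda>j. ee (x1 * trunc ?N m j)))"
      unfolding E_def lprod_rot_Qm[OF rxs(1,3)] by (simp add: cj_diff[of _ ?N])
    then show ?thesis using hs_trunc[OF N, of x1 m] by (simp only: hs_cj[OF uF] minus_carrier_square dg_carrier)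
  qed
  have R: "rots M ps = R1 * R2"
    unfolding rots_def ps_def R1_def R2_def map_append
    by (subst lprod_append) (auto simp: comp_def)
  have "rms_diag \<phi> (weyl_translation ?N (k1, k2)) = rms_diag \<phi> (E * D)"
    unfolding weyl_translation_eq[OF N]
    by (subst rms_diag_smult[OF N onb]) (simp_all add: E_def D_def x1_def x2_def)
  \<comment> \<open>Evolution leaves the diagonal elements in an eigenbasis unchanged, so all digits
    can be moved to non-negative times.\<close>
  also have "\<dots> = rms_diag \<phi> ((?C ^^ m) (E * D))"
    by (rule rms_diag_cj_pow[OF N onb uB _ eig, symmetric]) simp
  also have "\<dots> \<le> rms_diag \<phi> (R1 * R2) + hs ((?C ^^ m) (E * D) - R1 * R2)"
    by (rule rms_diag_diff_le[OF N onb]) simp_all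
  also have "hs ((?C ^^ m) (E * D) - R1 * R2)
      \<le> hs ((?C ^^ m) (E * D) - (?C ^^ m) (E' * D')) + hs ((?C ^^ m) (E' * D') - R1 * R2)"
    by (rule hs_triangle[of _ ?N]) simp_all
  also have "hs ((?C ^^ m) (E * D) - (?C ^^ m) (E' * D')) = hs (E * D - E' * D')"
    by (rule hs_cj_pow_diff[OF uB]) simp_all
  also have "\<dots> \<le> hs (E - E') + hs (D - D')"
    by (rule hs_mult_diff[OF uE uE' uD uD'])
  also have "hs ((?C ^^ m) (E' * D') - R1 * R2) \<le> hs ((?C ^^ m) E' - R1) + hs ((?C ^^ m) D' - R2)"
    unfolding cj_pow_mult[OF uB carriers(3,4)]
    by (rule hs_mult_diff[OF cj_pow_unitary[OF uB uE'] uR1 cj_pow_unitary[OF uB uD'] uR2])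
  also have "hs ((?C ^^ m) E' - R1) \<le> real m * (8 * 2 ^ m * eta M)"
    unfolding E'_def R1_def by (rule momentum_rots_approx[OF rxs(1,2)])
  also have "hs ((?C ^^ m) D' - R2) \<le> real m * (8 * 2 ^ m * eta M)"
    unfolding D'_def R2_def by (rule position_rots_approx[OF xs(1,2)])
  finally have main: "rms_diag \<phi> (weyl_translation ?N (k1, k2)) \<le> rms_diag \<phi> (rots M ps)
      + (2 * pi * \<bar>x1\<bar> / 2 ^ m + 2 * pi * \<bar>x2\<bar> / 2 ^ m + 16 * real m * 2 ^ m * eta M)"
    unfolding R using hE hD by (simp add: algebra_simps)
  have "rms_diag \<phi> (rots M ps) \<le> tau M m * (\<Prod>p\<leftarrow>ps. wt (fst p))"
  proof (rule rms_diag_rots_le[OF M onb eig m])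
    show "sorted_wrt (<) (map snd ps)"
      by (auto simp: ps_def xs_def comp_def sorted_wrt_append sorted_wrt_map rev_map[symmetric] sorted_wrt_rev sorted_wrt_upt
          simp del: upt_Suc intro: sorted_wrt_mono_rel[OF _ sorted_wrt_upt])
    show "i < 2 * m" if "i \<in> snd ` set ps" for i
      using that m xs by (auto simp: ps_def)
    show "\<exists>p\<in>set ps. ee (fst p) = - 1"
    proof (cases "k1 = 0")
      case True
      then have "k2 \<noteq> 0" using k by simp
      then obtain i where "i \<in> {1..m}" "ee (x2 / 2 ^ i) = - 1"
        using ex_half_integer[of k2 m] k by (auto simp: x2_def)
      then show ?thesis using xs(1) by (force simp: ps_def)
    next
      case False
      then obtain i where "i \<in> {1..m}" "ee (x1 / 2 ^ i) = - 1"
        using ex_half_integer[of "- k1" m] k by (auto simp: x1_def)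
      then show ?thesis using xs(1) by (force simp: ps_def)
    qed
  qed
  also have "(\<Prod>p\<leftarrow>ps. wt (fst p)) = (\<Prod>i\<leftarrow>rev xs. wt (x1 / 2 ^ i)) * (\<Prod>i\<leftarrow>xs. wt (x2 / 2 ^ i))"
    by (simp only: ps_def map_append prod_list.append list.map_comp comp_def fst_conv)
  also have "tau M m * \<dots> \<le> tau M m * (growth k1 * growth k2)"
  proof (intro mult_left_mono mult_mono)
    show "(\<Prod>i\<leftarrow>rev xs. wt (x1 / 2 ^ i)) \<le> growth k1"
      by (rule prod_list_wt_le[OF rxs(1,3)]) (simp add: x1_def)
    show "(\<Prod>i\<leftarrow>xs. wt (x2 / 2 ^ i)) \<le> growth k2"
      by (rule prod_list_wt_le[OF xs(1,3)]) (simp add: x2_def)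
    show "0 \<le> (\<Prod>i\<leftarrow>xs. wt (x2 / 2 ^ i))"
      by (rule prod_list_nonneg) (auto simp: wt_nonneg)
  qed (auto simp: growth_def tau_def eta_nonneg[OF M])
  finally show ?thesis using main by (simp add: x1_def x2_def add_divide_distrib distrib_left)
qed

end

subsection \<open>The logarithmic bound for Weyl translations\<close>

definition weight :: "int \<times> int \<Rightarrow> real" where
  "weight k = (1 + \<bar>of_int (fst k)\<bar>) * (1 + \<bar>of_int (snd k)\<bar>)"

text \<open>The first term is the factor \<open>6\<close> from the bound on \<open>tau\<close> times
  \<open>4 * exp pi * exp pi\<close> from \<open>growth_le\<close>. The second is
  \<open>8 + 16\<close>, from truncation and from evolution.\<close>

definition weyl_const :: real where
  "weyl_const = 24 * exp pi * exp pi + 24"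

lemma weight_ge: "1 \<le> weight k" "\<bar>of_int (fst k)\<bar> \<le> weight k" "\<bar>of_int (snd k)\<bar> \<le> weight k"
  "\<bar>of_int (fst k)\<bar> + \<bar>of_int (snd k)\<bar> \<le> weight k"
proof -
  let ?a = "\<bar>real_of_int (fst k)\<bar>" and ?b = "\<bar>real_of_int (snd k)\<bar>"
  have "weight k = 1 + ?a + ?b + ?a * ?b" by (simp add: weight_def algebra_simps)
  moreover have "0 \<le> ?a * ?b" "0 \<le> ?a" "0 \<le> ?b" by auto
  ultimately show "1 \<le> weight k" "?a \<le> weight k" "?b \<le> weight k" "?a + ?b \<le> weight k" by linarith+
qed

lemma growth_le: "growth k1 * growth k2 \<le> 4 * exp pi * exp pi * weight (k1, k2)"
proof -
  have g: "growth k \<le> 2 * exp pi * (1 + \<bar>of_int k\<bar>)" for k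
  proof -
    have "max 1 (2 * \<bar>real_of_int k\<bar>) \<le> 2 * (1 + \<bar>of_int k\<bar>)" by auto
    then have "exp pi * max 1 (2 * \<bar>real_of_int k\<bar>) \<le> exp pi * (2 * (1 + \<bar>of_int k\<bar>))"
      by (rule mult_left_mono) simp
    then show ?thesis by (simp add: growth_def mult_ac)
  qed
  have "growth k1 * growth k2 \<le> (2 * exp pi * (1 + \<bar>of_int k1\<bar>)) * (2 * exp pi * (1 + \<bar>of_int k2\<bar>))"
    by (intro mult_mono g) (auto simp: growth_def)
  also have "\<dots> = 4 * exp pi * exp pi * weight (k1, k2)"
    by (simp add: weight_def algebra_simps)
  finally show ?thesis .
qed

lemma inverse_power_two_le: "m > 0 \<Longrightarrow> 1 / 2 ^ m \<le> 1 / sqrt (real m)"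
proof -
  assume m: "m > 0"
  have "real m < 2 ^ m" by (rule of_nat_less_two_power)
  moreover have "sqrt (real m) \<le> real m"
    using m by (intro real_le_lsqrt) (auto simp: power2_eq_square)
  ultimately have "sqrt (real m) \<le> 2 ^ m" by linarith
  then show ?thesis using m by (intro divide_left_mono) auto
qed

text \<open>
  With \<open>N = 2 * M\<close> and \<open>eta M = N powr (- 1 / 4)\<close>, the exponent \<open>24\<close> makes the error \<open>2 ^ (3 * m) * eta M\<close> at
  most \<open>2 ^ (- 3 * m)\<close>.
\<close>

lemma rms_diag_weyl_translation_sqrt_le:
  assumes M: "M > 0" and onb: "orthonormal_basis_H (2 * M) \<phi>"
    and eig: "\<forall>j<2 * M. \<exists>\<mu>. eigenvector (baker (2 * M)) (\<phi> j) \<mu>"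
    and m: "m > 0" and N: "2 ^ (24 * m) \<le> 2 * M" and k: "k \<noteq> (0, 0)"
    and unit: "rms_diag \<phi> (weyl_translation (2 * M) k) \<le> 1"
  shows "rms_diag \<phi> (weyl_translation (2 * M) k) \<le> weyl_const * weight k / sqrt (real m)"
proof -
  obtain k1 k2 where k12: "k = (k1, k2)" by (cases k)
  let ?s = "1 / sqrt (real m)" and ?h = "1 / (2::real) ^ m"
  have s: "0 < ?s" using m by simp
  have h: "0 < ?h" "?h \<le> ?s" "?h \<le> 1" using inverse_power_two_le[OF m] by auto
  have c: "24 \<le> weyl_const" by (simp add: weyl_const_def)
  show ?thesis
  proof (cases "\<bar>k1\<bar> < 2 ^ m \<and> \<bar>k2\<bar> < 2 ^ m")
    case False
    \<comment> \<open>Frequencies outside the digit range have weight at least \<open>2 ^ m\<close>,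
      so the trivial bound \<open>1\<close> is good enough.\<close>
    then have "2 ^ m \<le> \<bar>k1\<bar> \<or> 2 ^ m \<le> \<bar>k2\<bar>" by auto
    then have "(2::real) ^ m \<le> \<bar>of_int k1\<bar> \<or> (2::real) ^ m \<le> \<bar>of_int k2\<bar>"
      by (metis of_int_abs of_int_le_iff of_int_numeral of_int_power)
    then have "2 ^ m \<le> weight k" using weight_ge[of k] k12 by auto
    then have "1 \<le> weight k * ?h" by (simp add: field_simps)
    also have "\<dots> \<le> weight k * ?s" using h weight_ge(1)[of k] by (intro mult_left_mono) auto
    also have "\<dots> \<le> weyl_const * (weight k * ?s)"
      using c s weight_ge(1)[of k] mult_right_mono[of 1 weyl_const "weight k * ?s"] by simp
    finally show ?thesis using unit by simp
  next
    case True
    have eta: "eta M \<le> ?h ^ 6"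
    proof -
      have "real (2 ^ (24 * m)) \<le> real (2 * M)" using N of_nat_le_iff by blast
      then have "((2::real) ^ m) ^ 24 \<le> real (2 * M)"
        by (simp add: power_mult[symmetric] mult.commute)
      moreover have "((2::real) ^ m) ^ 24 = ((((2::real) ^ m) ^ 6)\<^sup>2)\<^sup>2" by (simp flip: power_mult)
      ultimately have "((2::real) ^ m) ^ 6 \<le> sqrt (sqrt (real (2 * M)))"
        by (intro real_le_rsqrt) (simp only:)
      then have "1 / sqrt (sqrt (real (2 * M))) \<le> 1 / ((2::real) ^ m) ^ 6"
        using M by (intro divide_left_mono mult_pos_pos) auto
      then show ?thesis by (simp add: eta_def power_divide)
    qed
    have p3: "(2::real) ^ (3 * m) = (1 / ?h) ^ 3" by (simp add: power_mult[symmetric] mult.commute)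
    have mh: "real m \<le> 1 / ?h" using of_nat_less_two_power[of m] by (simp add: less_imp_le)
    have sq: "?s\<^sup>2 = 1 / real m" using m by (simp add: power_divide)
    have e0: "0 \<le> eta M" by (rule eta_nonneg[OF M])
    have "32 * real m * 2 ^ (3 * m) * eta M \<le> 32 * (1 / ?h) * (1 / ?h) ^ 3 * ?h ^ 6"
      unfolding p3 using mh eta h e0 by (intro mult_mono) auto
    also have "\<dots> = 32 * ?h\<^sup>2" using h by (simp add: field_simps power2_eq_square eval_nat_numeral)
    also have "\<dots> \<le> 32 * ?s\<^sup>2" using h by (intro mult_left_mono power_mono) auto
    \<comment> \<open>\<open>1 + 32\<close> is rounded up to the square \<open>36\<close>.\<close>
    finally have "tau M m \<le> sqrt (36 * ?s\<^sup>2)"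
      unfolding tau_def using sq zero_le_power2[of ?s] by (intro real_sqrt_le_mono) linarith
    also have "\<dots> = 6 * ?s" using s by (simp add: real_sqrt_mult real_sqrt_divide)
    finally have tau: "tau M m \<le> 6 * ?s" .
    have "16 * real m * 2 ^ m * eta M \<le> 16 * (1 / ?h) * (1 / ?h) * ?h ^ 6"
      using mh eta h e0 by (intro mult_mono) auto
    also have "\<dots> = 16 * ?h * ?h ^ 3" using h by (simp add: field_simps eval_nat_numeral)
    also have "\<dots> \<le> 16 * ?s * 1"
      using h by (intro mult_mono power_le_one) auto
    also have "\<dots> \<le> 16 * weight k * ?s" using s weight_ge(1)[of k]
      unfolding mult_1_right by (intro mult_right_mono) auto
    finally have t3: "16 * real m * 2 ^ m * eta M \<le> 16 * weight k * ?s" .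
    have "2 * pi * (\<bar>of_int k1\<bar> + \<bar>of_int k2\<bar>) / 2 ^ m = 2 * pi * (\<bar>of_int k1\<bar> + \<bar>of_int k2\<bar>) * ?h"
      by simp
    also have "\<dots> \<le> 8 * weight k * ?s"
      using pi_less_4 weight_ge[of k] k12 h by (intro mult_mono) auto
    finally have t2: "2 * pi * (\<bar>of_int k1\<bar> + \<bar>of_int k2\<bar>) / 2 ^ m \<le> 8 * weight k * ?s" .
    have "tau M m * (growth k1 * growth k2) \<le> 6 * ?s * (4 * exp pi * exp pi * weight k)"
      unfolding k12 by (intro mult_mono tau growth_le) (use s in \<open>auto simp: growth_def\<close>)
    then have t1: "tau M m * (growth k1 * growth k2) \<le> 24 * exp pi * exp pi * weight k * ?s"
      by (simp add: mult_ac)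
    have "rms_diag \<phi> (weyl_translation (2 * M) k)
        \<le> 24 * exp pi * exp pi * weight k * ?s + 8 * weight k * ?s + 16 * weight k * ?s"
      using rms_diag_weyl_translation_le[OF M onb eig m, of k1 k2] k True t1 t2 t3 by (simp add: k12)
    also have "\<dots> = weyl_const * weight k * ?s" by (simp add: weyl_const_def algebra_simps)
    finally show ?thesis by simp
  qed
qed

lemma unitary_weyl_translation:
  assumes N: "N > 0"
  shows "unitary_mat N (weyl_translation N k)"
proof -
  obtain k1 k2 where "k = (k1, k2)" by (cases k)
  then show ?thesis
    by (auto simp: weyl_translation_eq[OF N] cj_def
        intro!: unitary_mat_smult unitary_mat_mult unitary_mat_adj unitary_dft N unitary_dg)
qed

theorem rms_diag_weyl_translation_ln_le:
  assumes N: "even N" "N \<ge> 2" and onb: "orthonormal_basis_H N \<phi>"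
    and eig: "\<forall>j<N. \<exists>\<mu>. eigenvector (baker N) (\<phi> j) \<mu>" and k: "k \<noteq> (0, 0)"
  shows "(rms_diag \<phi> (weyl_translation N k))\<^sup>2 \<le> 48 * weyl_const\<^sup>2 * (weight k)\<^sup>2 / ln (real N)"
proof -
  obtain M where NM: "N = 2 * M" using N by (elim evenE)
  have M: "M > 0" and N0: "N > 0" using N NM by auto
  have unit: "rms_diag \<phi> (weyl_translation N k) \<le> 1"
    by (rule rms_diag_unitary[OF N0 onb unitary_weyl_translation[OF N0]])
  have s0: "0 \<le> rms_diag \<phi> (weyl_translation N k)" by (rule rms_diag_nonneg[OF N0 onb])
  have ln0: "0 < ln (real N)" using N by simp
  \<comment> \<open>\<open>m\<close> is the integer part of the logarithm of \<open>N\<close> to the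
    base \<open>2 ^ 24\<close>.\<close>
  obtain m where m: "(2 ^ 24) ^ m \<le> N" "N < (2 ^ 24) ^ (m + 1)"
    using ex_power_ivl1[of "2 ^ 24" N] N by auto
  have "real N < 2 ^ (24 * (m + 1))"
  proof -
    have "real N < real ((2 ^ 24) ^ (m + 1))" using m(2) of_nat_less_iff by blast
    then show ?thesis by (simp only: power_mult of_nat_power of_nat_numeral)
  qed
  then have "ln (real N) < ln (2 ^ (24 * (m + 1)))" using N by (intro ln_less_cancel_iff[THEN iffD2]) simp_all
  also have "\<dots> = real (24 * (m + 1)) * ln 2" by (rule ln_realpow)
  also have "\<dots> \<le> real (24 * (m + 1)) * 1" using ln_2_less_1 by (intro mult_left_mono) auto
  finally have ln: "ln (real N) \<le> 24 * (real m + 1)" by simp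
  have cw: "1 \<le> weyl_const\<^sup>2 * (weight k)\<^sup>2"
  proof -
    have "1 \<le> weyl_const" by (simp add: weyl_const_def add_increasing)
    then have "1 \<le> weyl_const * weight k"
      using weight_ge(1)[of k] mult_mono[of 1 weyl_const 1 "weight k"] by simp
    then show ?thesis by (simp add: power_mult_distrib[symmetric] one_le_power)
  qed
  show ?thesis
  proof (cases "m = 0")
    case True
    \<comment> \<open>Here \<open>N\<close> is below \<open>2 ^ 24\<close> and there is no time to
      average over; the trivial bound is compared with \<open>48 / ln N\<close>, which is at least
      \<open>1\<close>.\<close>
    have "(rms_diag \<phi> (weyl_translation N k))\<^sup>2 \<le> 1" using unit s0 by (rule power_le_one[rotated])
    also have "1 \<le> 48 / ln (real N)" using ln ln0 True by simp
    also have "\<dots> \<le> 48 * (weyl_const\<^sup>2 * (weight k)\<^sup>2) / ln (real N)"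
      using cw ln0 by (intro divide_right_mono) auto
    finally show ?thesis by (simp add: mult.assoc)
  next
    case False
    then have m0: "m > 0" by simp
    have "rms_diag \<phi> (weyl_translation N k) \<le> weyl_const * weight k / sqrt (real m)"
      unfolding NM by (rule rms_diag_weyl_translation_sqrt_le[OF M _ _ m0 _ k])
        (use onb eig m unit in \<open>simp_all add: NM power_mult\<close>)
    then have "(rms_diag \<phi> (weyl_translation N k))\<^sup>2 \<le> (weyl_const * weight k / sqrt (real m))\<^sup>2"
      using s0 by (rule power_mono)
    also have "\<dots> = weyl_const\<^sup>2 * (weight k)\<^sup>2 * (1 / real m)"
      by (simp add: power_divide power_mult_distrib)
    also have "\<dots> \<le> weyl_const\<^sup>2 * (weight k)\<^sup>2 * (48 / ln (real N))"
    proof (rule mult_left_mono)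
      \<comment> \<open>\<open>m + 1\<close> is at most \<open>2 * m\<close>, which turns
        \<open>24\<close> into \<open>48\<close>.\<close>
      have "1 \<le> real m" using m0 by simp
      moreover have "24 * (real m + 1) = 24 * real m + 24" by simp
      ultimately have "ln (real N) \<le> 48 * real m" using ln by linarith
      then show "1 / real m \<le> 48 / ln (real N)" using m0 ln0 by (simp add: field_simps)
    qed simp
    finally show ?thesis by (simp add: mult_ac)
  qed
qed

subsection \<open>Decay of Fourier coefficients\<close>

text \<open>Each order \<open>k\<close> supplies its own partial derivatives; uniqueness of
  derivatives makes them agree, so one pair serves all orders.\<close>

lemma C_k_derivative:
  assumes "\<forall>k. C_k k f"
  obtains g h where
    "\<forall>q p. ((\<lambda>t. f (t, p)) has_vector_derivative g (q, p)) (at q)"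
    "\<forall>q p. ((\<lambda>t. f (q, t)) has_vector_derivative h (q, p)) (at p)"
    "\<forall>k. C_k k g" "\<forall>k. C_k k h"
proof -
  have "C_k (Suc 0) f" using assms by blast
  then obtain g h where gh:
    "\<forall>q p. ((\<lambda>t. f (t, p)) has_vector_derivative g (q, p)) (at q)"
    "\<forall>q p. ((\<lambda>t. f (q, t)) has_vector_derivative h (q, p)) (at p)"
    unfolding C_k.simps by blast
  have "C_k k g \<and> C_k k h" for k
  proof -
    have "C_k (Suc k) f" using assms by blast
    then obtain g' h' where gh':
      "\<forall>q p. ((\<lambda>t. f (t, p)) has_vector_derivative g' (q, p)) (at q)"
      "\<forall>q p. ((\<lambda>t. f (q, t)) has_vector_derivative h' (q, p)) (at p)"
      "C_k k g'" "C_k k h'"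
      unfolding C_k.simps by blast
    have "g' (q, p) = g (q, p)" for q p
      by (rule vector_derivative_unique_at[OF gh'(1)[rule_format] gh(1)[rule_format]])
    moreover have "h' (q, p) = h (q, p)" for q p
      by (rule vector_derivative_unique_at[OF gh'(2)[rule_format] gh(2)[rule_format]])
    ultimately have "g' = g" "h' = h" by (auto simp: fun_eq_iff)
    then show ?thesis using gh' by simp
  qed
  then show thesis using that gh by blast
qed

lemma derivative_periodic:
  fixes F G :: "real \<Rightarrow> complex"
  assumes per: "\<And>t. F (t + 1) = F t" and der: "\<And>t. (F has_vector_derivative G t) (at t)"
  shows "G (t + 1) = G t"
proof -
  have "((F \<circ> (\<lambda>t. t + 1)) has_vector_derivative (1 *\<^sub>R G (t + 1))) (at t)"
    by (rule vector_diff_chain_at) (auto intro!: derivative_eq_intros der)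
  moreover have "F \<circ> (\<lambda>t. t + 1) = F" using per by (auto simp: fun_eq_iff)
  ultimately have "(F has_vector_derivative G (t + 1)) (at t)" by simp
  then show ?thesis by (rule vector_derivative_unique_at[OF _ der])
qed

lemma smooth_torus_derivative:
  assumes "smooth_torus f"
  obtains g h where "smooth_torus g" "smooth_torus h"
    "\<And>q p. ((\<lambda>t. f (t, p)) has_vector_derivative g (q, p)) (at q)"
    "\<And>q p. ((\<lambda>t. f (q, t)) has_vector_derivative h (q, p)) (at p)"
proof -
  have per: "f (q + 1, p) = f (q, p)" "f (q, p + 1) = f (q, p)" for q p
    using assms by (auto simp: smooth_torus_def)
  obtain g h where gh:
    "\<forall>q p. ((\<lambda>t. f (t, p)) has_vector_derivative g (q, p)) (at q)"
    "\<forall>q p. ((\<lambda>t. f (q, t)) has_vector_derivative h (q, p)) (at p)"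
    "\<forall>k. C_k k g" "\<forall>k. C_k k h"
    using C_k_derivative[of f] assms by (auto simp: smooth_torus_def)
  have "g (q + 1, p) = g (q, p)" for q p
    by (rule derivative_periodic[of "\<lambda>t. f (t, p)" "\<lambda>t. g (t, p)"]) (use per gh in auto)
  moreover have "h (q, p + 1) = h (q, p)" for q p
    by (rule derivative_periodic[of "\<lambda>t. f (q, t)" "\<lambda>t. h (q, t)"]) (use per gh in auto)
  moreover have "g (q, p + 1) = g (q, p)" for q p
  proof -
    have "((\<lambda>t. f (t, p)) has_vector_derivative g (q, p + 1)) (at q)"
      using gh(1)[rule_format, of "p + 1" q] by (simp add: per)
    then show ?thesis by (rule vector_derivative_unique_at[OF _ gh(1)[rule_format]])
  qed
  moreover have "h (q + 1, p) = h (q, p)" for q p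
  proof -
    have "((\<lambda>t. f (q, t)) has_vector_derivative h (q + 1, p)) (at p)"
      using gh(2)[rule_format, of "q + 1" p] by (simp add: per)
    then show ?thesis by (rule vector_derivative_unique_at[OF _ gh(2)[rule_format]])
  qed
  ultimately show thesis using that[of g h] gh by (auto simp: smooth_torus_def)
qed

lemma smooth_torus_continuous: "smooth_torus f \<Longrightarrow> continuous_on A f"
  unfolding smooth_torus_def by (metis C_k.simps(1) continuous_on_subset subset_UNIV)

text \<open>Integration by parts; the boundary terms cancel because both \<open>F\<close> and the
  exponential take equal values at the two ends.\<close>

lemma integral_parts_periodic:
  fixes F G :: "real \<Rightarrow> complex" and \<omega> c :: real
  assumes per: "F 1 = F 0" "cis \<omega> = 1"
    and der: "\<And>t. (F has_vector_derivative G t) (at t)"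
    and G: "continuous_on UNIV G"
  shows "integral {0..1} (\<lambda>t. G t * cis (\<omega> * t + c)) = - \<i> * \<omega> * integral {0..1} (\<lambda>t. F t * cis (\<omega> * t + c))"
proof -
  let ?e = "\<lambda>t. cis (\<omega> * t + c)"
  have e: "(?e has_vector_derivative (\<i> * \<omega> * ?e t)) (at t within S)" for t S
  proof -
    have "(?e has_vector_derivative (\<omega> *\<^sub>R (\<i> * cis (\<omega> * t + c)))) (at t within S)"
      by (rule vector_diff_chain_within[of "\<lambda>t. \<omega> * t + c" \<omega> t S cis, unfolded comp_def])
         (auto intro!: derivative_eq_intros simp: has_vector_derivative_def scaleR_conv_of_real)
    then show ?thesis by (simp add: scaleR_conv_of_real mult_ac)
  qed
  have cF: "continuous_on {0..1} F"
    by (intro continuous_at_imp_continuous_on ballI has_vector_derivative_continuous[OF der])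
  have cG: "continuous_on {0..1} G" using G continuous_on_subset by blast
  have ce: "continuous_on {0..1} ?e" by (intro continuous_intros)
  have "((\<lambda>t. F t * (\<i> * \<omega> * ?e t) + G t * ?e t) has_integral (F 1 * ?e 1 - F 0 * ?e 0)) {0..1}"
  proof (rule fundamental_theorem_of_calculus)
    show "((\<lambda>t. F t * ?e t) has_vector_derivative F t * (\<i> * \<omega> * ?e t) + G t * ?e t) (at t within {0..1})" for t
      by (intro has_vector_derivative_mult e has_vector_derivative_at_within[OF der])
  qed simp
  moreover have "?e 1 = ?e 0"
    using per(2) by (simp add: cis_mult[symmetric])
  ultimately have "integral {0..1} (\<lambda>t. F t * (\<i> * \<omega> * ?e t) + G t * ?e t) = 0"
    using per(1) by (simp add: integral_unique)
  moreover have "integral {0..1} (\<lambda>t. F t * (\<i> * \<omega> * ?e t) + G t * ?e t)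
      = integral {0..1} (\<lambda>t. F t * (\<i> * \<omega> * ?e t)) + integral {0..1} (\<lambda>t. G t * ?e t)"
    by (intro Henstock_Kurzweil_Integration.integral_add integrable_continuous_interval continuous_intros cF cG ce)
  moreover have "integral {0..1} (\<lambda>t. F t * (\<i> * \<omega> * ?e t)) = \<i> * \<omega> * integral {0..1} (\<lambda>t. F t * ?e t)"
    by (subst integral_mult_right[symmetric]) (simp add: mult_ac)
  ultimately show ?thesis by (simp add: add_eq_0_iff)
qed

text \<open>Parts are integrated in the inner variable, so each partial derivative uses its own
  order of integration.\<close>

lemma fourier_coeff_iterated:
  assumes f: "continuous_on UNIV f"
  shows "fourier_coeff f (k1, k2)
      = integral {0..1} (\<lambda>q. integral {0..1} (\<lambda>p. f (q, p) * cis (- 2 * pi * (q * of_int k2 - p * of_int k1))))"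
    and "fourier_coeff f (k1, k2)
      = integral {0..1} (\<lambda>p. integral {0..1} (\<lambda>q. f (q, p) * cis (- 2 * pi * (q * of_int k2 - p * of_int k1))))"
proof -
  let ?F = "\<lambda>q p. f (q, p) * cis (- 2 * pi * (q * of_int k2 - p * of_int k1))"
  have "continuous_on UNIV (\<lambda>z. f z * cis (- 2 * pi * (fst z * of_int k2 - snd z * of_int k1)))"
    by (intro continuous_intros f)
  then have c: "continuous_on (cbox (0, 0) (1, 1)) (\<lambda>(q, p). ?F q p)"
    using continuous_on_subset[OF _ subset_UNIV] by (auto simp: case_prod_unfold)
  have "fourier_coeff f (k1, k2) = integral (cbox (0, 0) (1, 1)) (\<lambda>(q, p). ?F q p)"
    by (simp add: fourier_coeff_def torus_integral_def)
  also have "\<dots> = integral (cbox 0 1) (\<lambda>q. integral (cbox 0 1) (\<lambda>p. ?F q p))"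
    using integral_prod_continuous[OF c] by simp
  finally show 1: "fourier_coeff f (k1, k2) = integral {0..1} (\<lambda>q. integral {0..1} (\<lambda>p. ?F q p))"
    by simp
  show "fourier_coeff f (k1, k2) = integral {0..1} (\<lambda>p. integral {0..1} (\<lambda>q. ?F q p))"
    using integral_swap_continuous[OF c] 1 by simp
qed

lemma fourier_coeff_derivative_q:
  assumes f: "smooth_torus f" and g: "smooth_torus g"
    and der: "\<And>q p. ((\<lambda>t. f (t, p)) has_vector_derivative g (q, p)) (at q)"
  shows "cmod (fourier_coeff g (k1, k2)) = 2 * pi * \<bar>of_int k2\<bar> * cmod (fourier_coeff f (k1, k2))"
proof -
  let ?\<omega> = "- 2 * pi * of_int k2"
  have arg: "- 2 * pi * (q * of_int k2 - p * of_int k1) = ?\<omega> * q + 2 * pi * p * of_int k1" for q p :: real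
    by (simp add: algebra_simps)
  have "fourier_coeff g (k1, k2) = integral {0..1} (\<lambda>p. integral {0..1} (\<lambda>q. g (q, p) * cis (?\<omega> * q + 2 * pi * p * of_int k1)))"
    using fourier_coeff_iterated(2)[OF smooth_torus_continuous[OF g]] by (simp only: arg)
  also have "\<dots> = integral {0..1} (\<lambda>p. - \<i> * ?\<omega> * integral {0..1} (\<lambda>q. f (q, p) * cis (?\<omega> * q + 2 * pi * p * of_int k1)))"
  proof (intro integral_cong integral_parts_periodic)
    show "f (1, p) = f (0, p)" for p
    proof -
      have "f (0 + 1, p) = f (0, p)" using f unfolding smooth_torus_def by blast
      then show ?thesis by simp
    qed
    show "cis ?\<omega> = 1" using cis_multiple_2pi[of "- of_int k2"] by simp
    show "continuous_on UNIV (\<lambda>q. g (q, p))" for p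
      by (rule continuous_on_compose2[OF smooth_torus_continuous[OF g, of UNIV]]) (auto intro!: continuous_intros)
  qed (rule der)
  also have "\<dots> = - \<i> * ?\<omega> * integral {0..1} (\<lambda>p. integral {0..1} (\<lambda>q. f (q, p) * cis (?\<omega> * q + 2 * pi * p * of_int k1)))"
    by (rule integral_mult_right)
  also have "integral {0..1} (\<lambda>p. integral {0..1} (\<lambda>q. f (q, p) * cis (?\<omega> * q + 2 * pi * p * of_int k1))) = fourier_coeff f (k1, k2)"
    using fourier_coeff_iterated(2)[OF smooth_torus_continuous[OF f]] by (simp only: arg)
  finally show ?thesis by (simp add: norm_mult)
qed

lemma fourier_coeff_derivative_p:
  assumes f: "smooth_torus f" and h: "smooth_torus h"
    and der: "\<And>q p. ((\<lambda>t. f (q, t)) has_vector_derivative h (q, p)) (at p)"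
  shows "cmod (fourier_coeff h (k1, k2)) = 2 * pi * \<bar>of_int k1\<bar> * cmod (fourier_coeff f (k1, k2))"
proof -
  let ?\<omega> = "2 * pi * of_int k1"
  have arg: "- 2 * pi * (q * of_int k2 - p * of_int k1) = ?\<omega> * p + - 2 * pi * q * of_int k2" for q p :: real
    by (simp add: algebra_simps)
  have "fourier_coeff h (k1, k2) = integral {0..1} (\<lambda>q. integral {0..1} (\<lambda>p. h (q, p) * cis (?\<omega> * p + - 2 * pi * q * of_int k2)))"
    using fourier_coeff_iterated(1)[OF smooth_torus_continuous[OF h]] by (simp only: arg)
  also have "\<dots> = integral {0..1} (\<lambda>q. - \<i> * ?\<omega> * integral {0..1} (\<lambda>p. f (q, p) * cis (?\<omega> * p + - 2 * pi * q * of_int k2)))"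
  proof (intro integral_cong integral_parts_periodic)
    show "f (q, 1) = f (q, 0)" for q
    proof -
      have "f (q, 0 + 1) = f (q, 0)" using f unfolding smooth_torus_def by blast
      then show ?thesis by simp
    qed
    show "cis ?\<omega> = 1" using cis_multiple_2pi[of "of_int k1"] by simp
    show "continuous_on UNIV (\<lambda>p. h (q, p))" for q
      by (rule continuous_on_compose2[OF smooth_torus_continuous[OF h, of UNIV]]) (auto intro!: continuous_intros)
  qed (rule der)
  also have "\<dots> = - \<i> * ?\<omega> * integral {0..1} (\<lambda>q. integral {0..1} (\<lambda>p. f (q, p) * cis (?\<omega> * p + - 2 * pi * q * of_int k2)))"
    by (rule integral_mult_right)
  also have "integral {0..1} (\<lambda>q. integral {0..1} (\<lambda>p. f (q, p) * cis (?\<omega> * p + - 2 * pi * q * of_int k2))) = fourier_coeff f (k1, k2)"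
    using fourier_coeff_iterated(1)[OF smooth_torus_continuous[OF f]] by (simp only: arg)
  finally show ?thesis by (simp add: norm_mult)
qed

lemma fourier_coeff_bounded:
  assumes f: "smooth_torus f"
  shows "\<exists>C. \<forall>k. cmod (fourier_coeff f k) \<le> C"
proof -
  have "compact (f ` cbox (0, 0) (1, 1))"
    by (intro compact_continuous_image smooth_torus_continuous[OF f] compact_cbox)
  then obtain C where C: "\<And>z. z \<in> cbox (0, 0) (1, 1) \<Longrightarrow> cmod (f z) \<le> C"
    using compact_imp_bounded bounded_iff by (metis imageI)
  have "cmod (fourier_coeff f k) \<le> C" for k
  proof -
    obtain k1 k2 where k: "k = (k1, k2)" by (cases k)
    let ?F = "\<lambda>z. f z * cis (- 2 * pi * (fst z * of_int k2 - snd z * of_int k1))"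
    have "continuous_on (cbox (0, 0) (1, 1)) ?F"
      by (intro continuous_intros smooth_torus_continuous[OF f])
    then have "(?F has_integral integral (cbox (0, 0) (1, 1)) ?F) (cbox (0, 0) (1, 1))"
      by (intro integrable_integral integrable_continuous)
    moreover have "0 \<le> C"
    proof -
      have "cmod (f (0, 0)) \<le> C" by (rule C) simp
      then show ?thesis by (rule order_trans[OF norm_ge_zero])
    qed
    ultimately have "cmod (integral (cbox (0, 0) (1, 1)) ?F) \<le> C * measure lborel (cbox (0::real, 0::real) (1, 1))"
      using C by (intro has_integral_bound[of C ?F]) (auto simp: norm_mult)
    then show ?thesis
      by (simp add: k fourier_coeff_def torus_integral_def case_prod_unfold content_Pair)
  qed
  then show ?thesis by blast
qed

lemma fourier_coeff_decay_axis:
  assumes "smooth_torus f"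
  shows "\<exists>C. \<forall>k1 k2. cmod (fourier_coeff f (k1, k2)) * \<bar>of_int k2\<bar> ^ n \<le> C"
    and "\<exists>C. \<forall>k1 k2. cmod (fourier_coeff f (k1, k2)) * \<bar>of_int k1\<bar> ^ n \<le> C"
proof -
  have pi: "1 \<le> 2 * pi" using pi_ge_two by linarith
  show "\<exists>C. \<forall>k1 k2. cmod (fourier_coeff f (k1, k2)) * \<bar>of_int k2\<bar> ^ n \<le> C"
    using assms
  proof (induction n arbitrary: f)
    case 0
    then show ?case using fourier_coeff_bounded[of f] by auto
  next
    case (Suc n)
    obtain g where g: "smooth_torus g" "\<And>q p. ((\<lambda>t. f (t, p)) has_vector_derivative g (q, p)) (at q)"
      using smooth_torus_derivative[OF Suc.prems] by metis
    obtain C where C: "cmod (fourier_coeff g (k1, k2)) * \<bar>of_int k2\<bar> ^ n \<le> C" for k1 k2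
      using Suc.IH[OF g(1)] by blast
    have "cmod (fourier_coeff f (k1, k2)) * \<bar>of_int k2\<bar> ^ Suc n \<le> C" for k1 k2
    proof -
      let ?x = "cmod (fourier_coeff f (k1, k2)) * \<bar>of_int k2\<bar> ^ Suc n"
      have "?x \<le> 2 * pi * ?x" using pi mult_right_mono[of 1 "2 * pi" ?x] by simp
      also have "\<dots> = cmod (fourier_coeff g (k1, k2)) * \<bar>of_int k2\<bar> ^ n"
        by (simp add: fourier_coeff_derivative_q[OF Suc.prems g])
      also have "\<dots> \<le> C" by (rule C)
      finally show ?thesis .
    qed
    then show ?case by blast
  qed
  show "\<exists>C. \<forall>k1 k2. cmod (fourier_coeff f (k1, k2)) * \<bar>of_int k1\<bar> ^ n \<le> C"
    using assms
  proof (induction n arbitrary: f)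
    case 0
    then show ?case using fourier_coeff_bounded[of f] by auto
  next
    case (Suc n)
    obtain h where h: "smooth_torus h" "\<And>q p. ((\<lambda>t. f (q, t)) has_vector_derivative h (q, p)) (at p)"
      using smooth_torus_derivative[OF Suc.prems] by metis
    obtain C where C: "cmod (fourier_coeff h (k1, k2)) * \<bar>of_int k1\<bar> ^ n \<le> C" for k1 k2
      using Suc.IH[OF h(1)] by blast
    have "cmod (fourier_coeff f (k1, k2)) * \<bar>of_int k1\<bar> ^ Suc n \<le> C" for k1 k2
    proof -
      let ?x = "cmod (fourier_coeff f (k1, k2)) * \<bar>of_int k1\<bar> ^ Suc n"
      have "?x \<le> 2 * pi * ?x" using pi mult_right_mono[of 1 "2 * pi" ?x] by simp
      also have "\<dots> = cmod (fourier_coeff h (k1, k2)) * \<bar>of_int k1\<bar> ^ n"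
        by (simp add: fourier_coeff_derivative_p[OF Suc.prems h])
      also have "\<dots> \<le> C" by (rule C)
      finally show ?thesis .
    qed
    then show ?case by blast
  qed
qed

text \<open>The product weight is at most the square of \<open>2 * max 1 (max |k1| |k2|)\<close>, so
  its power \<open>n\<close> is controlled by pure derivatives of order \<open>2 * n\<close> in each
  variable.\<close>

lemma fourier_coeff_decay:
  assumes "smooth_torus f"
  shows "\<exists>C. \<forall>k. cmod (fourier_coeff f k) * weight k ^ n \<le> C"
proof -
  obtain C0 where C0: "\<And>k. cmod (fourier_coeff f k) \<le> C0"
    using fourier_coeff_bounded[OF assms] by blast
  obtain C1 where C1: "\<And>k1 k2. cmod (fourier_coeff f (k1, k2)) * \<bar>of_int k1\<bar> ^ (2 * n) \<le> C1"
    using fourier_coeff_decay_axis(2)[OF assms, of "2 * n"] by blast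
  obtain C2 where C2: "\<And>k1 k2. cmod (fourier_coeff f (k1, k2)) * \<bar>of_int k2\<bar> ^ (2 * n) \<le> C2"
    using fourier_coeff_decay_axis(1)[OF assms, of "2 * n"] by blast
  have "cmod (fourier_coeff f k) * weight k ^ n \<le> 2 ^ (2 * n) * (C0 + C1 + C2)" for k
  proof -
    obtain k1 k2 where k: "k = (k1, k2)" by (cases k)
    let ?a = "\<bar>real_of_int k1\<bar>" and ?b = "\<bar>real_of_int k2\<bar>" and ?c = "cmod (fourier_coeff f k)"
    define m where "m = max 1 (max ?a ?b)"
    have "weight k \<le> (2 * m) * (2 * m)"
      unfolding weight_def k fst_conv snd_conv by (intro mult_mono) (auto simp: m_def)
    then have "weight k ^ n \<le> ((2 * m) * (2 * m)) ^ n"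
      using weight_ge(1)[of k] by (intro power_mono) auto
    also have "\<dots> = 2 ^ (2 * n) * m ^ (2 * n)"
      by (simp only: power2_eq_square[symmetric] power_mult[symmetric] power_mult_distrib)
    also have "m ^ (2 * n) \<le> 1 + ?a ^ (2 * n) + ?b ^ (2 * n)"
    proof -
      have "m = 1 \<or> m = ?a \<or> m = ?b" by (auto simp: m_def max_def)
      then have "m ^ (2 * n) = 1 \<or> m ^ (2 * n) = ?a ^ (2 * n) \<or> m ^ (2 * n) = ?b ^ (2 * n)"
        by (elim disjE) (simp_all only: power_one simp_thms)
      moreover have "0 \<le> ?a ^ (2 * n)" "0 \<le> ?b ^ (2 * n)" by (simp_all only: zero_le_power abs_ge_zero)
      ultimately show ?thesis by linarith
    qed
    finally have "weight k ^ n \<le> 2 ^ (2 * n) * (1 + ?a ^ (2 * n) + ?b ^ (2 * n))" by simp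
    then have "?c * weight k ^ n \<le> ?c * (2 ^ (2 * n) * (1 + ?a ^ (2 * n) + ?b ^ (2 * n)))"
      by (rule mult_left_mono) simp
    also have "\<dots> = 2 ^ (2 * n) * (?c + ?c * ?a ^ (2 * n) + ?c * ?b ^ (2 * n))"
      by (simp add: algebra_simps)
    also have "\<dots> \<le> 2 ^ (2 * n) * (C0 + C1 + C2)"
      using C0[of k] C1[of k1 k2] C2[of k1 k2] k by (intro mult_left_mono add_mono) auto
    finally show ?thesis .
  qed
  then show ?thesis by blast
qed

section \<open>Summability over the frequency lattice\<close>

lemma summable_int_inverse_square: "(\<lambda>k::int. 1 / (1 + \<bar>of_int k\<bar>) ^ 2 :: real) summable_on UNIV"
proof -
  let ?f = "\<lambda>k::int. 1 / (1 + \<bar>of_int k\<bar>) ^ 2 :: real"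
  have "summable (\<lambda>n. inverse (real (Suc n) ^ 2))"
    by (subst summable_Suc_iff) (rule inverse_power_summable, simp)
  then have "(\<lambda>n::nat. inverse (real (Suc n) ^ 2)) summable_on UNIV"
    by (intro norm_summable_imp_summable_on) simp
  then have nat: "(\<lambda>n::nat. 1 / (1 + real n) ^ 2) summable_on UNIV"
    by (simp add: inverse_eq_divide add.commute)
  have "?f summable_on range int"
    using nat by (subst summable_on_reindex) (auto simp: comp_def)
  moreover have "?f summable_on range (\<lambda>n. - int n)"
    using nat by (subst summable_on_reindex) (auto simp: comp_def inj_on_def)
  ultimately have "?f summable_on (range int \<union> range (\<lambda>n. - int n))"
    by (rule summable_on_union)
  moreover have "range int \<union> range (\<lambda>n. - int n) = UNIV"
  proof (intro equalityI subsetI)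
    fix k :: int
    show "k \<in> range int \<union> range (\<lambda>n. - int n)" by (cases k rule: int_cases2) auto
  qed simp
  ultimately show ?thesis by simp
qed

lemma summable_weight: "(\<lambda>k. 1 / weight k ^ 2) summable_on UNIV"
proof -
  let ?f = "\<lambda>k::int. 1 / (1 + \<bar>of_int k\<bar>) ^ 2 :: real"
  have "(\<lambda>k. 1 / weight k ^ 2) summable_on (UNIV \<times> UNIV)"
  proof (rule summable_on_SigmaI)
    show "((\<lambda>y. 1 / weight (x, y) ^ 2) has_sum (?f x * infsum ?f UNIV)) UNIV" for x
      using has_sum_cmult_right[OF has_sum_infsum[OF summable_int_inverse_square], of "?f x"]
      by (simp add: weight_def power_mult_distrib)
    show "(\<lambda>x. ?f x * infsum ?f UNIV) summable_on UNIV"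
      by (rule summable_on_cmult_left[OF summable_int_inverse_square])
  qed simp
  then show ?thesis by simp
qed

text \<open>Two extra powers of the weight are spent on the summable inverse square.\<close>

lemma fourier_coeff_summable:
  assumes "smooth_torus f"
  shows "(\<lambda>k. cmod (fourier_coeff f k) * (weight k) ^ n) summable_on UNIV"
proof -
  obtain C where C: "\<And>k. cmod (fourier_coeff f k) * weight k ^ (n + 2) \<le> C"
    using fourier_coeff_decay[OF assms, of "n + 2"] by blast
  have "(\<lambda>k. C * (1 / weight k ^ 2)) summable_on UNIV"
    by (rule summable_on_cmult_right[OF summable_weight])
  then show ?thesis
  proof (rule summable_on_comparison_test)
    fix k
    have w: "0 < weight k" using weight_ge(1)[of k] by linarith
    have "cmod (fourier_coeff f k) * weight k ^ n * weight k ^ 2 \<le> C"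
      using C[of k] by (simp add: power_add mult_ac power2_eq_square)
    then show "cmod (fourier_coeff f k) * weight k ^ n \<le> C * (1 / weight k ^ 2)"
      using w by (simp add: field_simps)
    show "0 \<le> cmod (fourier_coeff f k) * weight k ^ n" using w by simp
  qed
qed

subsection \<open>Quantum variance\<close>

lemma has_sum_sum:
  fixes f :: "'a \<Rightarrow> 'b \<Rightarrow> 'c :: topological_comm_monoid_add"
  assumes "finite J" "\<And>j. j \<in> J \<Longrightarrow> (f j has_sum s j) A"
  shows "((\<lambda>k. \<Sum>j\<in>J. f j k) has_sum (\<Sum>j\<in>J. s j)) A"
  using assms by (induction J rule: finite_induct) (auto intro!: has_sum_add)

text \<open>Cauchy-Schwarz with the weight split as \<open>sqrt (c k) * sqrt (c k)\<close>, first on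
  finite sets and then in the limit. The result is linear in the squares of \<open>t\<close>, so it
  can be summed over the eigenbasis inside the series.\<close>

lemma has_sum_weighted_square_le:
  fixes f :: "'a \<Rightarrow> 'b :: real_normed_vector"
  assumes f: "(f has_sum s) A" and c: "(c has_sum C) A" and X: "((\<lambda>k. c k * (t k)\<^sup>2) has_sum X) A"
    and pos: "\<And>k. 0 \<le> c k" "\<And>k. 0 \<le> t k" and le: "\<And>k. norm (f k) \<le> c k * t k"
  shows "(norm s)\<^sup>2 \<le> C * X"
proof -
  have bound: "norm (sum f F) \<le> sqrt (C * X)" if F: "finite F" "F \<subseteq> A" for F
  proof (rule real_le_rsqrt)
    have "norm (sum f F) \<le> (\<Sum>k\<in>F. c k * t k)"
      by (rule order_trans[OF norm_sum sum_mono[OF le]])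
    also have "\<dots> = (\<Sum>k\<in>F. sqrt (c k) * (sqrt (c k) * t k))"
      using pos by (intro sum.cong refl) (simp add: mult.assoc[symmetric])
    finally have "(norm (sum f F))\<^sup>2 \<le> (\<Sum>k\<in>F. sqrt (c k) * (sqrt (c k) * t k))\<^sup>2"
      by (rule power_mono) simp
    also have "\<dots> \<le> (\<Sum>k\<in>F. (sqrt (c k))\<^sup>2) * (\<Sum>k\<in>F. (sqrt (c k) * t k)\<^sup>2)"
      by (rule Cauchy_Schwarz_ineq_sum)
    also have "\<dots> = (\<Sum>k\<in>F. c k) * (\<Sum>k\<in>F. c k * (t k)\<^sup>2)"
      using pos by (simp add: power_mult_distrib)
    also have "\<dots> \<le> C * X"
      using F pos by (intro mult_mono finite_sum_le_has_sum[OF c] finite_sum_le_has_sum[OF X] has_sum_nonneg[OF c] sum_nonneg) auto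
    finally show "(norm (sum f F))\<^sup>2 \<le> C * X" .
  qed
  have "((\<lambda>F. norm (sum f F)) \<longlongrightarrow> norm s) (finite_subsets_at_top A)"
    by (rule tendsto_norm[OF f[unfolded has_sum_def]])
  then have "norm s \<le> sqrt (C * X)"
  proof (rule tendsto_upperbound)
    show "\<forall>\<^sub>F F in finite_subsets_at_top A. norm (sum f F) \<le> sqrt (C * X)"
      by (rule eventually_finite_subsets_at_top_weakI) (rule bound)
  qed simp
  moreover have "0 \<le> C * X"
    using pos by (intro mult_nonneg_nonneg has_sum_nonneg[OF c] has_sum_nonneg[OF X]) auto
  ultimately show ?thesis by (metis norm_ge_zero power_mono real_sqrt_pow2)
qed

lemma weyl_translation_zero: "N > 0 \<Longrightarrow> weyl_translation N (0, 0) = 1\<^sub>m N"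
  by (rule eq_matI) (auto simp: weyl_translation_def)

lemma expect_weyl_op:
  assumes f: "smooth_torus f" and N: "N > 0" and onb: "orthonormal_basis_H N \<phi>" and j: "j < N"
  shows "((\<lambda>k. fourier_coeff f k * expect \<phi> (weyl_translation N k) j)
    has_sum (expect \<phi> (weyl_op N f) j)) UNIV"
proof -
  let ?T = "weyl_translation N"
  have T: "?T k \<in> carrier_mat N N" for k
    by (rule unitary_mat_carrier[OF unitary_weyl_translation[OF N]])
  have [simp]: "weyl_op N f \<in> carrier_mat N N" by (simp add: weyl_op_def)
  note phi = phi_carrier[OF N onb j]
  have entry: "((\<lambda>k. fourier_coeff f k * ?T k $$ (i, l)) has_sum (weyl_op N f $$ (i, l))) UNIV"
    if "i < N" "l < N" for i l
  proof -
    have "cmod (?T k $$ (i, l)) \<le> 1" for k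
      using that by (cases k) (auto simp: weyl_translation_def norm_mult)
    then have "norm (fourier_coeff f k * ?T k $$ (i, l)) \<le> cmod (fourier_coeff f k) * weight k ^ 0" for k
      by (simp add: norm_mult mult_left_le)
    then have "(\<lambda>k. norm (fourier_coeff f k * ?T k $$ (i, l))) summable_on UNIV"
      by (intro Infinite_Sum.abs_summable_on_comparison_test'[OF fourier_coeff_summable[OF f, of 0]]) simp
    then have "(\<lambda>k. fourier_coeff f k * ?T k $$ (i, l)) summable_on UNIV"
      by (rule abs_summable_summable)
    then show ?thesis using that by (simp add: weyl_op_def has_sum_infsum)
  qed
  have "((\<lambda>k. \<Sum>i<N. \<Sum>l<N. cnj (\<phi> j $ i) * (fourier_coeff f k * ?T k $$ (i, l)) * \<phi> j $ l)
      has_sum (\<Sum>i<N. \<Sum>l<N. cnj (\<phi> j $ i) * weyl_op N f $$ (i, l) * \<phi> j $ l)) UNIV"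
    by (intro has_sum_sum finite_lessThan has_sum_cmult_left has_sum_cmult_right entry) auto
  moreover have "(\<Sum>i<N. \<Sum>l<N. cnj (\<phi> j $ i) * weyl_op N f $$ (i, l) * \<phi> j $ l) = expect \<phi> (weyl_op N f) j"
    by (rule expect_sum[symmetric]) (use phi in auto)
  moreover have "(\<Sum>i<N. \<Sum>l<N. cnj (\<phi> j $ i) * (fourier_coeff f k * ?T k $$ (i, l)) * \<phi> j $ l)
      = fourier_coeff f k * expect \<phi> (?T k) j" for k
    unfolding expect_sum[where \<phi> = \<phi> and j = j, OF T phi] sum_distrib_left
    by (intro sum.cong refl) (simp only: mult_ac)
  ultimately show ?thesis by simp
qed

theorem theorem1p1:
  fixes a :: "real \<times> real \<Rightarrow> complex"
  assumes "smooth_torus a"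
  shows "\<exists>C::real. \<forall>(N::nat) \<phi>.
           even N \<longrightarrow> N \<ge> 2 \<longrightarrow> orthonormal_basis_H N \<phi> \<longrightarrow>
           (\<forall>j<N. \<exists>\<mu>. eigenvector (baker N) (\<phi> j) \<mu>) \<longrightarrow>
           quantum_variance a N \<phi> \<le> C / ln (real N)"
proof -
  \<comment> \<open>The zero frequency is set aside: its translation is the identity and contributes
    exactly the classical mean.\<close>
  let ?c = "\<lambda>k. cmod (fourier_coeff a k)" and ?I = "UNIV - {(0::int, 0::int)}"
  let ?K = "48 * weyl_const\<^sup>2"
  have sumI: "(\<lambda>k. ?c k * weight k ^ n) summable_on ?I" for n
    using fourier_coeff_summable[OF assms] by (rule summable_on_subset) simp
  define S0 where "S0 = infsum ?c ?I"
  define S2 where "S2 = infsum (\<lambda>k. ?c k * weight k ^ 2) ?I"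
  have S0: "(?c has_sum S0) ?I" using has_sum_infsum[OF sumI[of 0]] by (simp add: S0_def)
  have S2: "((\<lambda>k. ?c k * weight k ^ 2) has_sum S2) ?I" using has_sum_infsum[OF sumI[of 2]] by (simp add: S2_def)
  have "quantum_variance a N \<phi> \<le> S0 * (?K * S2) / ln (real N)"
    if N: "even N" "N \<ge> 2" and onb: "orthonormal_basis_H N \<phi>"
      and eig: "\<forall>j<N. \<exists>\<mu>. eigenvector (baker N) (\<phi> j) \<mu>" for N \<phi>
  proof -
    let ?T = "weyl_translation N" and ?e = "\<lambda>k j. expect \<phi> (weyl_translation N k) j"
    have N0: "N > 0" using N by simp
    have ln0: "0 < ln (real N)" using N by simp
    note carrier = unitary_mat_carrier[OF unitary_weyl_translation[OF N0]]
    have dim: "dim_row (?T k) = N" for k using carrier[of k] by auto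
    have rms_diag_sq: "(\<Sum>j<N. (cmod (?e k j))\<^sup>2) = real N * (rms_diag \<phi> (?T k))\<^sup>2" for k
      using N0 by (simp add: rms_diag_def dim power_divide L2_set_def sum_nonneg)
    \<comment> \<open>A crude bound that gives convergence of the series defining
      \<open>X\<close>.\<close>
    have e_le: "(cmod (?e k j))\<^sup>2 \<le> real N" if "j < N" for k j
    proof -
      have "(cmod (?e k j))\<^sup>2 \<le> (\<Sum>j<N. (cmod (?e k j))\<^sup>2)"
        using that by (intro member_le_sum) auto
      also have "\<dots> \<le> real N * 1"
        unfolding rms_diag_sq using rms_diag_unitary[OF N0 onb unitary_weyl_translation[OF N0]] rms_diag_nonneg[OF N0 onb]
        by (intro mult_left_mono power_le_one) auto
      finally show ?thesis by simp
    qed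
    define X where "X j = infsum (\<lambda>k. ?c k * (cmod (?e k j))\<^sup>2) ?I" for j
    have X: "((\<lambda>k. ?c k * (cmod (?e k j))\<^sup>2) has_sum X j) ?I" if "j < N" for j
    proof -
      have "(\<lambda>k. ?c k * real N) summable_on ?I"
        using has_sum_cmult_left[OF S0] by (rule has_sum_imp_summable)
      then have "(\<lambda>k. ?c k * (cmod (?e k j))\<^sup>2) summable_on ?I"
        by (rule summable_on_comparison_test) (simp_all add: mult_left_mono e_le[OF that])
      then show ?thesis unfolding X_def by (rule has_sum_infsum)
    qed
    have dev: "(cmod (inner_H (\<phi> j) (weyl_op N a *\<^sub>v \<phi> j) - torus_integral a))\<^sup>2 \<le> S0 * X j" if j: "j < N" for j
    proof (rule has_sum_weighted_square_le[OF _ S0 X[OF j]])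
      have "fourier_coeff a (0, 0) = torus_integral a"
        by (simp add: fourier_coeff_def case_prod_unfold)
      moreover have "?e (0, 0) j = 1"
        using phi_norm[OF N0 onb j] phi_carrier[OF N0 onb j] by (simp add: weyl_translation_zero[OF N0] expect_def)
      ultimately have "((\<lambda>k. fourier_coeff a k * ?e k j) has_sum torus_integral a) {(0, 0)}"
        by (intro has_sum_finiteI) auto
      then show "((\<lambda>k. fourier_coeff a k * ?e k j) has_sum
          (inner_H (\<phi> j) (weyl_op N a *\<^sub>v \<phi> j) - torus_integral a)) ?I"
        using has_sum_Diff[OF expect_weyl_op[OF assms N0 onb j]] by (simp add: expect_def)
    qed (auto simp: norm_mult)
    \<comment> \<open>The finite sum over the basis is taken inside the series, where for each
      frequency it is \<open>real N\<close> times a squared \<open>rms_diag\<close>.\<close>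
    have "(\<Sum>j<N. X j) \<le> real N * (?K * S2 / ln (real N))"
    proof (rule has_sum_mono)
      show "((\<lambda>k. \<Sum>j<N. ?c k * (cmod (?e k j))\<^sup>2) has_sum (\<Sum>j<N. X j)) ?I"
        by (intro has_sum_sum X) auto
      show "((\<lambda>k. real N * (?K * (?c k * weight k ^ 2) / ln (real N))) has_sum (real N * (?K * S2 / ln (real N)))) ?I"
        unfolding divide_inverse by (intro has_sum_cmult_right has_sum_cmult_left S2)
      fix k assume "k \<in> ?I"
      then have k: "k \<noteq> (0, 0)" by simp
      have "(\<Sum>j<N. ?c k * (cmod (?e k j))\<^sup>2) = ?c k * (real N * (rms_diag \<phi> (?T k))\<^sup>2)"
        by (simp only: sum_distrib_left[symmetric] rms_diag_sq)
      also have "\<dots> \<le> ?c k * (real N * (?K * (weight k)\<^sup>2 / ln (real N)))"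
        by (intro mult_left_mono rms_diag_weyl_translation_ln_le N onb eig k) auto
      finally show "(\<Sum>j<N. ?c k * (cmod (?e k j))\<^sup>2) \<le> real N * (?K * (?c k * weight k ^ 2) / ln (real N))"
        by (simp add: mult_ac)
    qed
    then have XN: "1 / real N * (\<Sum>j<N. X j) \<le> ?K * S2 / ln (real N)"
      using N0 by (simp add: divide_le_eq mult.commute)
    have S00: "0 \<le> S0" by (rule has_sum_nonneg[OF S0]) simp
    have "quantum_variance a N \<phi> \<le> 1 / real N * (\<Sum>j<N. S0 * X j)"
      unfolding quantum_variance_def by (intro mult_left_mono sum_mono dev) auto
    also have "\<dots> = S0 * (1 / real N * (\<Sum>j<N. X j))" by (simp add: sum_distrib_left[symmetric])
    also have "\<dots> \<le> S0 * (?K * S2 / ln (real N))" by (rule mult_left_mono[OF XN S00])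
    finally show ?thesis by simp
  qed
  then show ?thesis by blast
qed

end
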